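(* Let $k\ge 2$ be an integer and let $G$ be a (simple, connected) minimally $(k,k)$-edge-connected graph of order $n\geq 4k$. Then $$\rho(G) \leq \frac{\sqrt{4n-2k-4+2\sqrt{5k^2-8kn+4n^2-4k+4}}}{2},$$ with equality if and only if $G \cong K^{k-2}_{2, n-k}$.
   Context: All graphs are finite and simple. The order of a graph is its number of vertices. $\rho(G)$ denotes the spectral radius of $G$, i.e. the largest eigenvalue of its adjacency matrix $A(G)$. For an integer $l\ge 2$, the $l$-edge-connectivity $\kappa'_l(G)$ of a connected graph $G$ is the smallest number of edges whose removal leaves a graph with at least $l$ components if $|V(G)|\ge l$, and $\kappa'_l(G)=|V(G)|$ otherwise. (For $G-e$, which may be disconnected, $\kappa'_l(G-e)$ is given by the same formula.) A connected graph $G$ is $(k,l)$-edge-connected if $\kappa'_l(G)\ge k$; it is minimally $(k,l)$-edge-connected if $\kappa'_l(G)\ge k$ but $\kappa'_l(G-e)<k$ for every edge $e\in E(G)$. Here $l=k$. $K^{k-2}_{2,n-k}$ denotes the graph obtained from the disjoint union of the star $K_{1,k-2}$ and the complete bipartite graph $K_{2,n-k}$ by identifying the centre (the vertex of degree $k-2$) of $K_{1,k-2}$ with one of the two vertices of degree $n-k$ (a vertex in the part of size 2) of $K_{2,n-k}$; when $k=2$, $K_{1,0}$ is a single vertex. It has $n$ vertices. *)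

theory Defs
  imports Complex_Main "Jordan_Normal_Form.Char_Poly"
begin

(* A graph is a pair (V, E); an undirected edge joining u and v is the two-element set {u, v}. *)
type_synonym 'a graph = "'a set \<times> 'a set set"

definition verts :: "'a graph \<Rightarrow> 'a set" where
  "verts G = fst G"

definition edges :: "'a graph \<Rightarrow> 'a set set" where
  "edges G = snd G"

definition simple_graph :: "'a graph \<Rightarrow> bool" where
  "simple_graph G \<longleftrightarrow> finite (verts G) \<and> edges G \<subseteq> {e. e \<subseteq> verts G \<and> card e = 2}"

definition delete_edges :: "'a graph \<Rightarrow> 'a set set \<Rightarrow> 'a graph" where
  "delete_edges G F = (verts G, edges G - F)"

definition adj_rel :: "'a graph \<Rightarrow> ('a \<times> 'a) set" where
  "adj_rel G = {(u, v). {u, v} \<in> edges G}"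

definition graph_components :: "'a graph \<Rightarrow> 'a set set" where
  "graph_components G = verts G // ((adj_rel G)\<^sup>* \<inter> verts G \<times> verts G)"

definition connected_graph :: "'a graph \<Rightarrow> bool" where
  "connected_graph G \<longleftrightarrow> verts G \<noteq> {} \<and> (\<forall>u\<in>verts G. \<forall>v\<in>verts G. (u, v) \<in> (adj_rel G)\<^sup>*)"

(* G is not required to be connected here, so that this applies to a graph with an edge deleted. *)
definition edge_connectivity :: "nat \<Rightarrow> 'a graph \<Rightarrow> nat" where
  "edge_connectivity l G =
     (if l \<le> card (verts G)
      then (LEAST m. \<exists>F \<subseteq> edges G. card F = m \<and> l \<le> card (graph_components (delete_edges G F)))
      else card (verts G))"

definition edge_connected :: "nat \<Rightarrow> nat \<Rightarrow> 'a graph \<Rightarrow> bool" where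
  "edge_connected k l G \<longleftrightarrow> connected_graph G \<and> k \<le> edge_connectivity l G"

definition minimally_edge_connected :: "nat \<Rightarrow> nat \<Rightarrow> 'a graph \<Rightarrow> bool" where
  "minimally_edge_connected k l G \<longleftrightarrow>
     edge_connected k l G \<and> (\<forall>e\<in>edges G. edge_connectivity l (delete_edges G {e}) < k)"

(* Matrices are indexed by numbers, so the adjacency matrix is taken with respect to an
   enumeration of the vertices; its eigenvalues do not depend on the enumeration chosen. *)
definition vertex_list :: "'a graph \<Rightarrow> 'a list" where
  "vertex_list G = (SOME vs. distinct vs \<and> set vs = verts G)"

definition adjacency_matrix :: "'a graph \<Rightarrow> real mat" where
  "adjacency_matrix G =
     (let vs = vertex_list G; n = length vs
      in mat n n (\<lambda>(i, j). if {vs ! i, vs ! j} \<in> edges G then 1 else 0))"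

definition graph_spectral_radius :: "'a graph \<Rightarrow> real" where
  "graph_spectral_radius G = Max {x. eigenvalue (adjacency_matrix G) x}"

definition graph_iso :: "'a graph \<Rightarrow> 'b graph \<Rightarrow> bool" where
  "graph_iso G H \<longleftrightarrow>
     (\<exists>f. bij_betw f (verts G) (verts H) \<and>
          (\<forall>u\<in>verts G. \<forall>v\<in>verts G. {u, v} \<in> edges G \<longleftrightarrow> {f u, f v} \<in> edges H))"

(* The graph K^s_{2,t}: the vertices 0 and 1 form the part of size 2 of K_{2,t}, the vertices
   2, ..., t + 1 the other part; vertex 0 is also the centre of the star K_{1,s}, whose leaves
   are t + 2, ..., t + s + 1. *)
definition K2_star :: "nat \<Rightarrow> nat \<Rightarrow> nat graph" where
  "K2_star s t =
     ({..<t + s + 2},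
      {{h, m} | h m. h \<in> {0, 1} \<and> m \<in> {2..<t + 2}} \<union>
      {{0, l} | l. l \<in> {t + 2..<t + s + 2}})"

end

theory Submission
  imports Defs "HOL-Analysis.Function_Topology"
begin

text \<open>
  A connected graph is (k,k)-edge-connected iff it has at most k - 2 bridges, and minimality forces every
  non-bridge e to form a two-edge cut with at least k - 1 - b further edges, where b is the number of bridges.
  Being covered by cuts of size at most two is inherited by subgraphs and forbids three edge-disjoint paths
  one of which is an edge; such a graph containing a quadrangle has at most 2n - 4 - b edges.

  Let z be a nonnegative eigenvector for the spectral radius, with maximal entry 1 at u, and put s = k - 2,
  t = n - k. If b < s there are too few two-step walks from u. If b = s, their number is at most 2t + s,
  which exceeds the square of the claimed bound by at most s/2; hence some vertex v has at least t - 11s/12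
  common neighbours with u. Outside this complete bipartite graph and the vertices u, v the
  entries of z are below 1/2, so each remaining edge contributes at most 1 to the two-step walks from u and v
  together. The two resulting equations for the entries at u and v then give the bound, with equality only if
  all remaining edges are incident with u.
\<close>

section \<open>Reachability\<close>

text \<open>The square of the claimed bound is the larger root of (L - t)(L - t - s) = t^2, the
  equation that the four vertex classes of the extremal graph impose on L = \<rho>^2. This root lies
  between 2t + s/2 and 2t + s, and for s > 0 strictly below 2t + s. The walk count stops at 2t + s,
  so it cannot give the bound; it only locates v, and the exact comparison is left to the equations
  at u and v, where the quadratic reappears.

  Inequality and equality case are proved at once: the spectral radius is assumed to be at least the
  bound, and its value and the structure of the graph are derived. The assumption supplies \<rho>^2
  \<ge> 2t + s/2, which makes the walk counts rigid.

  The condition n \<ge> 4k enters as t \<ge> 3s + 6; it keeps the slack s/2 small against t and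
  makes \<rho> large enough to damp the entries away from u and v. The quadrangle in the edge count
  matters: a triangle has 3 > 2 * 3 - 4 edges. Hence a vertex with two common neighbours with u must
  first be found from the spectral assumption.\<close>

definition conn :: "'a set set \<Rightarrow> 'a \<Rightarrow> 'a \<Rightarrow> bool" where
  "conn E x y \<longleftrightarrow> (x, y) \<in> {(u, v). {u, v} \<in> E}\<^sup>*"

lemma conn_refl [simp]: "conn E x x"
  by (simp add: conn_def)

lemma conn_edge: "{x, y} \<in> E \<Longrightarrow> conn E x y"
  by (auto simp: conn_def)

lemma conn_trans [trans]: "conn E x y \<Longrightarrow> conn E y z \<Longrightarrow> conn E x z"
  unfolding conn_def by (rule rtrancl_trans)

lemma conn_sym: "conn E x y \<Longrightarrow> conn E y x"
  unfolding conn_def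
  by (rule symD[OF sym_rtrancl]) (auto simp: sym_def insert_commute)

lemma conn_mono: "conn E x y \<Longrightarrow> E \<subseteq> F \<Longrightarrow> conn F x y"
  unfolding conn_def by (rule subsetD[OF rtrancl_mono]) auto

lemma conn_induct [consumes 1, case_names refl step]:
  assumes "conn E x y" "P x"
    "\<And>y z. conn E x y \<Longrightarrow> P y \<Longrightarrow> {y, z} \<in> E \<Longrightarrow> P z"
  shows "P y"
  using assms(1) unfolding conn_def
  by (induct rule: rtrancl_induct) (use assms(2,3) in \<open>auto simp: conn_def\<close>)

lemma conn_subst:
  assumes "conn E x y" "\<And>a b. {a, b} \<in> E \<Longrightarrow> conn F a b"
  shows "conn F x y"
  using assms(1)
proof (induct rule: conn_induct)
  case (step y z)
  show ?case using conn_trans[OF step(2) assms(2)[OF step(3)]] .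
qed simp

text \<open>A walk can be shortened until it uses the new edge at most once, in one of the two
  directions.\<close>

lemma conn_insert:
  "conn (insert {a, b} S) x y \<longleftrightarrow>
     conn S x y \<or> (conn S x a \<and> conn S b y) \<or> (conn S x b \<and> conn S a y)" (is "?l \<longleftrightarrow> ?r x y")
proof
  assume ?l
  then show "?r x y"
  proof (induct rule: conn_induct)
    case (step y z)
    show ?case
    proof (cases "{y, z} \<in> S")
      case True
      then have "conn S y z" by (rule conn_edge)
      with step(2) show ?thesis by (meson conn_trans)
    next
      case False
      with step(3) have "y = a \<and> z = b \<or> y = b \<and> z = a" by (auto simp: doubleton_eq_iff)
      with step(2) show ?thesis by (metis conn_refl conn_sym conn_trans)
    qed
  qed simp
next
  assume r: "?r x y"
  have m: "conn (insert {a, b} S) p q" if "conn S p q" for p q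
    using that by (rule conn_mono) auto
  have e: "conn (insert {a, b} S) a b" by (rule conn_edge) simp
  from r consider "conn S x y" | "conn S x a" "conn S b y" | "conn S x b" "conn S a y" by blast
  then show ?l
  proof cases
    case 1 then show ?thesis by (rule m)
  next
    case 2 show ?thesis by (rule conn_trans[OF m[OF 2(1)] conn_trans[OF e m[OF 2(2)]]])
  next
    case 3 show ?thesis by (rule conn_trans[OF m[OF 3(1)] conn_trans[OF conn_sym[OF e] m[OF 3(2)]]])
  qed
qed

lemma conn_empty [simp]: "conn {} x y \<longleftrightarrow> x = y"
  by (auto simp: conn_def)

text \<open>If pq reconnects x and y, its ends lie in the two different components of x and y, and
  so xy reconnects p and q. This exchange makes "forms a two-edge cut with" a symmetric relation
  between edges.\<close>

lemma cut_swap: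
  assumes "\<not> conn S x y" "conn (insert {p, q} S) x y"
  shows "\<not> conn S p q" "conn (insert {x, y} S) p q"
proof -
  from assms consider "conn S x p" "conn S q y" | "conn S x q" "conn S p y"
    unfolding conn_insert by blast
  then have "\<not> conn S p q \<and> conn (insert {x, y} S) p q"
  proof cases
    case 1
    have "\<not> conn S p q" using assms(1) conn_trans[OF 1(1) conn_trans[OF _ 1(2)]] by blast
    with 1 show ?thesis unfolding conn_insert by (auto intro: conn_sym)
  next
    case 2
    have "\<not> conn S p q" using assms(1) conn_trans[OF 2(1) conn_trans[OF conn_sym 2(2)]] by blast
    with 2 show ?thesis unfolding conn_insert by (auto intro: conn_sym)
  qed
  then show "\<not> conn S p q" "conn (insert {x, y} S) p q" by auto
qed

section \<open>Bridges and the number of components\<close>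

definition bridges :: "'a set set \<Rightarrow> 'a set set" where
  "bridges E = {e \<in> E. \<forall>x y. e = {x, y} \<longrightarrow> \<not> conn (E - {e}) x y}"

lemma bridges_subset: "bridges E \<subseteq> E"
  by (auto simp: bridges_def)

lemma bridge_iff: "{x, y} \<in> bridges E \<longleftrightarrow> {x, y} \<in> E \<and> \<not> conn (E - {{x, y}}) x y"
  unfolding bridges_def using conn_sym[of "E - {{x, y}}" y x]
  by (auto simp: doubleton_eq_iff insert_commute)

lemma bridge_mono:
  assumes "e \<in> bridges E" "e \<in> F" "F \<subseteq> E"
  shows "e \<in> bridges F"
proof -
  have "conn (F - {e}) x y \<Longrightarrow> conn (E - {e}) x y" for x y
    by (erule conn_mono) (use assms in auto)
  then show ?thesis using assms unfolding bridges_def by blast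
qed

definition ncomp :: "'a set \<Rightarrow> 'a set set \<Rightarrow> nat" where
  "ncomp V E = card ((\<lambda>x. {y \<in> V. conn E x y}) ` V)"

lemma comp_eq_iff:
  assumes "x \<in> V" "y \<in> V"
  shows "{z \<in> V. conn E x z} = {z \<in> V. conn E y z} \<longleftrightarrow> conn E x y"
proof
  assume "{z \<in> V. conn E x z} = {z \<in> V. conn E y z}"
  with assms(2) have "y \<in> {z \<in> V. conn E x z}" by simp
  then show "conn E x y" by simp
next
  assume "conn E x y"
  then have "conn E x z \<longleftrightarrow> conn E y z" for z by (meson conn_trans conn_sym)
  then show "{z \<in> V. conn E x z} = {z \<in> V. conn E y z}" by simp
qed

lemma ncomp_empty [simp]: "finite V \<Longrightarrow> ncomp V {} = card V"
  unfolding ncomp_def by (rule card_image) (auto simp: inj_on_def)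

lemma ncomp_connected:
  assumes "V \<noteq> {}" "\<And>x y. x \<in> V \<Longrightarrow> y \<in> V \<Longrightarrow> conn E x y"
  shows "ncomp V E = 1"
proof -
  have "(\<lambda>x. {y \<in> V. conn E x y}) ` V = {V}" using assms by auto
  then show ?thesis by (simp add: ncomp_def)
qed

lemma ncomp_insert_conn:
  assumes "conn S a b"
  shows "ncomp V (insert {a, b} S) = ncomp V S"
proof -
  have "conn (insert {a, b} S) x y \<longleftrightarrow> conn S x y" for x y
    unfolding conn_insert
    using conn_trans[OF _ conn_trans[OF assms, of y], of x]
      conn_trans[OF _ conn_trans[OF conn_sym[OF assms], of y], of x] by blast
  then show ?thesis by (simp add: ncomp_def)
qed

text \<open>The classes of a and b disappear and their union, which is none of the remaining
  classes, is added.\<close>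

lemma ncomp_insert_not_conn:
  assumes "finite V" "a \<in> V" "b \<in> V" "\<not> conn S a b"
  shows "Suc (ncomp V (insert {a, b} S)) = ncomp V S"
proof -
  define K where "K E x = {y \<in> V. conn E x y}" for E :: "'a set set" and x
  let ?S = "insert {a, b} S"
  let ?R = "K S ` V - {K S a, K S b}"
  have ab: "K S a \<noteq> K S b" using assms comp_eq_iff[of a V b S] by (simp add: K_def)
  have Kx: "K ?S x = (if conn S x a \<or> conn S x b then K S a \<union> K S b else K S x)" if "x \<in> V" for x
  proof -
    have "conn ?S x y \<longleftrightarrow> (if conn S x a \<or> conn S x b then conn S a y \<or> conn S b y else conn S x y)" for y
      unfolding conn_insert using conn_trans[of S x a y] conn_trans[of S x b y]
        conn_trans[of S a x y] conn_trans[of S b x y] conn_sym[of S x a] conn_sym[of S x b] by auto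
    then show ?thesis by (auto simp: K_def)
  qed
  have eqa: "K S x = K S a \<longleftrightarrow> conn S x a" "K S x = K S b \<longleftrightarrow> conn S x b" if "x \<in> V" for x
    using comp_eq_iff[OF that assms(2), of S] comp_eq_iff[OF that assms(3), of S]
    by (simp_all add: K_def)
  have 1: "K ?S ` V = insert (K S a \<union> K S b) ?R"
  proof (intro subset_antisym subsetI)
    fix X assume "X \<in> K ?S ` V"
    then show "X \<in> insert (K S a \<union> K S b) ?R" using Kx eqa by (auto split: if_splits)
  next
    fix X assume "X \<in> insert (K S a \<union> K S b) ?R"
    then consider "X = K S a \<union> K S b" | x where "x \<in> V" "X = K S x" "X \<noteq> K S a" "X \<noteq> K S b" by auto
    then show "X \<in> K ?S ` V"
    proof cases
      case 1 then show ?thesis using Kx[OF assms(2)] assms(2) by auto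
    next
      case 2
      then have "K ?S x = X" using Kx eqa by auto
      with 2 show ?thesis by auto
    qed
  qed
  have aK: "a \<in> K S a" using assms by (simp add: K_def)
  have 2: "K S a \<union> K S b \<notin> ?R"
  proof
    assume "K S a \<union> K S b \<in> ?R"
    then obtain x where x: "x \<in> V" "K S a \<union> K S b = K S x" "K S x \<noteq> K S a" by auto
    then have "a \<in> K S x" using aK by blast
    then have "conn S x a" by (simp add: K_def)
    with x eqa show False by blast
  qed
  have fin: "finite (K S ` V)" using assms by simp
  have sub: "{K S a, K S b} \<subseteq> K S ` V" using assms by auto
  have "card {K S a, K S b} \<le> card (K S ` V)" by (rule card_mono[OF fin sub])
  then have ge: "2 \<le> card (K S ` V)" using ab by simp
  have "card (K ?S ` V) = Suc (card ?R)" unfolding 1 using 2 fin by simp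
  also have "card ?R = card (K S ` V) - 2"
    using card_Diff_subset[OF _ sub] ab by simp
  finally show ?thesis using ge by (simp add: ncomp_def K_def)
qed

locale fin_graph =
  fixes V :: "'a set" and E :: "'a set set"
  assumes fin: "finite V" and sub: "E \<subseteq> {e. e \<subseteq> V \<and> card e = 2}"
begin

lemma edgeD: "{x, y} \<in> E \<Longrightarrow> x \<in> V \<and> y \<in> V \<and> x \<noteq> y"
  using sub by (auto simp: card_2_iff)

lemma edge_ex: "e \<in> E \<Longrightarrow> \<exists>x y. e = {x, y} \<and> x \<in> V \<and> y \<in> V \<and> x \<noteq> y"
proof -
  assume "e \<in> E"
  then have "e \<subseteq> V" "card e = 2" using sub by auto
  then show ?thesis unfolding card_2_iff by blast
qed

lemma finE: "finite E"
  by (rule finite_subset[of _ "Pow V"]) (use fin sub in auto)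

lemma subgraph: "F \<subseteq> E \<Longrightarrow> fin_graph V F"
  using fin sub by unfold_locales auto

lemma ncomp_remove_bridges:
  assumes "F \<subseteq> bridges E"
  shows "ncomp V (E - F) = ncomp V E + card F"
proof -
  have "finite F" using assms bridges_subset finE by (meson finite_subset)
  then show ?thesis using assms
  proof (induct F)
    case (insert e F)
    obtain x y where e: "e = {x, y}" "x \<in> V" "y \<in> V"
      using insert.prems bridges_subset edge_ex[of e] by auto
    have eE: "e \<in> E" using insert.prems bridges_subset by auto
    have "\<not> conn (E - {e}) x y" using insert.prems e by (auto simp: bridge_iff)
    then have "\<not> conn (E - insert e F) x y" using conn_mono[of "E - insert e F" x y "E - {e}"] by blast
    from ncomp_insert_not_conn[OF fin e(2,3) this]
    have "Suc (ncomp V (insert e (E - insert e F))) = ncomp V (E - insert e F)" using e by simp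
    moreover have "insert e (E - insert e F) = E - F" using eE insert.hyps by auto
    ultimately show ?case using insert by simp
  qed simp
qed

lemma ncomp_remove_le:
  assumes "F \<subseteq> E"
  shows "ncomp V (E - F) \<le> ncomp V E + card F"
proof -
  have "finite F" using assms finE by (meson finite_subset)
  then show ?thesis using assms
  proof (induct F)
    case (insert e F)
    obtain x y where e: "e = {x, y}" "x \<in> V" "y \<in> V"
      using insert.prems edge_ex[of e] by auto
    have *: "insert e (E - insert e F) = E - F" using insert by auto
    have "ncomp V (E - insert e F) \<le> Suc (ncomp V (E - F))"
      using ncomp_insert_not_conn[OF fin e(2,3), of "E - insert e F"]
        ncomp_insert_conn[of "E - insert e F" x y V] * e by (cases "conn (E - insert e F) x y") auto
    then show ?case using insert by simp
  qed simp
qed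

lemma ncomp_remove_nonbridge:
  assumes "e \<in> E" "e \<notin> bridges E"
  shows "ncomp V (E - {e}) = ncomp V E"
proof -
  obtain x y where e: "e = {x, y}" using assms(1) edge_ex by blast
  then have "conn (E - {{x, y}}) x y" using assms by (auto simp: bridge_iff)
  from ncomp_insert_conn[OF this, of V] show ?thesis using assms(1) e by (simp add: insert_absorb)
qed

end

section \<open>Graphs all of whose edges lie in edge cuts of size at most two\<close>

text \<open>The edge f may lie outside E. Thus every bridge satisfies the condition with an
  arbitrary f, and the condition passes to subgraphs in which f has been deleted.\<close>

definition two_cuts :: "'a set set \<Rightarrow> bool" where
  "two_cuts E \<longleftrightarrow>
     (\<forall>x y. {x, y} \<in> E \<longrightarrow> (\<exists>f. f \<noteq> {x, y} \<and> \<not> conn (E - {{x, y}, f}) x y))"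

lemma not_conn_mono: "\<not> conn F x y \<Longrightarrow> E \<subseteq> F \<Longrightarrow> \<not> conn E x y"
  by (metis conn_mono)

lemma two_cuts_mono:
  assumes "two_cuts E" "F \<subseteq> E"
  shows "two_cuts F"
  unfolding two_cuts_def
proof (intro allI impI)
  fix x y assume "{x, y} \<in> F"
  then obtain f where f: "f \<noteq> {x, y}" "\<not> conn (E - {{x, y}, f}) x y"
    using assms(1)[unfolded two_cuts_def] subsetD[OF assms(2)] by meson
  have "\<not> conn (F - {{x, y}, f}) x y"
    by (rule not_conn_mono[OF f(2) Diff_mono[OF assms(2) order_refl]])
  with f(1) show "\<exists>f. f \<noteq> {x, y} \<and> \<not> conn (F - {{x, y}, f}) x y" by blast
qed

text \<open>Besides xy only one edge f is deleted, and f cannot meet both of the disjoint sets A and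
  B. The local structure lemmas on common neighbours exploit the two-edge cuts only in this
  form.\<close>

lemma two_cuts_no_three:
  assumes "two_cuts E" "{x, y} \<in> E" "conn A x y" "conn B x y" "A \<subseteq> E" "B \<subseteq> E"
    "{x, y} \<notin> A" "{x, y} \<notin> B" "A \<inter> B = {}"
  shows False
proof -
  obtain f where f: "\<not> conn (E - {{x, y}, f}) x y"
    using assms(1,2) unfolding two_cuts_def by meson
  have "f \<notin> A \<or> f \<notin> B" using assms(9) by blast
  then have "A \<subseteq> E - {{x, y}, f} \<or> B \<subseteq> E - {{x, y}, f}" using assms(5-8) by blast
  then show False using f conn_mono[OF assms(3)] conn_mono[OF assms(4)] by meson
qed

lemma conn_path2: "{a, b} \<in> S \<Longrightarrow> {b, c} \<in> S \<Longrightarrow> conn S a c"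
  by (rule conn_trans[OF conn_edge conn_edge])

lemma conn_path3: "{a, b} \<in> S \<Longrightarrow> {b, c} \<in> S \<Longrightarrow> {c, d} \<in> S \<Longrightarrow> conn S a d"
  by (rule conn_trans[OF conn_path2 conn_edge])

lemma conn_path4:
  "{a, b} \<in> S \<Longrightarrow> {b, c} \<in> S \<Longrightarrow> {c, d} \<in> S \<Longrightarrow> {d, e} \<in> S \<Longrightarrow> conn S a e"
  by (rule conn_trans[OF conn_path3 conn_edge])

context fin_graph
begin

text \<open>Extend three edges of the quadrangle to a spanning tree. Every edge outside the tree is paired
  with a tree edge which together with it forms a cut; distinct edges get distinct partners, no partner
  is a bridge, and two of the three quadrangle edges in the tree are nobody's partner.\<close>

lemma sparse_quadrangle:
  assumes tc: "two_cuts E" and con: "\<And>x y. x \<in> V \<Longrightarrow> y \<in> V \<Longrightarrow> conn E x y"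
    and q: "{a, b} \<in> E" "{b, c} \<in> E" "{c, d} \<in> E" "{d, a} \<in> E" "a \<noteq> c" "b \<noteq> d"
  shows "card E + card (bridges E) + 4 \<le> 2 * card V"
proof -
  define G3 where "G3 = {{a, b}, {b, c}, {c, d}}"
  note dist = edgeD[OF q(1)] edgeD[OF q(2)] edgeD[OF q(3)] edgeD[OF q(4)] q(5,6)
  have G3E: "G3 \<subseteq> E" using q by (auto simp: G3_def)
  have cG3: "card G3 = 3" using dist by (auto simp: G3_def doubleton_eq_iff)
  have hG3: "{d, a} \<notin> G3" using dist by (auto simp: G3_def doubleton_eq_iff)
  \<comment> \<open>A maximal removable set \<open>D\<close> leaves the required tree
    \<open>T\<close>. That \<open>T\<close> is a tree appears only as the count \<open>cT\<close>:
    all its edges outside \<open>G3\<close> are bridges of \<open>T\<close>, and \<open>G3\<close>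
    alone has \<open>card V - 3\<close> components.\<close>
  define \<D> where "\<D> = {D. D \<subseteq> E \<and> D \<inter> G3 = {} \<and> (\<forall>x\<in>V. \<forall>y\<in>V. conn (E - D) x y)}"
  have "finite \<D>" using finE by (auto simp: \<D>_def)
  moreover have "{} \<in> \<D>" using con by (simp add: \<D>_def)
  ultimately obtain D where D: "D \<in> \<D>" and Dmax: "\<And>D'. D' \<in> \<D> \<Longrightarrow> D \<subseteq> D' \<Longrightarrow> D = D'"
    using finite_has_maximal[of \<D>] by blast
  define T where "T = E - D"
  have DE: "D \<subseteq> E" "D \<inter> G3 = {}" and conT: "\<And>x y. x \<in> V \<Longrightarrow> y \<in> V \<Longrightarrow> conn T x y"
    using D by (auto simp: \<D>_def T_def)
  have TE: "T \<subseteq> E" and G3T: "G3 \<subseteq> T" using DE G3E by (auto simp: T_def)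
  interpret T: fin_graph V T using subgraph[OF TE] .
  have br: "T - G3 \<subseteq> bridges T"
  proof
    fix t assume t: "t \<in> T - G3"
    then obtain x y where xy: "t = {x, y}" using T.edge_ex by blast
    have "\<not> conn (T - {{x, y}}) x y"
    proof
      assume c: "conn (T - {{x, y}}) x y"
      have all: "conn (T - {t}) v w" if "v \<in> V" "w \<in> V" for v w
      proof (rule conn_subst[OF conT[OF that]])
        fix p r assume "{p, r} \<in> T"
        then show "conn (T - {t}) p r"
          using c xy by (cases "{p, r} = t") (auto simp: doubleton_eq_iff intro: conn_edge conn_sym)
      qed
      have "E - insert t D = T - {t}" by (auto simp: T_def)
      moreover have "insert t D \<subseteq> E" "insert t D \<inter> G3 = {}" using t DE TE by auto
      ultimately have "insert t D \<in> \<D>" using all unfolding \<D>_def by simp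
      then have "D = insert t D" by (rule Dmax) auto
      then show False using t by (auto simp: T_def)
    qed
    then show "t \<in> bridges T" using t xy by (simp add: bridge_iff)
  qed
  have "V \<noteq> {}" using dist by auto
  then have nT: "ncomp V T = 1" using conT by (rule ncomp_connected)
  have "Suc (Suc (Suc (ncomp V G3))) = card V"
  proof -
    have "Suc (ncomp V {{c, d}}) = card V"
      using ncomp_insert_not_conn[OF fin, of c d "{}"] dist fin by simp
    moreover have "Suc (ncomp V {{b, c}, {c, d}}) = ncomp V {{c, d}}"
      using ncomp_insert_not_conn[OF fin, of b c "{{c, d}}"] dist
      by (simp add: conn_insert[of c d "{}"])
    moreover have "Suc (ncomp V G3) = ncomp V {{b, c}, {c, d}}"
      using ncomp_insert_not_conn[OF fin, of a b "{{b, c}, {c, d}}"] dist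
      by (auto simp add: conn_insert[of c d "{}"] conn_insert[of b c "{{c, d}}"] G3_def)
    ultimately show ?thesis by simp
  qed
  moreover have "ncomp V G3 = 1 + card (T - G3)"
    using T.ncomp_remove_bridges[OF br] nT G3T by (simp add: Int_absorb1 double_diff)
  moreover have "card (T - G3) = card T - 3" "3 \<le> card T"
    using card_Diff_subset[of G3 T] G3T T.finE cG3 card_mono[OF T.finE G3T]
    by (auto intro: finite_subset)
  ultimately have cT: "card T + 1 = card V" by simp
  have hD: "{d, a} \<in> D"
  proof (rule ccontr)
    assume "{d, a} \<notin> D"
    then have "{d, a} \<in> bridges T" using br hG3 q(4) by (auto simp: T_def)
    moreover have "conn (T - {{d, a}}) a d"
      by (rule conn_path3[of a b _ c]) (use G3T hG3 in \<open>auto simp: G3_def\<close>)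
    ultimately show False by (auto simp: bridge_iff dest: conn_sym)
  qed
  \<comment> \<open>The partner must not depend on the order of the two ends of \<open>e\<close>, so
    that it can be chosen as a function of the edge.\<close>
  have "\<exists>f. f \<noteq> e \<and> (\<forall>x y. e = {x, y} \<longrightarrow> \<not> conn (E - {e, f}) x y)" if eD: "e \<in> D" for e
  proof -
    obtain x y where xy: "e = {x, y}" using eD DE edge_ex[of e] by auto
    then obtain f where "f \<noteq> e" "\<not> conn (E - {e, f}) x y"
      using tc subsetD[OF DE(1) eD] xy unfolding two_cuts_def by meson
    then show ?thesis using xy by (auto simp: doubleton_eq_iff dest: conn_sym)
  qed
  then obtain \<phi> where \<phi>: "\<And>e. e \<in> D \<Longrightarrow> \<phi> e \<noteq> e"
    "\<And>x y. {x, y} \<in> D \<Longrightarrow> \<not> conn (E - {{x, y}, \<phi> {x, y}}) x y"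
    by metis
  \<comment> \<open>Since \<open>T\<close> is connected, the cut formed by \<open>e\<close> and its
    partner has to contain an edge of \<open>T\<close>, and \<open>e\<close> is not one.\<close>
  have \<phi>T: "\<phi> {x, y} \<in> T" if e: "{x, y} \<in> D" for x y
  proof (rule ccontr)
    assume "\<phi> {x, y} \<notin> T"
    then have "T \<subseteq> E - {{x, y}, \<phi> {x, y}}" using e by (auto simp: T_def)
    moreover have "x \<in> V" "y \<in> V" using edgeD[OF subsetD[OF DE(1) e]] by auto
    ultimately show False using \<phi>(2)[OF e] conn_mono[OF conT] by meson
  qed
  have swap: "\<not> conn (E - {{x, y}, {p, r}}) p r" "conn (E - {{p, r}}) p r"
    if e: "{x, y} \<in> D" and f: "\<phi> {x, y} = {p, r}" for x y p r
  proof -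
    let ?S = "E - {{x, y}, {p, r}}"
    have 1: "\<not> conn ?S x y" using \<phi>(2)[OF e] f by simp
    have "x \<in> V" "y \<in> V" using edgeD[of x y] e DE by auto
    then have "conn T x y" by (rule conT)
    then have 2: "conn (insert {p, r} ?S) x y" by (rule conn_mono) (use e in \<open>auto simp: T_def\<close>)
    show "\<not> conn ?S p r" by (rule cut_swap(1)[OF 1 2])
    have "conn (insert {x, y} ?S) p r" by (rule cut_swap(2)[OF 1 2])
    then show "conn (E - {{p, r}}) p r"
      by (rule conn_mono) (use e DE \<phi>(1)[OF e] f in auto)
  qed
  have \<phi>nb: "\<phi> e \<notin> bridges E" if eD: "e \<in> D" for e
  proof -
    obtain x y where xy: "e = {x, y}" using eD DE edge_ex[of e] by auto
    obtain p r where pr: "\<phi> e = {p, r}" using \<phi>T[of x y] eD xy TE edge_ex[of "\<phi> e"] by auto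
    show ?thesis using swap(2)[of x y p r] that xy pr by (simp add: bridge_iff)
  qed
  \<comment> \<open>If \<open>e\<close> is not the closing edge, the three other edges of the
    quadrangle survive the deletion of \<open>e\<close> and its partner and still join the ends of
    the partner.\<close>
  have \<phi>G3: "e = {d, a}" if eD: "e \<in> D" and eG: "\<phi> e \<in> G3" for e
  proof (rule ccontr)
    assume ne: "e \<noteq> {d, a}"
    obtain x y where xy: "e = {x, y}" using eD DE edge_ex[of e] by auto
    have eG': "e \<notin> G3" using that DE by auto
    have n: "e \<noteq> {a, b}" "e \<noteq> {b, c}" "e \<noteq> {c, d}" using eG' by (auto simp: G3_def)
    have nn: "{a, b} \<noteq> {b, c}" "{a, b} \<noteq> {c, d}" "{a, b} \<noteq> {d, a}" "{b, c} \<noteq> {c, d}" "{b, c} \<noteq> {d, a}"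
      "{c, d} \<noteq> {d, a}" using dist by (auto simp: doubleton_eq_iff)
    consider "\<phi> e = {a, b}" | "\<phi> e = {b, c}" | "\<phi> e = {c, d}" using eG by (auto simp: G3_def)
    then show False
    proof cases
      case 1
      have "conn (E - {e, {a, b}}) b a" by (rule conn_path3[of b c _ d]) (use q n nn ne in auto)
      with swap(1)[of x y a b] 1 xy that show False by (auto dest: conn_sym)
    next
      case 2
      have "conn (E - {e, {b, c}}) c b" by (rule conn_path3[of c d _ a]) (use q n nn ne in auto)
      with swap(1)[of x y b c] 2 xy that show False by (auto dest: conn_sym)
    next
      case 3
      have "conn (E - {e, {c, d}}) d c" by (rule conn_path3[of d a _ b]) (use q n nn ne in auto)
      with swap(1)[of x y c d] 3 xy that show False by (auto dest: conn_sym)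
    qed
  qed
  \<comment> \<open>A common partner pr splits \<open>T\<close> into two sides, and both
    \<open>e\<close> and \<open>e'\<close> run between them. After deleting \<open>e\<close> and pr
    the edge \<open>e'\<close> still joins the sides, so the ends of \<open>e\<close> stay
    connected.\<close>
  have inj: "inj_on \<phi> D"
  proof (rule inj_onI, rule ccontr)
    fix e e' assume e: "e \<in> D" "e' \<in> D" "\<phi> e = \<phi> e'" "e \<noteq> e'"
    obtain x y where xy: "e = {x, y}" using e DE edge_ex[of e] by auto
    obtain x' y' where xy': "e' = {x', y'}" using e DE edge_ex[of e'] by auto
    obtain p r where pr: "\<phi> e = {p, r}" using \<phi>T[of x y] e xy TE edge_ex[of "\<phi> e"] by auto
    let ?S = "T - {{p, r}}"
    have V: "x \<in> V" "y \<in> V" "x' \<in> V" "y' \<in> V"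
      using edgeD[of x y] edgeD[of x' y'] e DE xy xy' by auto
    have ins: "insert {p, r} ?S = T" using \<phi>T[of x y] e xy pr by auto
    have nc: "\<not> conn ?S x y"
    proof (rule not_conn_mono)
      show "\<not> conn (E - {{x, y}, {p, r}}) x y" using \<phi>(2)[of x y] e xy pr by simp
    qed (use e xy in \<open>auto simp: T_def\<close>)
    have nc': "\<not> conn ?S x' y'"
    proof (rule not_conn_mono)
      show "\<not> conn (E - {{x', y'}, {p, r}}) x' y'" using \<phi>(2)[of x' y'] e xy' pr by simp
    qed (use e xy' in \<open>auto simp: T_def\<close>)
    have A: "conn ?S x p \<and> conn ?S r y \<or> conn ?S x r \<and> conn ?S p y"
      using conT[OF V(1,2)] nc ins conn_insert[of p r ?S x y] by auto
    have B: "conn ?S x' p \<and> conn ?S r y' \<or> conn ?S x' r \<and> conn ?S p y'"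
      using conT[OF V(3,4)] nc' ins conn_insert[of p r ?S x' y'] by auto
    let ?R = "E - {{x, y}, {p, r}}"
    have m: "conn ?S v w \<Longrightarrow> conn ?R v w" for v w
      by (erule conn_mono) (use e xy in \<open>auto simp: T_def\<close>)
    have e'R: "conn ?R x' y'" by (rule conn_edge) (use e xy xy' pr DE \<phi>(1)[of e'] in auto)
    have pr': "conn ?R p r"
      using B conn_trans[OF conn_sym[OF m] conn_trans[OF e'R conn_sym[OF m]]]
        conn_trans[OF m conn_trans[OF conn_sym[OF e'R] m]] by meson
    have "conn ?R x y"
      using A conn_trans[OF m conn_trans[OF pr' m]]
        conn_trans[OF m conn_trans[OF conn_sym[OF pr'] m]] by meson
    then show False using \<phi>(2)[of x y] e xy pr by simp
  qed
  have bT: "bridges E \<subseteq> T"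
  proof
    fix e assume e: "e \<in> bridges E"
    then obtain x y where xy: "e = {x, y}" "x \<in> V" "y \<in> V" using bridges_subset edge_ex by blast
    show "e \<in> T"
    proof (rule ccontr)
      assume "e \<notin> T"
      then have "T \<subseteq> E - {e}" by (auto simp: T_def)
      then have "conn (E - {{x, y}}) x y" using conn_mono[OF conT[OF xy(2,3)]] xy(1) by simp
      then show False using e xy by (simp add: bridge_iff)
    qed
  qed
  have bG3: "bridges E \<inter> G3 = {}"
  proof -
    have nn: "{a, b} \<noteq> {b, c}" "{a, b} \<noteq> {c, d}" "{a, b} \<noteq> {d, a}" "{b, c} \<noteq> {c, d}" "{b, c} \<noteq> {d, a}"
      "{c, d} \<noteq> {d, a}" using dist by (auto simp: doubleton_eq_iff)
    have "conn (E - {{a, b}}) b a" by (rule conn_path3[of b c _ d]) (use q nn in auto)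
    moreover have "conn (E - {{b, c}}) c b" by (rule conn_path3[of c d _ a]) (use q nn in auto)
    moreover have "conn (E - {{c, d}}) d c" by (rule conn_path3[of d a _ b]) (use q nn in auto)
    ultimately show ?thesis by (auto simp: G3_def bridge_iff dest: conn_sym)
  qed
  have fD: "finite D" using DE finE by (meson finite_subset)
  have fG: "finite G3" by (simp add: G3_def)
  have fb: "finite (bridges E)" using bT T.finE by (meson finite_subset)
  have \<phi>DT: "\<phi> ` D \<subseteq> T" using \<phi>T DE edge_ex by blast
  \<comment> \<open>Inside the tree, with |V| - 1 edges, lie the b bridges and, disjoint from them,
    the partners together with \<open>G3\<close>. Only the closing edge can have its partner in
    \<open>G3\<close>, so the latter union has at least |D| + 2 elements; hence |D| \<le> |V| - 3 -
    b.\<close>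
  have "card (bridges E) + card (\<phi> ` D \<union> G3) = card (bridges E \<union> (\<phi> ` D \<union> G3))"
    by (rule card_Un_disjoint[symmetric]) (use fb fD fG bG3 \<phi>nb in auto)
  also have "\<dots> \<le> card T" by (rule card_mono[OF T.finE]) (use bT \<phi>DT G3T in auto)
  finally have 1: "card (bridges E) + card (\<phi> ` D \<union> G3) \<le> card T" .
  have "card (\<phi> ` D \<inter> G3) \<le> card {\<phi> {d, a}}" by (rule card_mono) (use \<phi>G3 in auto)
  then have 2: "card (\<phi> ` D) + card G3 \<le> card (\<phi> ` D \<union> G3) + 1"
    using card_Un_Int[of "\<phi> ` D" G3] fD fG by simp
  have 3: "card D + card T = card E"
    using card_Diff_subset[OF fD DE(1)] card_mono[OF finE DE(1)] by (simp add: T_def)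
  show ?thesis using 1 2 3 cT cG3 card_image[OF inj] by linarith
qed

end

section \<open>The largest eigenvalue of a symmetric matrix\<close>

text \<open>Vectors are functions on the whole type that vanish off V. The sphere is then a closed
  subset of a product of compact sets, and compactness is Tychonoff's theorem.\<close>

lemma compact_sphere:
  fixes V :: "'a set"
  assumes "finite V"
  shows "compact {f :: 'a \<Rightarrow> real. (\<forall>x. x \<notin> V \<longrightarrow> f x = 0) \<and> (\<Sum>x\<in>V. (f x)\<^sup>2) = 1}" (is "compact ?S")
proof -
  define B where "B x = (if x \<in> V then {-1..1} else {0 :: real})" for x
  have "compactin (product_topology (\<lambda>_. euclidean) UNIV) (PiE UNIV B)"
    by (auto simp: compactin_PiE B_def)
  then have c: "compact (PiE UNIV B)"
    by (simp add: euclidean_product_topology)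
  have "continuous_on UNIV (\<lambda>f :: 'a \<Rightarrow> real. \<Sum>x\<in>V. (f x)\<^sup>2)"
    by (intro continuous_intros continuous_on_product_coordinates)
  then have "closed ((\<lambda>f :: 'a \<Rightarrow> real. \<Sum>x\<in>V. (f x)\<^sup>2) -` {1})"
    by (rule closed_vimage[rotated]) simp
  then have "compact (PiE UNIV B \<inter> ((\<lambda>f :: 'a \<Rightarrow> real. \<Sum>x\<in>V. (f x)\<^sup>2) -` {1}))"
    using c by blast
  also have "PiE UNIV B \<inter> ((\<lambda>f :: 'a \<Rightarrow> real. \<Sum>x\<in>V. (f x)\<^sup>2) -` {1}) = ?S"
  proof (intro subset_antisym subsetI)
    fix f assume "f \<in> ?S"
    then have f: "\<And>x. x \<notin> V \<Longrightarrow> f x = 0" "(\<Sum>x\<in>V. (f x)\<^sup>2) = 1" by auto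
    have "f x \<in> {-1..1}" if "x \<in> V" for x
    proof -
      have "(f x)\<^sup>2 \<le> (\<Sum>x\<in>V. (f x)\<^sup>2)" by (rule member_le_sum[OF that _ assms]) simp
      then have "\<bar>f x\<bar> \<le> 1" using f(2) by (simp add: abs_square_le_1)
      then show ?thesis by auto
    qed
    with f show "f \<in> PiE UNIV B \<inter> ((\<lambda>f. \<Sum>x\<in>V. (f x)\<^sup>2) -` {1})" by (auto simp: B_def)
  next
    fix f assume f: "f \<in> PiE UNIV B \<inter> ((\<lambda>f. \<Sum>x\<in>V. (f x)\<^sup>2) -` {1})"
    have "f x = 0" if "x \<notin> V" for x
    proof -
      have "f x \<in> B x" using f by auto
      with that show ?thesis by (simp add: B_def)
    qed
    with f show "f \<in> ?S" by auto
  qed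
  finally show ?thesis .
qed

text \<open>The absolute value of a maximizer of the quadratic form on the unit sphere is again a maximizer,
  and a maximizer is an eigenvector because the first variation vanishes.\<close>

lemma nonneg_top_eigenvector:
  fixes A :: "'a \<Rightarrow> 'a \<Rightarrow> real"
  assumes V: "finite V" "V \<noteq> {}" and symm: "\<And>x y. A x y = A y x" and nonneg: "\<And>x y. 0 \<le> A x y"
  shows "\<exists>m z. (\<forall>x. 0 \<le> z x) \<and> (\<exists>x\<in>V. z x \<noteq> 0) \<and> (\<forall>x\<in>V. m * z x = (\<Sum>y\<in>V. A x y * z y)) \<and>
    (\<forall>\<mu> f. (\<exists>x\<in>V. f x \<noteq> 0) \<and> (\<forall>x\<in>V. \<mu> * f x = (\<Sum>y\<in>V. A x y * f y)) \<longrightarrow> \<mu> \<le> m)"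
proof -
  define q where "q f = (\<Sum>x\<in>V. \<Sum>y\<in>V. A x y * f x * f y)" for f :: "'a \<Rightarrow> real"
  define nn where "nn f = (\<Sum>x\<in>V. (f x)\<^sup>2)" for f :: "'a \<Rightarrow> real"
  define S where "S = {f :: 'a \<Rightarrow> real. (\<forall>x. x \<notin> V \<longrightarrow> f x = 0) \<and> (\<Sum>x\<in>V. (f x)\<^sup>2) = 1}"
  have cS: "compact S" unfolding S_def by (rule compact_sphere[OF V(1)])
  have S: "f \<in> S \<longleftrightarrow> (\<forall>x. x \<notin> V \<longrightarrow> f x = 0) \<and> nn f = 1" for f
    by (simp add: S_def nn_def)
  obtain v where v: "v \<in> V" using V by blast
  have "(\<lambda>x. if x = v then 1 else 0) \<in> S"
  proof -
    have "(\<Sum>x\<in>V. (if x = v then 1 else 0 :: real)\<^sup>2) = (\<Sum>x\<in>V. if x = v then 1 else 0)"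
      by (intro sum.cong) auto
    then show ?thesis using v V by (auto simp: S nn_def)
  qed
  then have ne: "S \<noteq> {}" by (metis empty_iff)
  have cq: "continuous_on S q"
    unfolding q_def
    by (intro continuous_intros continuous_on_subset[OF continuous_on_product_coordinates]) auto
  obtain f where f: "f \<in> S" "\<And>g. g \<in> S \<Longrightarrow> q g \<le> q f"
    using continuous_attains_sup[OF cS ne cq] by metis
  define m where "m = q f"
  have nn0: "nn g \<ge> 0" for g unfolding nn_def by (intro sum_nonneg) auto
  have nnz: "nn g = 0 \<longleftrightarrow> (\<forall>x\<in>V. g x = 0)" for g
    unfolding nn_def using V by (subst sum_nonneg_eq_0_iff) auto
  \<comment> \<open>By homogeneity the maximality on the sphere extends to all vectors; for a vector
    that vanishes on V both sides are 0.\<close>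
  have le: "q g \<le> m * nn g" for g
  proof (cases "nn g = 0")
    case True
    then have "q g = 0" unfolding q_def by (intro sum.neutral ballI) (simp add: nnz)
    then show ?thesis using True by simp
  next
    case False
    then have pos: "nn g > 0" using nn0[of g] by linarith
    define c where "c = sqrt (nn g)"
    have c: "c > 0" "c\<^sup>2 = nn g" using pos by (auto simp: c_def)
    define h where "h x = (if x \<in> V then g x / c else 0)" for x
    have "(\<Sum>x\<in>V. (h x)\<^sup>2) = nn g / c\<^sup>2"
      unfolding nn_def h_def sum_divide_distrib by (intro sum.cong) (auto simp: power_divide)
    then have "nn h = 1" using c pos by (simp add: nn_def)
    then have "h \<in> S" by (simp add: S h_def)
    then have "q h \<le> m" unfolding m_def by (rule f(2))
    moreover have "q h = q g / c\<^sup>2"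
      unfolding q_def h_def sum_divide_distrib by (intro sum.cong) (auto simp: power2_eq_square)
    ultimately show ?thesis using c pos by (simp add: field_simps)
  qed
  define z where "z x = \<bar>f x\<bar>" for x
  have nz: "nn z = 1" using f(1) by (simp add: S nn_def z_def)
  have "q f \<le> q z"
    unfolding q_def z_def
  proof (intro sum_mono)
    fix x y
    have "A x y * f x * f y \<le> \<bar>A x y * f x * f y\<bar>" by simp
    also have "\<dots> = A x y * \<bar>f x\<bar> * \<bar>f y\<bar>" using nonneg[of x y] by (simp add: abs_mult)
    finally show "A x y * f x * f y \<le> A x y * \<bar>f x\<bar> * \<bar>f y\<bar>" .
  qed
  then have qz: "q z = m" using le[of z] nz by (simp add: m_def)
  have eig: "m * z x = (\<Sum>y\<in>V. A x y * z y)" if x: "x \<in> V" for x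
  proof -
    define r where "r = (\<Sum>y\<in>V. A x y * z y) - m * z x"
    define \<delta> where "\<delta> y = (if y = x then 1 else 0 :: real)" for y
    have d: "(\<Sum>y\<in>V. g y * \<delta> y) = g x" for g :: "'a \<Rightarrow> real"
    proof -
      have "(\<Sum>y\<in>V. g y * \<delta> y) = (\<Sum>y\<in>V. if y = x then g y else 0)"
        by (intro sum.cong) (auto simp: \<delta>_def)
      then show ?thesis using x V by simp
    qed
    have q\<delta>: "q (\<lambda>y. z y + t * \<delta> y) = q z + 2 * t * (\<Sum>y\<in>V. A x y * z y) + t\<^sup>2 * A x x" for t
    proof -
      have "q (\<lambda>y. z y + t * \<delta> y) = (\<Sum>p\<in>V. \<Sum>y\<in>V. A p y * z p * z y)
          + t * (\<Sum>p\<in>V. \<Sum>y\<in>V. A p y * z p * \<delta> y) + t * (\<Sum>p\<in>V. \<Sum>y\<in>V. A p y * \<delta> p * z y)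
          + t\<^sup>2 * (\<Sum>p\<in>V. \<Sum>y\<in>V. A p y * \<delta> p * \<delta> y)"
        unfolding q_def sum_distrib_left sum.distrib[symmetric]
        by (intro sum.cong) (auto simp: algebra_simps power2_eq_square)
      moreover have "(\<Sum>p\<in>V. \<Sum>y\<in>V. A p y * z p * \<delta> y) = (\<Sum>p\<in>V. A x p * z p)"
        by (intro sum.cong refl) (simp add: d symm[of x])
      moreover have "(\<Sum>p\<in>V. \<Sum>y\<in>V. A p y * \<delta> p * z y) = (\<Sum>y\<in>V. A x y * z y)"
      proof (subst sum.swap, intro sum.cong refl)
        fix y
        show "(\<Sum>p\<in>V. A p y * \<delta> p * z y) = A x y * z y"
          using d[of "\<lambda>p. A p y * z y"] by (simp add: mult.commute mult.left_commute)
      qed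
      moreover have "(\<Sum>p\<in>V. \<Sum>y\<in>V. A p y * \<delta> p * \<delta> y) = A x x"
        by (simp add: d)
      ultimately show ?thesis by (simp add: q_def)
    qed
    have n\<delta>: "nn (\<lambda>y. z y + t * \<delta> y) = nn z + 2 * t * z x + t\<^sup>2" for t
    proof -
      have "nn (\<lambda>y. z y + t * \<delta> y) = (\<Sum>y\<in>V. (z y)\<^sup>2) + 2 * t * (\<Sum>y\<in>V. z y * \<delta> y) + t\<^sup>2 * (\<Sum>y\<in>V. \<delta> y * \<delta> y)"
        unfolding nn_def sum_distrib_left sum.distrib[symmetric]
        by (intro sum.cong) (auto simp: algebra_simps power2_eq_square)
      moreover have "(\<Sum>y\<in>V. z y * \<delta> y) = z x" "(\<Sum>y\<in>V. \<delta> y * \<delta> y) = 1"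
        using d[of z] d[of \<delta>] by (auto simp: \<delta>_def)
      ultimately show ?thesis by (simp add: nn_def)
    qed
    have key: "2 * t * r \<le> t\<^sup>2 * (m - A x x)" for t
      using le[of "\<lambda>y. z y + t * \<delta> y"] unfolding q\<delta> n\<delta> qz nz r_def by (simp add: algebra_simps)
    have "r = 0"
    proof (rule ccontr)
      assume r: "r \<noteq> 0"
      \<comment> \<open>With b above \<open>m - A x x\<close>, the step t = r/b makes the
        first-order gain 2tr larger than the second-order term unless r = 0.\<close>
      define b where "b = \<bar>m - A x x\<bar> + 1"
      have b: "b > 0" "m - A x x < b" by (auto simp: b_def)
      have "2 * (r / b) * r \<le> (r / b)\<^sup>2 * (m - A x x)" by (rule key)
      also have "\<dots> < (r / b)\<^sup>2 * b" using r b by (intro mult_strict_left_mono) auto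
      also have "\<dots> = (r / b) * r" using b by (simp add: power2_eq_square)
      finally have "(r / b) * r < 0" by simp
      moreover have "(r / b) * r \<ge> 0" using b by (simp add: zero_le_divide_iff)
      ultimately show False by simp
    qed
    then show ?thesis by (simp add: r_def)
  qed
  have top: "\<mu> \<le> m" if g: "\<exists>x\<in>V. g x \<noteq> 0" "\<forall>x\<in>V. \<mu> * g x = (\<Sum>y\<in>V. A x y * g y)" for \<mu> g
  proof -
    have "q g = (\<Sum>x\<in>V. g x * (\<Sum>y\<in>V. A x y * g y))"
      unfolding q_def sum_distrib_left by (intro sum.cong) auto
    also have "\<dots> = (\<Sum>x\<in>V. g x * (\<mu> * g x))" using g(2) by (intro sum.cong) auto
    also have "\<dots> = \<mu> * nn g" unfolding nn_def sum_distrib_left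
      by (intro sum.cong) (auto simp: power2_eq_square)
    finally have "\<mu> * nn g \<le> m * nn g" using le[of g] by simp
    moreover have "nn g > 0" using nn0[of g] nnz[of g] g(1) by force
    ultimately show ?thesis by simp
  qed
  have "\<exists>x\<in>V. z x \<noteq> 0" using nz nnz[of z] by auto
  moreover have "\<forall>x. 0 \<le> z x" by (simp add: z_def)
  ultimately show ?thesis using eig top by blast
qed

section \<open>Eigenvectors as functions on the vertices\<close>

definition nbrs :: "'a set set \<Rightarrow> 'a \<Rightarrow> 'a set" where
  "nbrs E x = {y. {x, y} \<in> E}"

text \<open>Keeping eigenvectors on the vertices instead of on indices frees everything after
  \<open>spectral_radius_eigenfun\<close> from the arbitrary enumeration in
  \<open>vertex_list\<close>.\<close>

definition eigenfun :: "'a set \<Rightarrow> 'a set set \<Rightarrow> real \<Rightarrow> ('a \<Rightarrow> real) \<Rightarrow> bool" where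
  "eigenfun V E \<mu> f \<longleftrightarrow>
     (\<exists>x\<in>V. f x \<noteq> 0) \<and> (\<forall>x\<in>V. \<mu> * f x = (\<Sum>y\<in>nbrs E x. f y))"

lemma simple_graph_fin_graph: "simple_graph G \<longleftrightarrow> fin_graph (verts G) (edges G)"
  by (simp add: simple_graph_def fin_graph_def)

lemma (in fin_graph) nbrs_subset: "nbrs E x \<subseteq> V"
  using edgeD by (auto simp: nbrs_def)

lemma (in fin_graph) sum_nbrs:
  fixes f :: "'a \<Rightarrow> real"
  shows "(\<Sum>y\<in>nbrs E x. f y) = (\<Sum>y\<in>V. of_bool ({x, y} \<in> E) * f y)"
proof -
  have "(\<Sum>y\<in>nbrs E x. f y) = (\<Sum>y\<in>nbrs E x. of_bool ({x, y} \<in> E) * f y)"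
    by (intro sum.cong) (auto simp: nbrs_def)
  also have "\<dots> = (\<Sum>y\<in>V. of_bool ({x, y} \<in> E) * f y)"
    by (rule sum.mono_neutral_left) (use fin nbrs_subset in \<open>auto simp: nbrs_def\<close>)
  finally show ?thesis .
qed

lemma eigenvalue_adjacency_matrix:
  assumes "simple_graph G"
  shows "eigenvalue (adjacency_matrix G) \<mu> \<longleftrightarrow> (\<exists>f. eigenfun (verts G) (edges G) \<mu> f)"
proof -
  interpret fin_graph "verts G" "edges G" using assms by (simp add: simple_graph_fin_graph)
  define vs where "vs = vertex_list G"
  have "\<exists>vs. distinct vs \<and> set vs = verts G" using finite_distinct_list[OF fin] by blast
  from someI_ex[OF this] have vs: "distinct vs" "set vs = verts G"
    by (simp_all add: vs_def vertex_list_def)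
  define n where "n = length vs"
  have bij: "bij_betw ((!) vs) {0..<n} (verts G)"
    using bij_betw_nth[OF vs(1), of "{0..<n}" "verts G"] vs(2) by (auto simp: n_def lessThan_atLeast0)
  have vsV: "vs ! i \<in> verts G" if "i < n" for i
    using nth_mem[of i vs] that unfolding vs(2) n_def by simp
  have vsE: "\<exists>j<n. x = vs ! j" if "x \<in> verts G" for x
    using that in_set_conv_nth[of x vs] unfolding vs(2) n_def by metis
  have A: "adjacency_matrix G = mat n n (\<lambda>(i, j). if {vs ! i, vs ! j} \<in> edges G then 1 else 0)"
    unfolding adjacency_matrix_def Let_def n_def vs_def ..
  have step: "(adjacency_matrix G *\<^sub>v v) $ i = (\<Sum>y\<in>nbrs (edges G) (vs ! i). f y)"
    if "i < n" "dim_vec v = n" "\<And>j. j < n \<Longrightarrow> f (vs ! j) = v $ j" for v i and f :: "'a \<Rightarrow> real"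
  proof -
    have "(adjacency_matrix G *\<^sub>v v) $ i = (\<Sum>j\<in>{0..<n}. of_bool ({vs ! i, vs ! j} \<in> edges G) * f (vs ! j))"
    proof -
      have "(adjacency_matrix G *\<^sub>v v) $ i = (\<Sum>j\<in>{0..<n}. row (adjacency_matrix G) i $ j * v $ j)"
        using that(1,2) by (simp add: A scalar_prod_def)
      also have "\<dots> = (\<Sum>j\<in>{0..<n}. of_bool ({vs ! i, vs ! j} \<in> edges G) * f (vs ! j))"
        by (intro sum.cong refl) (use that in \<open>simp add: A\<close>)
      finally show ?thesis .
    qed
    also have "\<dots> = (\<Sum>y\<in>verts G. of_bool ({vs ! i, y} \<in> edges G) * f y)"
      by (rule sum.reindex_bij_betw[OF bij])
    finally show ?thesis by (simp add: sum_nbrs)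
  qed
  show ?thesis
  proof
    assume "eigenvalue (adjacency_matrix G) \<mu>"
    then obtain v where v: "v \<in> carrier_vec n" "v \<noteq> 0\<^sub>v n" "adjacency_matrix G *\<^sub>v v = \<mu> \<cdot>\<^sub>v v"
      unfolding eigenvalue_def eigenvector_def by (auto simp: A)
    define f where "f x = v $ (inv_into {0..<n} ((!) vs) x)" for x
    have f: "f (vs ! j) = v $ j" if "j < n" for j
      using that bij by (simp add: f_def bij_betw_def inv_into_f_f)
    have "\<exists>i<n. v $ i \<noteq> 0"
    proof (rule ccontr)
      assume "\<not> ?thesis"
      then have "v = 0\<^sub>v n" using v(1) by (intro eq_vecI) auto
      with v(2) show False by simp
    qed
    then obtain i where i: "i < n" "v $ i \<noteq> 0" by blast
    have "\<exists>x\<in>verts G. f x \<noteq> 0" using vsV[OF i(1)] f[OF i(1)] i(2) by metis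
    moreover have "\<mu> * f x = (\<Sum>y\<in>nbrs (edges G) x. f y)" if xV: "x \<in> verts G" for x
    proof -
      obtain j where j: "j < n" "x = vs ! j" using vsE[OF xV] by blast
      have "(\<mu> \<cdot>\<^sub>v v) $ j = \<mu> * f x" using j v(1) f by simp
      then show ?thesis using step[of j v f] v f j by simp
    qed
    ultimately show "\<exists>f. eigenfun (verts G) (edges G) \<mu> f" unfolding eigenfun_def by blast
  next
    assume "\<exists>f. eigenfun (verts G) (edges G) \<mu> f"
    then obtain f where f: "\<exists>x\<in>verts G. f x \<noteq> 0"
      "\<And>x. x \<in> verts G \<Longrightarrow> \<mu> * f x = (\<Sum>y\<in>nbrs (edges G) x. f y)"
      unfolding eigenfun_def by blast
    define v where "v = vec n (\<lambda>i. f (vs ! i))"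
    obtain x where x: "x \<in> verts G" "f x \<noteq> 0" using f(1) by blast
    obtain j where j: "j < n" "x = vs ! j" using vsE[OF x(1)] by blast
    have "v \<noteq> 0\<^sub>v n"
    proof
      assume "v = 0\<^sub>v n"
      then have "v $ j = 0" using j by simp
      with x j show False by (simp add: v_def)
    qed
    moreover have "adjacency_matrix G *\<^sub>v v = \<mu> \<cdot>\<^sub>v v"
    proof (rule eq_vecI)
      fix i assume "i < dim_vec (\<mu> \<cdot>\<^sub>v v)"
      then have i: "i < n" by (simp add: v_def)
      from f(2)[OF vsV[OF this]] show "(adjacency_matrix G *\<^sub>v v) $ i = (\<mu> \<cdot>\<^sub>v v) $ i"
        using step[OF i, of v f] i by (simp add: v_def)
    qed (simp add: A v_def)
    ultimately show "eigenvalue (adjacency_matrix G) \<mu>"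
      unfolding eigenvalue_def eigenvector_def by (intro exI[of _ v]) (simp add: A v_def)
  qed
qed

lemma spectral_radius_eigenfun:
  assumes G: "simple_graph G" and ne: "verts G \<noteq> {}"
  obtains z where "\<And>x. 0 \<le> z x" "eigenfun (verts G) (edges G) (graph_spectral_radius G) z"
    "\<And>\<mu> f. eigenfun (verts G) (edges G) \<mu> f \<Longrightarrow> \<mu> \<le> graph_spectral_radius G"
proof -
  interpret fin_graph "verts G" "edges G" using G by (simp add: simple_graph_fin_graph)
  let ?A = "\<lambda>x y. of_bool ({x, y} \<in> edges G) :: real"
  have A: "?A x y = ?A y x" "0 \<le> ?A x y" for x y by (auto simp: insert_commute)
  obtain m z where z: "\<forall>x. 0 \<le> z x" "\<exists>x\<in>verts G. z x \<noteq> 0"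
    "\<forall>x\<in>verts G. m * z x = (\<Sum>y\<in>verts G. ?A x y * z y)"
    "\<forall>\<mu> f. (\<exists>x\<in>verts G. f x \<noteq> 0) \<and> (\<forall>x\<in>verts G. \<mu> * f x = (\<Sum>y\<in>verts G. ?A x y * f y)) \<longrightarrow> \<mu> \<le> m"
    using nonneg_top_eigenvector[where A = ?A, OF fin ne A] by blast
  have ez: "eigenfun (verts G) (edges G) m z" unfolding eigenfun_def sum_nbrs using z(2,3) by blast
  have top: "\<mu> \<le> m" if "eigenfun (verts G) (edges G) \<mu> f" for \<mu> f
    using that z(4) unfolding eigenfun_def sum_nbrs by blast
  have C: "adjacency_matrix G \<in> carrier_mat (length (vertex_list G)) (length (vertex_list G))"
    by (simp add: adjacency_matrix_def Let_def)
  \<comment> \<open>\<open>Max\<close> says something only about a finite set; the eigenvalues are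
    roots of the monic characteristic polynomial.\<close>
  have fs: "finite {x. eigenvalue (adjacency_matrix G) x}"
  proof (rule finite_subset)
    show "{x. eigenvalue (adjacency_matrix G) x} \<subseteq> {x. poly (char_poly (adjacency_matrix G)) x = 0}"
      using eigenvalue_root_char_poly[OF C] by auto
    show "finite {x. poly (char_poly (adjacency_matrix G)) x = 0}"
      using degree_monic_char_poly[OF C] by (intro poly_roots_finite) auto
  qed
  have "graph_spectral_radius G = m"
    unfolding graph_spectral_radius_def
    by (rule Max_eqI[OF fs]) (use ez top in \<open>auto simp: eigenvalue_adjacency_matrix[OF G]\<close>)
  then show ?thesis using that[of z] z(1) ez top by blast
qed

section \<open>Minimally (k,k)-edge-connected graphs\<close>

lemma card_graph_components:
  "card (graph_components (delete_edges G F)) = ncomp (verts G) (edges G - F)"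
proof -
  have "graph_components (delete_edges G F) = (\<lambda>x. {y \<in> verts G. conn (edges G - F) x y}) ` verts G"
    by (auto simp: graph_components_def delete_edges_def adj_rel_def verts_def edges_def
        quotient_def conn_def)
  then show ?thesis by (simp add: ncomp_def)
qed

lemma edge_connectivity_eq:
  assumes "l \<le> card (verts G)"
  shows "edge_connectivity l G = (LEAST m. \<exists>F\<subseteq>edges G. card F = m \<and> l \<le> ncomp (verts G) (edges G - F))"
  using assms by (simp add: edge_connectivity_def card_graph_components)

lemma verts_delete_edges [simp]: "verts (delete_edges G F) = verts G"
  by (simp add: delete_edges_def verts_def)

lemma edges_delete_edges [simp]: "edges (delete_edges G F) = edges G - F"
  by (simp add: delete_edges_def edges_def)

lemma connected_graph_conn:
  "connected_graph G \<longleftrightarrow> verts G \<noteq> {} \<and> (\<forall>x\<in>verts G. \<forall>y\<in>verts G. conn (edges G) x y)"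
  by (simp add: connected_graph_def adj_rel_def conn_def)

text \<open>Deleting k - 1 edges from a connected graph leaves k components only if all of them are bridges.\<close>

lemma few_bridges:
  assumes G: "simple_graph G" and ec: "edge_connected k k G" and k: "2 \<le> k" "k \<le> card (verts G)"
  shows "card (bridges (edges G)) \<le> k - 2"
proof (rule ccontr)
  assume "\<not> ?thesis"
  then have "k - 1 \<le> card (bridges (edges G))" using k by simp
  then obtain F where F: "F \<subseteq> bridges (edges G)" "card F = k - 1"
    by (metis obtain_subset_with_card_n)
  interpret fin_graph "verts G" "edges G" using G by (simp add: simple_graph_fin_graph)
  have con: "verts G \<noteq> {}" "\<And>x y. x \<in> verts G \<Longrightarrow> y \<in> verts G \<Longrightarrow> conn (edges G) x y"
    using ec by (auto simp: edge_connected_def connected_graph_conn)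
  have "ncomp (verts G) (edges G - F) = k"
    using ncomp_remove_bridges[OF F(1)] ncomp_connected[OF con] F(2) k by simp
  moreover have "F \<subseteq> edges G" using F bridges_subset by fast
  ultimately have "edge_connectivity k G \<le> k - 1"
    unfolding edge_connectivity_eq[OF k(2)] using F(2) by (intro Least_le exI[of _ F]) simp
  moreover have "k \<le> edge_connectivity k G" using ec by (simp add: edge_connected_def)
  ultimately show False using k by linarith
qed

text \<open>Minimality yields fewer than k edges F whose deletion splits G - e into k components. As
  G - e is connected, F has exactly k - 1 edges and all of them are bridges of G - e: a non-bridge
  would be deleted without gain. Those that are not bridges of G form a two-edge cut with e, by
  \<open>cut_swap\<close>.\<close>

lemma nonbridge_partners:
  assumes G: "simple_graph G" and mec: "minimally_edge_connected k k G"
    and k: "2 \<le> k" "k \<le> card (verts G)"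
    and e: "{x, y} \<in> edges G" "{x, y} \<notin> bridges (edges G)"
  shows "k - 1 \<le> card {f \<in> edges G. f \<noteq> {x, y} \<and> \<not> conn (edges G - {{x, y}, f}) x y} + card (bridges (edges G))"
proof -
  define V where "V = verts G"
  define E where "E = edges G"
  interpret fin_graph V E using G by (simp add: simple_graph_fin_graph V_def E_def)
  let ?e = "{x, y}"
  have xy: "x \<in> V" "y \<in> V" using edgeD e(1) by (auto simp: E_def)
  have con: "V \<noteq> {}" "\<And>u v. u \<in> V \<Longrightarrow> v \<in> V \<Longrightarrow> conn E u v"
    using mec by (auto simp: minimally_edge_connected_def edge_connected_def connected_graph_conn V_def E_def)
  interpret E': fin_graph V "E - {?e}" by (rule subgraph) auto
  have n1: "ncomp V (E - {?e}) = 1"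
    using ncomp_remove_nonbridge[of ?e] e ncomp_connected[OF con] by (simp add: E_def)
  define P where "P m \<longleftrightarrow> (\<exists>F\<subseteq>E - {?e}. card F = m \<and> k \<le> ncomp V (E - {?e} - F))" for m
  have ec: "edge_connectivity k (delete_edges G {?e}) = (LEAST m. P m)"
    using edge_connectivity_eq[of k "delete_edges G {?e}"] k by (simp add: P_def V_def E_def)
  \<comment> \<open>\<open>LEAST\<close> needs a witness: deleting all edges leaves
    \<open>card V\<close> components, and k is at most that number.\<close>
  have "P (card (E - {?e}))"
    unfolding P_def using k fin by (intro exI[of _ "E - {?e}"]) (simp add: V_def)
  then have "P (LEAST m. P m)" by (rule LeastI)
  moreover have "(LEAST m. P m) < k"
    using mec e(1) unfolding ec[symmetric] by (simp add: minimally_edge_connected_def)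
  ultimately obtain F where F: "F \<subseteq> E - {?e}" "card F < k" "k \<le> ncomp V (E - {?e} - F)"
    unfolding P_def by metis
  have finF: "finite F" using F(1) finE by (meson finite_Diff finite_subset)
  have cF: "card F = k - 1"
    using E'.ncomp_remove_le[OF F(1)] n1 F by linarith
  have Fb: "F \<subseteq> bridges (E - {?e})"
  proof
    fix f assume f: "f \<in> F"
    show "f \<in> bridges (E - {?e})"
    proof (rule ccontr)
      assume nb: "f \<notin> bridges (E - {?e})"
      have "f \<in> E - {?e}" using f F(1) by auto
      from E'.ncomp_remove_nonbridge[OF this nb] n1 have 1: "ncomp V (E - {?e} - {f}) = 1" by simp
      interpret E'': fin_graph V "E - {?e} - {f}" by (rule subgraph) auto
      have "ncomp V (E - {?e} - {f} - (F - {f})) \<le> 1 + card (F - {f})"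
        using E''.ncomp_remove_le[of "F - {f}"] F(1) 1 by auto
      moreover have "E - {?e} - {f} - (F - {f}) = E - {?e} - F" using f by auto
      moreover have "card (F - {f}) = card F - 1" using f finF by simp
      ultimately show False using F(3) cF k by simp
    qed
  qed
  have part: "F - bridges E \<subseteq> {f \<in> E. f \<noteq> ?e \<and> \<not> conn (E - {?e, f}) x y}"
  proof
    fix f assume f: "f \<in> F - bridges E"
    then have fE: "f \<in> E" "f \<noteq> ?e" using F(1) by auto
    then obtain p r where pr: "f = {p, r}" using edge_ex by blast
    have "E - {?e} - {f} = E - {?e, f}" by auto
    then have 1: "\<not> conn (E - {?e, f}) p r" using f Fb pr bridge_iff[of p r "E - {?e}"] by auto
    have "conn (E - {f}) p r" using f fE pr bridge_iff[of p r E] by auto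
    moreover have "insert ?e (E - {?e, f}) = E - {f}" using e fE by (auto simp: E_def)
    ultimately have "\<not> conn (E - {?e, f}) x y" using cut_swap(1)[OF 1, of x y] by simp
    with fE show "f \<in> {f \<in> E. f \<noteq> ?e \<and> \<not> conn (E - {?e, f}) x y}" by simp
  qed
  have "card F \<le> card (F - bridges E) + card (bridges E)"
  proof -
    have fb: "finite (bridges E)" using finE bridges_subset by (meson finite_subset)
    have "card F \<le> card ((F - bridges E) \<union> bridges E)"
      by (rule card_mono) (use finF fb in auto)
    also have "\<dots> \<le> card (F - bridges E) + card (bridges E)" by (rule card_Un_le)
    finally show ?thesis .
  qed
  also have "card (F - bridges E) \<le> card {f \<in> E. f \<noteq> ?e \<and> \<not> conn (E - {?e, f}) x y}"
    by (rule card_mono[OF _ part]) (use finE in simp)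
  finally show ?thesis using cF by (simp add: E_def)
qed

lemma minimally_two_cuts:
  assumes G: "simple_graph G" and mec: "minimally_edge_connected k k G"
    and k: "2 \<le> k" "k \<le> card (verts G)"
  shows "two_cuts (edges G)"
  unfolding two_cuts_def
proof (intro allI impI)
  fix x y assume e: "{x, y} \<in> edges G"
  have ec: "edge_connected k k G" using mec by (simp add: minimally_edge_connected_def)
  show "\<exists>f. f \<noteq> {x, y} \<and> \<not> conn (edges G - {{x, y}, f}) x y"
  proof (cases "{x, y} \<in> bridges (edges G)")
    case True
    then have "\<not> conn (edges G - {{x, y}}) x y" by (simp add: bridge_iff)
    \<comment> \<open>A bridge is a cut by itself; the empty set, which differs from every edge,
      serves as dummy partner.\<close>
    then have "\<not> conn (edges G - {{x, y}, {}}) x y" by (rule not_conn_mono) auto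
    then show ?thesis by blast
  next
    case False
    have "card {f \<in> edges G. f \<noteq> {x, y} \<and> \<not> conn (edges G - {{x, y}, f}) x y} \<noteq> 0"
      using nonbridge_partners[OF G mec k e False] few_bridges[OF G ec k] k by linarith
    then have "{f \<in> edges G. f \<noteq> {x, y} \<and> \<not> conn (edges G - {{x, y}, f}) x y} \<noteq> {}"
      by (metis card.empty)
    then show ?thesis by (auto simp del: ex_simps)
  qed
qed

text \<open>With fewer than k - 2 bridges there are at least two partners. They are described as two
  edges lying on every detour around xy, the form in which they clash with two detours that share at
  most one edge.\<close>

lemma minimally_two_partners:
  assumes G: "simple_graph G" and mec: "minimally_edge_connected k k G"
    and k: "2 \<le> k" "k \<le> card (verts G)"
    and b: "card (bridges (edges G)) < k - 2"
    and e: "{x, y} \<in> edges G" "{x, y} \<notin> bridges (edges G)"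
  shows "\<exists>f g. f \<noteq> g \<and> (\<forall>A. A \<subseteq> edges G - {{x, y}} \<longrightarrow> conn A x y \<longrightarrow> f \<in> A \<and> g \<in> A)"
proof -
  define P where "P = {f \<in> edges G. f \<noteq> {x, y} \<and> \<not> conn (edges G - {{x, y}, f}) x y}"
  have "2 \<le> card P" using nonbridge_partners[OF G mec k e] b by (simp add: P_def)
  then obtain S where S: "S \<subseteq> P" "card S = 2" by (metis obtain_subset_with_card_n)
  then obtain f g where fg: "f \<noteq> g" "f \<in> P" "g \<in> P" unfolding card_2_iff by auto
  have in_path: "h \<in> A" if h: "h \<in> P" and A: "A \<subseteq> edges G - {{x, y}}" "conn A x y" for h A
  proof (rule ccontr)
    assume "h \<notin> A"
    then have "A \<subseteq> edges G - {{x, y}, h}" using A(1) by auto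
    then have "conn (edges G - {{x, y}, h}) x y" by (rule conn_mono[OF A(2)])
    then show False using h by (simp add: P_def)
  qed
  show ?thesis using fg in_path by meson
qed

section \<open>Common neighbours\<close>

lemma nbrs_iff: "y \<in> nbrs E x \<longleftrightarrow> {x, y} \<in> E"
  by (simp add: nbrs_def)

lemma nbrs_sym: "y \<in> nbrs E x \<longleftrightarrow> x \<in> nbrs E y"
  by (simp add: nbrs_def insert_commute)

lemma sum_restrict:
  fixes g :: "'a \<Rightarrow> real"
  assumes "finite V" "S \<subseteq> V"
  shows "(\<Sum>y\<in>V. if y \<in> S then g y else 0) = sum g S"
  using assms by (simp add: sum.inter_restrict[symmetric] Int_absorb1)

lemma conn_walk2: "conn {{a, b}, {b, c}} a c"
  by (rule conn_path2[of a b]) auto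

lemma conn_walk3: "conn {{a, b}, {b, c}, {c, d}} a d"
  by (rule conn_path3[of a b _ c]) auto

lemma conn_walk4: "conn {{a, b}, {b, c}, {c, d}, {d, e}} a e"
  by (rule conn_path4[of a b _ c d]) auto

context fin_graph
begin

lemma finite_nbrs [simp]: "finite (nbrs E x)"
  using nbrs_subset fin by (rule finite_subset)

lemma nbrs_irrefl: "x \<notin> nbrs E x"
  using edgeD[of x x] by (auto simp: nbrs_iff)

lemma sum_card_nbrs_swap:
  assumes "finite A" "finite B"
  shows "(\<Sum>x\<in>A. card (nbrs E x \<inter> B)) = (\<Sum>y\<in>B. card (nbrs E y \<inter> A))"
proof -
  have c: "card (nbrs E x \<inter> S) = (\<Sum>y\<in>S. of_bool (y \<in> nbrs E x))" if "finite S" for x S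
    using that by (simp add: Int_commute Int_def)
  have "(\<Sum>x\<in>A. card (nbrs E x \<inter> B)) = (\<Sum>x\<in>A. \<Sum>y\<in>B. of_bool (y \<in> nbrs E x))"
    using assms c by simp
  also have "\<dots> = (\<Sum>y\<in>B. \<Sum>x\<in>A. of_bool (y \<in> nbrs E x))" by (rule sum.swap)
  also have "\<dots> = (\<Sum>y\<in>B. \<Sum>x\<in>A. of_bool (x \<in> nbrs E y))" by (simp add: nbrs_sym)
  finally show ?thesis using assms c by simp
qed

lemma handshake: "(\<Sum>x\<in>V. card (nbrs E x)) = 2 * card E"
proof -
  define P where "P = (SIGMA x:V. nbrs E x)"
  have finP: "finite P" using fin by (auto simp: P_def)
  have "(\<Sum>x\<in>V. card (nbrs E x)) = card P" using fin by (simp add: P_def)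
  also have "card P = (\<Sum>e\<in>E. card {p \<in> P. {fst p, snd p} = e})"
  proof -
    have "P = (\<Union>e\<in>E. {p \<in> P. {fst p, snd p} = e})" by (auto simp: P_def nbrs_iff)
    also have "card \<dots> = (\<Sum>e\<in>E. card {p \<in> P. {fst p, snd p} = e})"
      by (rule card_UN_disjoint) (use finE finP in auto)
    finally show ?thesis .
  qed
  also have "\<dots> = (\<Sum>e\<in>E. 2)"
  proof (rule sum.cong)
    fix e assume e: "e \<in> E"
    then obtain x y where xy: "e = {x, y}" "x \<in> V" "y \<in> V" "x \<noteq> y" using edge_ex by blast
    have "{p \<in> P. {fst p, snd p} = e} = {(x, y), (y, x)}"
      using e xy by (auto simp: P_def nbrs_iff doubleton_eq_iff insert_commute)
    then show "card {p \<in> P. {fst p, snd p} = e} = 2" using xy by simp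
  qed simp
  finally show ?thesis by simp
qed

lemma card_between:
  assumes "A \<subseteq> V" "B \<subseteq> V" "A \<inter> B = {}"
  shows "(\<Sum>x\<in>A. card (nbrs E x \<inter> B)) = card {e \<in> E. \<exists>x\<in>A. \<exists>y\<in>B. e = {x, y}}"
proof -
  define P where "P = (SIGMA x:A. nbrs E x \<inter> B)"
  have "finite A" using assms fin by (meson finite_subset)
  then have "(\<Sum>x\<in>A. card (nbrs E x \<inter> B)) = card P" by (simp add: P_def)
  also have "card P = card ((\<lambda>p. {fst p, snd p}) ` P)"
    by (rule card_image[symmetric])
      (use assms(3) in \<open>auto simp: inj_on_def P_def doubleton_eq_iff\<close>)
  also have "(\<lambda>p. {fst p, snd p}) ` P = {e \<in> E. \<exists>x\<in>A. \<exists>y\<in>B. e = {x, y}}"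
  proof (intro subset_antisym subsetI)
    fix e assume "e \<in> {e \<in> E. \<exists>x\<in>A. \<exists>y\<in>B. e = {x, y}}"
    then obtain x y where "x \<in> A" "y \<in> B" "e = {x, y}" "e \<in> E" by blast
    then show "e \<in> (\<lambda>p. {fst p, snd p}) ` P"
      by (intro image_eqI[of _ _ "(x, y)"]) (auto simp: P_def nbrs_iff)
  next
    fix e assume "e \<in> (\<lambda>p. {fst p, snd p}) ` P"
    then obtain x y where "(x, y) \<in> P" "e = {x, y}" by auto
    then have "x \<in> A" "y \<in> B" "e = {x, y}" "e \<in> E" by (auto simp: P_def nbrs_iff)
    then show "e \<in> {e \<in> E. \<exists>x\<in>A. \<exists>y\<in>B. e = {x, y}}" by blast
  qed
  finally show ?thesis .
qed

end

section \<open>Configurations excluded because they contain three edge-disjoint paths\<close>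

locale two_cut_graph = fin_graph +
  assumes tc: "two_cuts E"
begin

text \<open>Otherwise the edge uw and the paths through a and b are three edge-disjoint u-w
  paths.\<close>

lemma no_diamond:
  assumes "w \<in> nbrs E u" "a \<in> nbrs E u" "a \<in> nbrs E w" "b \<in> nbrs E u" "b \<in> nbrs E w"
  shows "a = b"
proof (rule ccontr)
  assume ab: "a \<noteq> b"
  have e: "{u, w} \<in> E" "{u, a} \<in> E" "{a, w} \<in> E" "{u, b} \<in> E" "{b, w} \<in> E"
    using assms by (auto simp: nbrs_iff insert_commute)
  note d = e[THEN edgeD]
  have "conn {{u, a}, {a, w}} u w" "conn {{u, b}, {b, w}} u w" by (rule conn_walk2)+
  from two_cuts_no_three[OF tc e(1) this] show False
    using e d ab by (auto simp: doubleton_eq_iff)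
qed

lemma codegree_adjacent:
  assumes "w \<in> nbrs E u"
  shows "card (nbrs E u \<inter> nbrs E w) \<le> 1"
  using no_diamond[OF assms] by (subst card_le_Suc0_iff_eq[unfolded One_nat_def[symmetric]]) auto

text \<open>For a different from w2, the edge u w1, the path through a and the way round the
  quadrangle are edge-disjoint. For a = w2 the edge w1 w2 is a diagonal, with detours through u and
  through x.\<close>

lemma quadrangle_no_triangle:
  assumes "x \<noteq> u" "x \<notin> nbrs E u" "w1 \<noteq> w2" "w1 \<in> nbrs E u" "w1 \<in> nbrs E x"
    "w2 \<in> nbrs E u" "w2 \<in> nbrs E x" "a \<in> nbrs E u" "a \<in> nbrs E w1"
  shows False
proof -
  have e: "{u, w1} \<in> E" "{u, w2} \<in> E" "{w2, x} \<in> E" "{x, w1} \<in> E" "{u, a} \<in> E" "{a, w1} \<in> E"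
    using assms by (auto simp: nbrs_iff insert_commute)
  note d = e[THEN edgeD]
  show False
  proof (cases "a = w2")
    case True
    have "conn {{w1, u}, {u, w2}} w1 w2" "conn {{w1, x}, {x, w2}} w1 w2"
      by (rule conn_walk2)+
    from two_cuts_no_three[OF tc _ this] show False
      using True e d assms by (auto simp: doubleton_eq_iff insert_commute)
  next
    case False
    have "conn {{u, a}, {a, w1}} u w1" by (rule conn_walk2)
    moreover have "conn {{u, w2}, {w2, x}, {x, w1}} u w1" by (rule conn_walk3)
    moreover have "a \<noteq> x" using assms by auto
    ultimately show False
      using two_cuts_no_three[OF tc e(1), of "{{u, a}, {a, w1}}" "{{u, w2}, {w2, x}, {x, w1}}"]
        False e d assms(1-3) by (auto simp: doubleton_eq_iff)
  qed
qed

lemma pick_avoiding_two: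
  assumes "3 \<le> card S"
  shows "\<exists>w\<in>S. w \<noteq> a \<and> w \<noteq> b"
proof (rule ccontr)
  assume "\<not> ?thesis"
  then have "S \<subseteq> {a, b}" by auto
  then have "card S \<le> card {a, b}" by (rule card_mono[rotated]) simp
  also have "\<dots> \<le> 2" by (simp add: card_insert_if)
  finally show False using assms by simp
qed

text \<open>With three common neighbours of u and x, one of them, w1, avoids both w and a supposed
  second common neighbour w2 of u and y. Then uw, u w1 x w and u w2 y w are edge-disjoint.\<close>

lemma hub_disjoint:
  assumes "x \<noteq> u" "x \<notin> nbrs E u" "3 \<le> card (nbrs E u \<inter> nbrs E x)" "y \<noteq> u" "y \<noteq> x"
    "w \<in> nbrs E u" "w \<in> nbrs E x" "w \<in> nbrs E y"
  shows "nbrs E u \<inter> nbrs E y = {w}"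
proof -
  have "w2 = w" if w2: "w2 \<in> nbrs E u" "w2 \<in> nbrs E y" for w2
  proof (rule ccontr)
    assume ne: "w2 \<noteq> w"
    obtain w1 where w1: "w1 \<in> nbrs E u" "w1 \<in> nbrs E x" "w1 \<noteq> w" "w1 \<noteq> w2"
      using pick_avoiding_two[OF assms(3), of w w2] by auto
    have e: "{u, w} \<in> E" "{u, w1} \<in> E" "{w1, x} \<in> E" "{x, w} \<in> E" "{u, w2} \<in> E" "{w2, y} \<in> E" "{y, w} \<in> E"
      using assms w1 w2 by (auto simp: nbrs_iff insert_commute)
    note d = e[THEN edgeD]
    have xw2: "x \<noteq> w2" using w2 assms by auto
    have "conn {{u, w1}, {w1, x}, {x, w}} u w" "conn {{u, w2}, {w2, y}, {y, w}} u w"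
      by (rule conn_walk3)+
    from two_cuts_no_three[OF tc e(1) this] show False
      using e d assms(1,4,5) w1(3,4) ne xw2 by (auto simp: doubleton_eq_iff)
  qed
  then show ?thesis using assms by blast
qed

text \<open>Two common neighbours a, b of u and y would give the paths x w1 u a y and x w2 u b y
  beside the edge xy; \<open>hub_disjoint\<close> keeps w1, w2 apart from a, b.\<close>

lemma hub_nbr_codegree:
  assumes "x \<noteq> u" "x \<notin> nbrs E u" "3 \<le> card (nbrs E u \<inter> nbrs E x)" "y \<in> nbrs E x" "y \<notin> nbrs E u"
  shows "card (nbrs E u \<inter> nbrs E y) \<le> 1"
proof (rule ccontr)
  assume "\<not> ?thesis"
  then have "\<not> (\<forall>a\<in>nbrs E u \<inter> nbrs E y. \<forall>b\<in>nbrs E u \<inter> nbrs E y. a = b)"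
    by (subst card_le_Suc0_iff_eq[symmetric]) auto
  then obtain a b where ab: "a \<in> nbrs E u" "a \<in> nbrs E y" "b \<in> nbrs E u" "b \<in> nbrs E y" "a \<noteq> b"
    by blast
  obtain w1 where w1: "w1 \<in> nbrs E u" "w1 \<in> nbrs E x" using pick_avoiding_two[OF assms(3)] by auto
  obtain w2 where w2: "w2 \<in> nbrs E u" "w2 \<in> nbrs E x" "w2 \<noteq> w1"
    using pick_avoiding_two[OF assms(3), of w1 w1] by auto
  have yu: "y \<noteq> u" using assms by (auto simp: nbrs_sym)
  have yx: "y \<noteq> x" using assms nbrs_irrefl by auto
  have ndis: "w \<notin> nbrs E y" if w: "w \<in> nbrs E u" "w \<in> nbrs E x" for w
  proof
    assume "w \<in> nbrs E y"
    from hub_disjoint[OF assms(1-3) yu yx w this] ab show False by (metis IntI singletonD)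
  qed
  have e: "{x, y} \<in> E" "{x, w1} \<in> E" "{w1, u} \<in> E" "{u, a} \<in> E" "{a, y} \<in> E"
    "{x, w2} \<in> E" "{w2, u} \<in> E" "{u, b} \<in> E" "{b, y} \<in> E"
    using assms w1 w2 ab by (auto simp: nbrs_iff insert_commute)
  note d = e[THEN edgeD]
  have ne: "w1 \<noteq> a" "w1 \<noteq> b" "w2 \<noteq> a" "w2 \<noteq> b" "a \<noteq> x" "b \<noteq> x" "w1 \<noteq> y" "w2 \<noteq> y"
    using ndis w1 w2 ab assms by auto
  have "conn {{x, w1}, {w1, u}, {u, a}, {a, y}} x y" "conn {{x, w2}, {w2, u}, {u, b}, {b, y}} x y"
    by (rule conn_walk4)+
  from two_cuts_no_three[OF tc e(1) this] show False
    using e d ne w2(3) ab(5) assms(1) yu by (auto simp: doubleton_eq_iff)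
qed

lemma triangle_disconnects:
  assumes "{a, b} \<in> E" "{b, c} \<in> E" "{c, a} \<in> E"
  shows "\<not> conn (E - {{a, b}, {b, c}, {c, a}}) a b"
proof
  assume c: "conn (E - {{a, b}, {b, c}, {c, a}}) a b"
  note d = assms[THEN edgeD]
  have "conn {{a, c}, {c, b}} a b" by (rule conn_walk2)
  from two_cuts_no_three[OF tc assms(1) c this] show False
    using assms d by (auto simp: doubleton_eq_iff insert_commute)
qed

text \<open>Without the edges of the triangle its three corners lie in different components, by
  \<open>triangle_disconnects\<close>; restoring bu alone cannot join u to a.\<close>

lemma triangle_bridge:
  assumes "{u, a} \<in> E" "{a, b} \<in> E" "{b, u} \<in> E" "F \<subseteq> E" "{a, b} \<notin> F" "{u, a} \<in> F"
  shows "{u, a} \<in> bridges F"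
proof -
  define S where "S = E - {{u, a}, {a, b}, {b, u}}"
  have S: "\<not> conn S u a" "\<not> conn S a b" "\<not> conn S b u"
    using triangle_disconnects[OF assms(1,2,3)] triangle_disconnects[OF assms(2,3,1)]
      triangle_disconnects[OF assms(3,1,2)] by (auto simp: S_def insert_commute)
  have "\<not> conn (insert {b, u} S) u a"
    using S by (auto simp: conn_insert dest: conn_sym)
  then have "\<not> conn (F - {{u, a}}) u a"
    by (rule not_conn_mono) (use assms in \<open>auto simp: S_def\<close>)
  then show ?thesis using assms by (simp add: bridge_iff)
qed

text \<open>Each edge inside the neighbourhood of u is removed first; this costs one edge but creates two
  new bridges, which pays for counting it twice in the sum of the degrees of the neighbours of u.\<close>

lemma codegree_sum_bound:
  assumes con: "\<And>x y. x \<in> V \<Longrightarrow> y \<in> V \<Longrightarrow> conn E x y"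
    and u: "u \<in> V" and x: "x \<in> V" "x \<noteq> u" "2 \<le> card (nbrs E u \<inter> nbrs E x)"
  shows "(\<Sum>y\<in>V. card (nbrs E u \<inter> nbrs E y)) + card {e \<in> E. e \<inter> nbrs E u = {}}
           + card (bridges E) + 4 \<le> 2 * card V"
proof -
  define N where "N = nbrs E u"
  define c where "c y = card (N \<inter> nbrs E y)" for y
  define TN where "TN = {y \<in> N. c y = 1}"
  define F where "F = {e \<in> E. \<not> e \<subseteq> N}"
  define W where "W = {e \<in> E. e \<inter> N = {}}"
  have FE: "F \<subseteq> E" by (auto simp: F_def)
  have NV: "N \<subseteq> V" using nbrs_subset by (simp add: N_def)
  have uN: "u \<notin> N" using nbrs_irrefl by (simp add: N_def)
  interpret F: two_cut_graph V F
    using subgraph[OF FE] two_cuts_mono[OF tc FE] by (simp add: two_cut_graph_def two_cut_graph_axioms_def)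
  have c1: "c y \<le> 1" if "y \<in> N" for y
    using codegree_adjacent[of y u] that by (simp add: c_def N_def)
  have xN: "x \<notin> N" using c1[of x] x by (auto simp: c_def N_def)
  obtain w1 w2 where w: "w1 \<in> N" "w1 \<in> nbrs E x" "w2 \<in> N" "w2 \<in> nbrs E x" "w1 \<noteq> w2"
  proof -
    have "\<not> card (N \<inter> nbrs E x) \<le> Suc 0" using x by (simp add: N_def)
    then show ?thesis using that card_le_Suc0_iff_eq[of "N \<inter> nbrs E x"] fin NV by (auto simp: finite_subset)
  qed
  \<comment> \<open>Neither u nor x lies in \<open>N\<close>, so no edge of this quadrangle is
    removed in passing to \<open>F\<close>.\<close>
  have q: "{u, w1} \<in> F" "{w1, x} \<in> F" "{x, w2} \<in> F" "{w2, u} \<in> F"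
    using w xN uN by (auto simp: F_def N_def nbrs_iff insert_commute)
  have conF: "conn F p r" if "p \<in> V" "r \<in> V" for p r
  proof (rule conn_subst[OF con[OF that]])
    fix p r assume e: "{p, r} \<in> E"
    show "conn F p r"
    proof (cases "{p, r} \<in> F")
      case False
      then have "p \<in> N" "r \<in> N" using e by (auto simp: F_def)
      then have "{p, u} \<in> F" "{u, r} \<in> F" using uN by (auto simp: F_def N_def nbrs_iff insert_commute)
      then show ?thesis by (rule conn_path2)
    qed (rule conn_edge)
  qed
  have 1: "card F + card (bridges F) + 4 \<le> 2 * card V"
    by (rule F.sparse_quadrangle[OF F.tc conF q x(2)[symmetric] w(5)])
  have TNp: "\<exists>b. {u, y} \<in> E \<and> {y, b} \<in> E \<and> {b, u} \<in> E \<and> {y, b} \<notin> F" if "y \<in> TN" for y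
  proof -
    have "N \<inter> nbrs E y \<noteq> {}" using that by (auto simp: TN_def c_def)
    then obtain b where "b \<in> N" "b \<in> nbrs E y" by blast
    then show ?thesis using that by (intro exI[of _ b]) (auto simp: TN_def F_def N_def nbrs_iff insert_commute)
  qed
  have uF: "{u, y} \<in> F" if "y \<in> N" for y using that uN by (auto simp: F_def N_def nbrs_iff)
  \<comment> \<open>A matched vertex y spans a triangle with u and its neighbour in
    \<open>N\<close>. The edge opposite u has been removed, so uy becomes a bridge; in
    \<open>E\<close> it was none, so these bridges are new.\<close>
  have "(\<lambda>y. {u, y}) ` TN \<subseteq> bridges F"
  proof (rule image_subsetI)
    fix y assume y: "y \<in> TN"
    then obtain b where "{u, y} \<in> E" "{y, b} \<in> E" "{b, u} \<in> E" "{y, b} \<notin> F" using TNp by blast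
    then show "{u, y} \<in> bridges F" using triangle_bridge[of u y b F] FE uF y by (auto simp: TN_def)
  qed
  moreover have "bridges E \<subseteq> bridges F"
  proof
    fix e assume e: "e \<in> bridges E"
    have "e \<in> F"
    proof (rule ccontr)
      assume "e \<notin> F"
      then have eN: "e \<subseteq> N" "e \<in> E" using e bridges_subset by (auto simp: F_def)
      obtain p r where pr: "e = {p, r}" using eN edge_ex by blast
      have "u \<noteq> p" "u \<noteq> r" using eN pr uN by auto
      then have "{p, u} \<in> E - {e}" "{u, r} \<in> E - {e}"
        using eN pr by (auto simp: N_def nbrs_iff insert_commute doubleton_eq_iff)
      then have "conn (E - {e}) p r" by (rule conn_path2)
      then show False using e pr by (simp add: bridge_iff)
    qed
    then show "e \<in> bridges F" by (rule bridge_mono[OF e _ FE])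
  qed
  moreover have "bridges E \<inter> (\<lambda>y. {u, y}) ` TN = {}"
  proof -
    have "{u, y} \<notin> bridges E" if y: "y \<in> TN" for y
    proof -
      obtain b where b: "{u, y} \<in> E" "{y, b} \<in> E" "{b, u} \<in> E" "{y, b} \<notin> F" using TNp y by blast
      have "conn (E - {{u, y}}) u y"
        by (rule conn_path2[of u b]) (use b edgeD in \<open>auto simp: doubleton_eq_iff insert_commute\<close>)
      then show ?thesis by (simp add: bridge_iff)
    qed
    then show ?thesis by auto
  qed
  moreover have "card ((\<lambda>y. {u, y}) ` TN) = card TN"
    by (rule card_image) (auto simp: inj_on_def doubleton_eq_iff)
  moreover have fb: "finite (bridges F)" "finite (bridges E)"
    using finE F.finE bridges_subset by (meson finite_subset)+
  moreover have "finite TN" using NV fin by (auto simp: TN_def intro: finite_subset)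
  ultimately have 2: "card (bridges E) + card TN \<le> card (bridges F)"
    using card_Un_disjoint[of "bridges E" "(\<lambda>y. {u, y}) ` TN"]
      card_mono[of "bridges F" "bridges E \<union> (\<lambda>y. {u, y}) ` TN"] by auto
  have fN: "finite N" using NV fin by (rule finite_subset)
  have "(\<Sum>y\<in>N. c y) = (\<Sum>y\<in>N. if y \<in> TN then 1 else 0)"
    using c1 by (intro sum.cong) (force simp: TN_def le_Suc_eq)+
  also have "\<dots> = card TN" using fN by (simp add: sum.If_cases TN_def Int_def)
  finally have sN: "(\<Sum>y\<in>N. c y) = card TN" .
  have "(\<Sum>y\<in>V - N. c y) = card {e \<in> E. \<exists>x\<in>V - N. \<exists>y\<in>N. e = {x, y}}"
    unfolding c_def using card_between[of "V - N" N] NV by (simp add: Int_commute Int_absorb1)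
  moreover have "card {e \<in> E. \<exists>x\<in>V - N. \<exists>y\<in>N. e = {x, y}} + card W \<le> card F"
  proof -
    have "card {e \<in> E. \<exists>x\<in>V - N. \<exists>y\<in>N. e = {x, y}} + card W
        = card ({e \<in> E. \<exists>x\<in>V - N. \<exists>y\<in>N. e = {x, y}} \<union> W)"
      by (rule card_Un_disjoint[symmetric]) (use finE in \<open>auto simp: W_def\<close>)
    also have "\<dots> \<le> card F"
    proof (rule card_mono[OF F.finE], rule Un_least)
      show "W \<subseteq> F"
      proof
        fix e assume e: "e \<in> W"
        then have "e \<noteq> {}" using edge_ex[of e] by (auto simp: W_def)
        with e show "e \<in> F" by (auto simp: W_def F_def)
      qed
    qed (auto simp: F_def)
    finally show ?thesis .
  qed
  moreover have "(\<Sum>y\<in>V. c y) = (\<Sum>y\<in>V - N. c y) + (\<Sum>y\<in>N. c y)"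
    using sum.subset_diff[OF NV fin] .
  \<comment> \<open>The sum over \<open>V - N\<close> plus |W| is at most |F|, and the sum over
    \<open>N\<close> is |TN|. Since |TN| + b is at most the number of bridges of \<open>F\<close>,
    everything is covered by \<open>sparse_quadrangle\<close> for \<open>F\<close>.\<close>
  ultimately show ?thesis using 1 2 sN unfolding c_def N_def W_def by linarith
qed

end

section \<open>Two-step walks from a maximum of the top eigenvector\<close>

locale top_eigen = two_cut_graph V E for V :: "'a set" and E +
  fixes lam :: real and z :: "'a \<Rightarrow> real" and u :: 'a
  assumes con: "\<And>x y. x \<in> V \<Longrightarrow> y \<in> V \<Longrightarrow> conn E x y"
    and z0: "\<And>x. 0 \<le> z x" and z1: "\<And>x. x \<in> V \<Longrightarrow> z x \<le> 1"
    and uV: "u \<in> V" and zu: "z u = 1" and lam0: "0 < lam"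
    and eig: "\<And>x. x \<in> V \<Longrightarrow> lam * z x = (\<Sum>y\<in>nbrs E x. z y)"
begin

text \<open>The numbers of common neighbours are the entries of the square of the adjacency
  matrix.\<close>

lemma two_walks:
  assumes "x \<in> V"
  shows "lam * lam * z x = (\<Sum>y\<in>V. real (card (nbrs E x \<inter> nbrs E y)) * z y)"
proof -
  have "lam * lam * z x = (\<Sum>w\<in>nbrs E x. lam * z w)"
    unfolding mult.assoc eig[OF assms] by (rule sum_distrib_left)
  also have "\<dots> = (\<Sum>w\<in>nbrs E x. \<Sum>y\<in>V. of_bool ({w, y} \<in> E) * z y)"
    using nbrs_subset eig by (intro sum.cong) (auto simp: sum_nbrs)
  also have "\<dots> = (\<Sum>y\<in>V. \<Sum>w\<in>nbrs E x. of_bool ({w, y} \<in> E) * z y)" by (rule sum.swap)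
  also have "\<dots> = (\<Sum>y\<in>V. real (card (nbrs E x \<inter> nbrs E y)) * z y)"
  proof (intro sum.cong refl)
    fix y
    have "nbrs E x \<inter> nbrs E y = nbrs E x \<inter> {w. {w, y} \<in> E}"
      by (auto simp: nbrs_iff insert_commute)
    then show "(\<Sum>w\<in>nbrs E x. of_bool ({w, y} \<in> E) * z y) = real (card (nbrs E x \<inter> nbrs E y)) * z y"
      by (simp add: sum_distrib_right[symmetric])
  qed
  finally show ?thesis .
qed

lemma eig_le_card:
  assumes "x \<in> V" "nbrs E x \<subseteq> A" "finite A" "A \<subseteq> V"
  shows "lam * z x \<le> real (card A)"
proof -
  have "lam * z x = (\<Sum>y\<in>nbrs E x. z y)" by (rule eig[OF assms(1)])
  also have "\<dots> \<le> (\<Sum>y\<in>A. z y)" by (rule sum_mono2[OF assms(3,2)]) (rule z0)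
  also have "\<dots> \<le> (\<Sum>y\<in>A. 1)" using z1 assms(4) by (intro sum_mono) auto
  finally show ?thesis by simp
qed

section \<open>Vertices sorted by their number of common neighbours with u\<close>

definition "N = nbrs E u"
definition "c x = card (N \<inter> nbrs E x)"
definition "TN = {x \<in> N. c x = 1}"
definition "M0 = {x \<in> V - N - {u}. c x = 0}"
definition "M1 = {x \<in> V - N - {u}. c x = 1}"
definition "M2 = {x \<in> V - N - {u}. c x = 2}"
text \<open>The hubs. The threshold 3 leaves a third common neighbour once two are excluded, as
  \<open>hub_disjoint\<close> requires.\<close>

definition "H = {x \<in> V - N - {u}. 3 \<le> c x}"
definition "waste = card {e \<in> E. e \<inter> N = {}}"
text \<open>The number of two-step walks from u that end neither at u nor at a hub;
  \<open>\<zeta>\<close> weights each of them by the entry at its end.\<close>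

definition "a = real (card TN) + real (card M1) + 2 * real (card M2)"
definition "\<zeta> = (\<Sum>x\<in>TN. z x) + (\<Sum>x\<in>M1. z x) + 2 * (\<Sum>x\<in>M2. z x)"
definition "hloss = (\<Sum>x\<in>H. real (c x) * (1 - z x))"

lemma NV: "N \<subseteq> V" using nbrs_subset by (simp add: N_def)
lemma uN: "u \<notin> N" using nbrs_irrefl by (simp add: N_def)
lemma finN: "finite N" by (simp add: N_def)
lemma parts_V: "TN \<subseteq> V" "M0 \<subseteq> V" "M1 \<subseteq> V" "M2 \<subseteq> V" "H \<subseteq> V"
  using NV by (auto simp: TN_def M0_def M1_def M2_def H_def)
lemma parts_fin: "finite TN" "finite M0" "finite M1" "finite M2" "finite H"
  using parts_V fin by (auto intro: finite_subset)
lemma c_u: "c u = card N" by (simp add: c_def N_def)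
lemma c_N: "x \<in> N \<Longrightarrow> c x \<le> 1" using codegree_adjacent[of x u] by (simp add: c_def N_def)

lemma codegree_split:
  fixes g :: "'a \<Rightarrow> real"
  shows "(\<Sum>y\<in>V. real (c y) * g y) =
    real (card N) * g u + sum g TN + sum g M1 + 2 * sum g M2 + (\<Sum>y\<in>H. real (c y) * g y)"
proof -
  have "(\<Sum>y\<in>V. real (c y) * g y) = (\<Sum>y\<in>V. (if y \<in> {u} then real (card N) * g y else 0)
      + (if y \<in> TN then g y else 0) + (if y \<in> M1 then g y else 0)
      + (if y \<in> M2 then 2 * g y else 0) + (if y \<in> H then real (c y) * g y else 0))"
  proof (rule sum.cong[OF refl])
    fix y assume y: "y \<in> V"
    consider "y = u" | "y \<in> N" "c y = 0" | "y \<in> N" "c y = 1" | "y \<in> V - N - {u}" "c y = 0"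
      | "y \<in> V - N - {u}" "c y = 1" | "y \<in> V - N - {u}" "c y = 2" | "y \<in> V - N - {u}" "3 \<le> c y"
      using y c_N[of y] by (cases "y \<in> N"; cases "y = u"; force)
    then show "real (c y) * g y = (if y \<in> {u} then real (card N) * g y else 0)
      + (if y \<in> TN then g y else 0) + (if y \<in> M1 then g y else 0)
      + (if y \<in> M2 then 2 * g y else 0) + (if y \<in> H then real (c y) * g y else 0)"
      by cases (use uN in \<open>auto simp: c_u TN_def M1_def M2_def H_def\<close>)
  qed
  also have "\<dots> = real (card N) * g u + sum g TN + sum g M1 + (\<Sum>y\<in>M2. 2 * g y) + (\<Sum>y\<in>H. real (c y) * g y)"
    unfolding sum.distrib
    using uV by (simp only: sum_restrict[OF fin] parts_V empty_subsetI insert_subset simp_thms) simp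
  finally show ?thesis by (simp add: sum_distrib_left)
qed

lemma lam_sq: "lam * lam = real (card N) + \<zeta> + (\<Sum>x\<in>H. real (c x) * z x)"
  using two_walks[OF uV] codegree_split[of z] by (simp add: zu N_def[symmetric] c_def[symmetric] \<zeta>_def)

lemma codegree_sum: "real (\<Sum>y\<in>V. c y) = real (card N) + a + real (\<Sum>x\<in>H. c x)"
  using codegree_split[of "\<lambda>_. 1"] by (simp add: a_def)

lemma card_parts: "1 + card N + card M0 + card M1 + card M2 + card H = card V"
proof -
  have "card V = card ({u} \<union> N \<union> M0 \<union> M1 \<union> M2 \<union> H)"
  proof (rule arg_cong[of _ _ card], intro subset_antisym subsetI)
    fix x assume "x \<in> V"
    moreover have "c x = 0 \<or> c x = 1 \<or> c x = 2 \<or> 3 \<le> c x" by linarith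
    ultimately show "x \<in> {u} \<union> N \<union> M0 \<union> M1 \<union> M2 \<union> H"
      by (auto simp: M0_def M1_def M2_def H_def)
  qed (use NV parts_V uV in auto)
  also have "\<dots> = card {u} + card N + card M0 + card M1 + card M2 + card H"
  proof -
    have "card ({u} \<union> N) = card {u} + card N"
      by (rule card_Un_disjoint) (use finN uN in auto)
    moreover have "card ({u} \<union> N \<union> M0) = card ({u} \<union> N) + card M0"
      by (rule card_Un_disjoint) (use finN parts_fin in \<open>auto simp: M0_def\<close>)
    moreover have "card ({u} \<union> N \<union> M0 \<union> M1) = card ({u} \<union> N \<union> M0) + card M1"
      by (rule card_Un_disjoint) (use finN parts_fin in \<open>auto simp: M0_def M1_def\<close>)
    moreover have "card ({u} \<union> N \<union> M0 \<union> M1 \<union> M2) = card ({u} \<union> N \<union> M0 \<union> M1) + card M2"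
      by (rule card_Un_disjoint) (use finN parts_fin in \<open>auto simp: M0_def M1_def M2_def\<close>)
    moreover have "card ({u} \<union> N \<union> M0 \<union> M1 \<union> M2 \<union> H) = card ({u} \<union> N \<union> M0 \<union> M1 \<union> M2) + card H"
      by (rule card_Un_disjoint) (use finN parts_fin in \<open>auto simp: M0_def M1_def M2_def H_def\<close>)
    ultimately show ?thesis by simp
  qed
  finally show ?thesis by simp
qed

lemma waste_degree: "(\<Sum>x\<in>V - N. card (nbrs E x - N)) = 2 * waste"
proof -
  let ?W = "{e \<in> E. e \<inter> N = {}}"
  interpret W: fin_graph V ?W by (rule subgraph) auto
  have W: "nbrs ?W x = (if x \<in> N then {} else nbrs E x - N)" for x
    by (auto simp: nbrs_iff)
  have "(\<Sum>x\<in>V - N. card (nbrs E x - N)) = (\<Sum>x\<in>V - N. card (nbrs ?W x))"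
    unfolding W by (intro sum.cong) auto
  also have "\<dots> = (\<Sum>x\<in>V. card (nbrs ?W x))"
    using fin by (intro sum.mono_neutral_left) (auto simp: W)
  finally show ?thesis using W.handshake by (simp add: waste_def)
qed

lemma waste_degree_le:
  assumes "A \<subseteq> V - N"
  shows "(\<Sum>x\<in>A. real (card (nbrs E x - N))) \<le> 2 * real waste"
proof -
  have "(\<Sum>x\<in>A. card (nbrs E x - N)) \<le> (\<Sum>x\<in>V - N. card (nbrs E x - N))"
    by (rule sum_mono2) (use assms fin in auto)
  then have "real (\<Sum>x\<in>A. card (nbrs E x - N)) \<le> real (2 * waste)"
    unfolding waste_degree by (simp only: of_nat_le_iff)
  then show ?thesis by simp
qed

lemma outside_bound:
  assumes "x \<in> V" "x \<notin> N"
  shows "lam * z x \<le> real (c x) + real (card (nbrs E x - N))"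
proof -
  have "lam * z x \<le> real (card (nbrs E x))"
    by (rule eig_le_card) (use assms nbrs_subset in auto)
  also have "card (nbrs E x) = card (nbrs E x \<inter> N) + card (nbrs E x - N)"
    using card_Int_Diff[of "nbrs E x" N] by simp
  finally show ?thesis by (simp add: c_def Int_commute)
qed

text \<open>The neighbours of x are u, its one neighbour b in \<open>N\<close>, and vertices of
  \<open>M1\<close>. Any further neighbour would have a second common neighbour with u and close a
  quadrangle through the edge ux, which already carries the triangle u x b.\<close>

lemma matched_bound:
  assumes x: "x \<in> TN"
  shows "lam * z x \<le> 2 + real (card (nbrs E x \<inter> M1))"
proof -
  have xN: "x \<in> N" "c x = 1" using x by (auto simp: TN_def)
  then obtain b where b: "N \<inter> nbrs E x = {b}" by (auto simp: c_def card_1_singleton_iff)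
  have "y \<in> M1" if y: "y \<in> nbrs E x" "y \<noteq> u" "y \<noteq> b" for y
  proof -
    have yN: "y \<notin> N" using b y by auto
    have xy: "x \<in> nbrs E y" using y(1) nbrs_sym by metis
    have bb: "b \<in> nbrs E u" "b \<in> nbrs E x" using b by (auto simp: N_def)
    have "w = x" if w: "w \<in> N" "w \<in> nbrs E y" for w
      using quadrangle_no_triangle[of y u x w b, OF y(2) _ _ _ xy _ w(2) bb] yN xN(1) w(1)
      by (auto simp: N_def)
    then have "N \<inter> nbrs E y = {x}" using xN(1) xy by blast
    then show ?thesis using y yN nbrs_subset by (auto simp: M1_def c_def)
  qed
  then have s: "nbrs E x \<subseteq> insert u (insert b (nbrs E x \<inter> M1))" by auto
  have bV: "b \<in> V" using b NV by auto
  have "lam * z x \<le> real (card (insert u (insert b (nbrs E x \<inter> M1))))"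
    by (rule eig_le_card[OF _ s]) (use xN NV uV bV nbrs_subset in auto)
  also have "\<dots> \<le> real (2 + card (nbrs E x \<inter> M1))"
    by (simp add: card_insert_if)
  finally show ?thesis by simp
qed

lemma sum_matched: "(\<Sum>x\<in>TN. card (nbrs E x \<inter> M1)) \<le> card M1"
proof -
  have "(\<Sum>x\<in>TN. card (nbrs E x \<inter> M1)) = (\<Sum>y\<in>M1. card (nbrs E y \<inter> TN))"
    by (rule sum_card_nbrs_swap) (use parts_fin in auto)
  also have "\<dots> \<le> (\<Sum>y\<in>M1. 1)"
  proof (rule sum_mono)
    fix y assume y: "y \<in> M1"
    have "card (nbrs E y \<inter> TN) \<le> c y"
      unfolding c_def by (rule card_mono) (auto simp: finN TN_def)
    then show "card (nbrs E y \<inter> TN) \<le> 1" using y by (simp add: M1_def)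
  qed
  finally show ?thesis by simp
qed

text \<open>A vertex of \<open>M1\<close> is charged at most twice, for its own neighbour in
  \<open>N\<close> and as a neighbour of a matched vertex. As lam is large, the bound makes \<zeta>
  much smaller than a, so that walks ending outside the hubs are mostly lost.\<close>

lemma \<zeta>_bound: "lam * \<zeta> \<le> 2 * a + 4 * real waste"
proof -
  have "lam * (\<Sum>x\<in>TN. z x) \<le> (\<Sum>x\<in>TN. 2 + real (card (nbrs E x \<inter> M1)))"
    unfolding sum_distrib_left by (intro sum_mono matched_bound)
  also have "\<dots> = 2 * real (card TN) + real (\<Sum>x\<in>TN. card (nbrs E x \<inter> M1))"
    by (simp add: sum.distrib)
  also have "\<dots> \<le> 2 * real (card TN) + real (card M1)"
    using sum_matched by (simp only: add_le_cancel_left of_nat_le_iff)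
  finally have 1: "lam * (\<Sum>x\<in>TN. z x) \<le> 2 * real (card TN) + real (card M1)" .
  have "lam * (\<Sum>x\<in>M1. z x) \<le> (\<Sum>x\<in>M1. real (c x) + real (card (nbrs E x - N)))"
    unfolding sum_distrib_left by (intro sum_mono outside_bound) (auto simp: M1_def)
  also have "\<dots> = real (card M1) + (\<Sum>x\<in>M1. real (card (nbrs E x - N)))"
    by (simp add: sum.distrib M1_def)
  finally have 2: "lam * (\<Sum>x\<in>M1. z x) \<le> real (card M1) + (\<Sum>x\<in>M1. real (card (nbrs E x - N)))" .
  have "lam * (\<Sum>x\<in>M2. z x) \<le> (\<Sum>x\<in>M2. real (c x) + real (card (nbrs E x - N)))"
    unfolding sum_distrib_left by (intro sum_mono outside_bound) (auto simp: M2_def)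
  also have "\<dots> = 2 * real (card M2) + (\<Sum>x\<in>M2. real (card (nbrs E x - N)))"
    by (simp add: sum.distrib M2_def)
  finally have 3: "lam * (\<Sum>x\<in>M2. z x) \<le> 2 * real (card M2) + (\<Sum>x\<in>M2. real (card (nbrs E x - N)))" .
  have "(\<Sum>x\<in>M1 \<union> M2. real (card (nbrs E x - N))) \<le> 2 * real waste"
    by (rule waste_degree_le) (auto simp: M1_def M2_def)
  then have 4: "(\<Sum>x\<in>M1. real (card (nbrs E x - N))) + (\<Sum>x\<in>M2. real (card (nbrs E x - N))) \<le> 2 * real waste"
    by (subst (asm) sum.union_disjoint) (use parts_fin in \<open>auto simp: M1_def M2_def\<close>)
  have 5: "0 \<le> (\<Sum>x\<in>M1. real (card (nbrs E x - N)))" by (simp add: sum_nonneg)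
  show ?thesis using 1 2 3 4 5 unfolding \<zeta>_def a_def by (simp add: distrib_left)
qed

text \<open>A common neighbour w of u and v has only u, v and vertices of \<open>M1\<close> as
  neighbours; the remaining neighbours of v have at most one neighbour in \<open>N\<close>. Read
  backwards, an entry of v near 1 forces many common neighbours.\<close>

lemma hub_bound:
  assumes v: "v \<in> H"
  shows "lam * lam * z v \<le> 2 * real (c v) + a + 2 * real waste"
proof -
  have vV: "v \<in> V" "v \<notin> N" "v \<noteq> u" "3 \<le> card (nbrs E u \<inter> nbrs E v)" "v \<notin> nbrs E u"
    using v by (auto simp: H_def c_def N_def)
  define C where "C = N \<inter> nbrs E v"
  define Y where "Y = nbrs E v - N"
  have finC: "finite C" "finite Y" by (auto simp: C_def Y_def)
  have uv: "u \<notin> nbrs E v" using vV(5) nbrs_sym[of u E v] by simp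
  have YV: "Y \<subseteq> V - N - {u}" using nbrs_subset uv by (auto simp: Y_def)
  have tri1: False if "w \<in> C" "y \<in> N" "y \<in> nbrs E w" for w y
  proof -
    obtain w2 where w2: "w2 \<in> nbrs E u \<inter> nbrs E v" "w2 \<noteq> w" using pick_avoiding_two[OF vV(4), of w w] by auto
    show False
      using quadrangle_no_triangle[of v u w w2 y] that w2 vV by (auto simp: C_def N_def)
  qed
  have tri2: False if "w \<in> C" "y \<in> nbrs E v" "y \<in> nbrs E w" for w y
  proof -
    obtain w2 where w2: "w2 \<in> nbrs E u \<inter> nbrs E v" "w2 \<noteq> w" using pick_avoiding_two[OF vV(4), of w w] by auto
    show False
      using quadrangle_no_triangle[of u v w w2 y] that w2 vV by (auto simp: C_def N_def nbrs_sym[of u])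
  qed
  have Cb: "lam * z w \<le> 2 + real (card (nbrs E w \<inter> M1))" if w: "w \<in> C" for w
  proof -
    have "y \<in> M1" if y: "y \<in> nbrs E w" "y \<noteq> u" "y \<noteq> v" for y
    proof -
      have yN: "y \<notin> N" using tri1[OF w _ y(1)] by blast
      have wy: "w \<in> nbrs E y" using y(1) nbrs_sym by metis
      have "nbrs E u \<inter> nbrs E y = {w}"
        by (rule hub_disjoint[OF vV(3,5,4) y(2,3) _ _ wy]) (use w in \<open>auto simp: C_def N_def\<close>)
      then show ?thesis using y yN nbrs_subset by (auto simp: M1_def c_def N_def)
    qed
    then have s: "nbrs E w \<subseteq> insert u (insert v (nbrs E w \<inter> M1))" by auto
    have "lam * z w \<le> real (card (insert u (insert v (nbrs E w \<inter> M1))))"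
      by (rule eig_le_card[OF _ s]) (use w NV uV vV nbrs_subset in \<open>auto simp: C_def\<close>)
    also have "\<dots> \<le> real (2 + card (nbrs E w \<inter> M1))" by (simp add: card_insert_if)
    finally show ?thesis by simp
  qed
  have Yc: "c y \<le> 1" if "y \<in> Y" for y
    using hub_nbr_codegree[OF vV(3,5,4), of y] that by (auto simp: Y_def N_def c_def)
  \<comment> \<open>Each vertex of \<open>M1\<close> is charged only once: one that is adjacent to
    both v and a vertex of \<open>C\<close> would put a triangle on a quadrangle.\<close>
  have "(\<Sum>w\<in>C. card (nbrs E w \<inter> M1)) + (\<Sum>y\<in>Y. c y) \<le> card M1"
  proof -
    have "(\<Sum>y\<in>Y. c y) = (\<Sum>y\<in>Y. if y \<in> M1 then 1 else 0)"
    proof (rule sum.cong[OF refl])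
      fix y assume y: "y \<in> Y"
      have "c y = 0 \<or> c y = 1" using Yc[OF y] by linarith
      then show "c y = (if y \<in> M1 then 1 else 0)" using y YV by (auto simp: M1_def)
    qed
    also have "\<dots> = card (Y \<inter> M1)" using finC by (simp add: sum.If_cases Int_def)
    also have "\<dots> = (\<Sum>y\<in>M1. if y \<in> Y then 1 else 0)"
      using parts_fin by (simp add: sum.If_cases Int_def conj_commute)
    finally have Y: "(\<Sum>y\<in>Y. c y) = (\<Sum>y\<in>M1. if y \<in> Y then 1 else 0)" .
    have "(\<Sum>w\<in>C. card (nbrs E w \<inter> M1)) = (\<Sum>y\<in>M1. card (nbrs E y \<inter> C))"
      by (rule sum_card_nbrs_swap) (use parts_fin finC in auto)
    then have "(\<Sum>w\<in>C. card (nbrs E w \<inter> M1)) + (\<Sum>y\<in>Y. c y)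
        = (\<Sum>y\<in>M1. card (nbrs E y \<inter> C) + (if y \<in> Y then 1 else 0))"
      unfolding Y by (simp add: sum.distrib)
    also have "\<dots> \<le> (\<Sum>y\<in>M1. 1)"
    proof (rule sum_mono)
      fix y assume y: "y \<in> M1"
      show "card (nbrs E y \<inter> C) + (if y \<in> Y then 1 else 0) \<le> 1"
      proof (cases "y \<in> Y")
        case True
        have "w \<notin> C" if "w \<in> nbrs E y" for w
          using tri2[of w y] True that nbrs_sym[of w E y] by (auto simp: Y_def)
        then have "nbrs E y \<inter> C = {}" by blast
        then show ?thesis by simp
      next
        case False
        have "card (nbrs E y \<inter> C) \<le> c y"
          unfolding c_def by (rule card_mono) (auto simp: finN C_def)
        then show ?thesis using False y by (simp add: M1_def)
      qed
    qed
    finally show ?thesis by simp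
  qed
  then have M: "(\<Sum>w\<in>C. real (card (nbrs E w \<inter> M1))) + (\<Sum>y\<in>Y. real (c y)) \<le> real (card M1)"
    by (simp only: of_nat_sum[symmetric] of_nat_add[symmetric] of_nat_le_iff)
  have "lam * lam * z v = (\<Sum>w\<in>nbrs E v. lam * z w)"
    unfolding mult.assoc eig[OF vV(1)] by (rule sum_distrib_left)
  also have "\<dots> = (\<Sum>w\<in>C. lam * z w) + (\<Sum>y\<in>Y. lam * z y)"
    using sum.Int_Diff[of "nbrs E v" "\<lambda>w. lam * z w" N] by (simp add: C_def Y_def Int_commute)
  also have "\<dots> \<le> (\<Sum>w\<in>C. 2 + real (card (nbrs E w \<inter> M1))) + (\<Sum>y\<in>Y. real (c y) + real (card (nbrs E y - N)))"
    by (intro add_mono sum_mono Cb outside_bound) (use YV in auto)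
  also have "\<dots> = 2 * real (card C) + ((\<Sum>w\<in>C. real (card (nbrs E w \<inter> M1))) + (\<Sum>y\<in>Y. real (c y)))
      + (\<Sum>y\<in>Y. real (card (nbrs E y - N)))"
    by (simp add: sum.distrib)
  also have "\<dots> \<le> 2 * real (card C) + real (card M1) + 2 * real waste"
    using M waste_degree_le[of Y] YV by fastforce
  also have "\<dots> \<le> 2 * real (c v) + a + 2 * real waste"
    by (simp add: a_def c_def C_def)
  finally show ?thesis .
qed

end

text \<open>Over all directed edges the slacks 1 - (\<phi> x y + \<phi> y x) add up to twice the
  difference of the two sides. They are nonnegative, so equality makes each of them vanish.\<close>

lemma (in fin_graph) sum_edges_le:
  fixes \<phi> :: "'a \<Rightarrow> 'a \<Rightarrow> real"
  assumes "\<And>x y. {x, y} \<in> E \<Longrightarrow> \<phi> x y + \<phi> y x \<le> 1"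
  shows "(\<Sum>x\<in>V. \<Sum>y\<in>nbrs E x. \<phi> x y) \<le> real (card E)"
    and "(\<Sum>x\<in>V. \<Sum>y\<in>nbrs E x. \<phi> x y) = real (card E) \<Longrightarrow> {x, y} \<in> E \<Longrightarrow> \<phi> x y + \<phi> y x = 1"
proof -
  have as_matrix: "(\<Sum>x\<in>V. \<Sum>y\<in>nbrs E x. g x y) = (\<Sum>x\<in>V. \<Sum>y\<in>V. of_bool ({x, y} \<in> E) * g x y)"
    for g :: "'a \<Rightarrow> 'a \<Rightarrow> real"
    by (intro sum.cong refl sum_nbrs)
  have swap: "(\<Sum>x\<in>V. \<Sum>y\<in>nbrs E x. \<phi> y x) = (\<Sum>x\<in>V. \<Sum>y\<in>nbrs E x. \<phi> x y)"
    unfolding as_matrix by (subst sum.swap) (simp add: insert_commute)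
  have "(\<Sum>x\<in>V. \<Sum>y\<in>nbrs E x. 1) = 2 * real (card E)"
  proof -
    have "(\<Sum>x\<in>V. \<Sum>y\<in>nbrs E x. 1) = real (\<Sum>x\<in>V. card (nbrs E x))" by simp
    then show ?thesis unfolding handshake by simp
  qed
  then have eq: "(\<Sum>x\<in>V. \<Sum>y\<in>nbrs E x. 1 - (\<phi> x y + \<phi> y x))
      = 2 * real (card E) - 2 * (\<Sum>x\<in>V. \<Sum>y\<in>nbrs E x. \<phi> x y)"
    by (simp only: sum_subtractf sum.distrib swap)
  have nn: "0 \<le> 1 - (\<phi> x y + \<phi> y x)" if "y \<in> nbrs E x" for x y
    using assms[of x y] that by (simp add: nbrs_iff)
  have inner: "0 \<le> (\<Sum>y\<in>nbrs E x. 1 - (\<phi> x y + \<phi> y x))" for x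
    by (rule sum_nonneg) (rule nn)
  have "0 \<le> (\<Sum>x\<in>V. \<Sum>y\<in>nbrs E x. 1 - (\<phi> x y + \<phi> y x))"
    by (intro sum_nonneg inner)
  with eq show "(\<Sum>x\<in>V. \<Sum>y\<in>nbrs E x. \<phi> x y) \<le> real (card E)" by simp
  assume "(\<Sum>x\<in>V. \<Sum>y\<in>nbrs E x. \<phi> x y) = real (card E)" and e: "{x, y} \<in> E"
  with eq have "(\<Sum>x\<in>V. \<Sum>y\<in>nbrs E x. 1 - (\<phi> x y + \<phi> y x)) = 0" by simp
  then have "(\<Sum>y\<in>nbrs E x. 1 - (\<phi> x y + \<phi> y x)) = 0"
    using sum_nonneg_eq_0_iff[of V "\<lambda>x. \<Sum>y\<in>nbrs E x. 1 - (\<phi> x y + \<phi> y x)"] fin inner edgeD[OF e] by blast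
  then have "1 - (\<phi> x y + \<phi> y x) = 0"
    using sum_nonneg_eq_0_iff[of "nbrs E x" "\<lambda>y. 1 - (\<phi> x y + \<phi> y x)"] nn[of _ x] e by (simp add: nbrs_iff)
  then show "\<phi> x y + \<phi> y x = 1" by simp
qed

context top_eigen
begin

section \<open>Excluding too few bridges, and finding a hub\<close>

lemma sum_TN_le: "(\<Sum>x\<in>TN. z x) \<le> lam" "(\<Sum>x\<in>TN. z x) \<le> real (card TN)"
proof -
  have "(\<Sum>x\<in>TN. z x) \<le> (\<Sum>x\<in>N. z x)"
    by (rule sum_mono2) (use finN z0 in \<open>auto simp: TN_def\<close>)
  also have "\<dots> = lam" using eig[OF uV] by (simp add: zu N_def)
  finally show "(\<Sum>x\<in>TN. z x) \<le> lam" .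
  show "(\<Sum>x\<in>TN. z x) \<le> real (card TN)"
    using sum_mono[of TN z "\<lambda>_. 1"] z1 parts_V by auto
qed

lemma sum_M_le: "(\<Sum>x\<in>M1. z x) \<le> real (card M1)" "(\<Sum>x\<in>M2. z x) \<le> real (card M2)"
proof -
  have "(\<Sum>x\<in>A. z x) \<le> real (card A)" if "A \<subseteq> V" for A
    using sum_mono[of A z "\<lambda>_. 1"] z1 that by auto
  then show "(\<Sum>x\<in>M1. z x) \<le> real (card M1)" "(\<Sum>x\<in>M2. z x) \<le> real (card M2)"
    using parts_V by blast+
qed

lemma \<zeta>_le_a: "\<zeta> \<le> a"
  using sum_TN_le(2) sum_M_le by (simp add: \<zeta>_def a_def)

lemma \<zeta>_nonneg: "0 \<le> \<zeta>"
  unfolding \<zeta>_def by (intro add_nonneg_nonneg mult_nonneg_nonneg sum_nonneg z0) auto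

text \<open>If no edge has a single partner only, the quadrangles through u are edge-disjoint, so there are
  too few two-step walks from u.\<close>

lemma two_partners_impossible:
  assumes par: "\<And>x y. {x, y} \<in> E \<Longrightarrow> {x, y} \<notin> bridges E \<Longrightarrow>
      \<exists>f g. f \<noteq> g \<and> (\<forall>A. A \<subseteq> E - {{x, y}} \<longrightarrow> conn A x y \<longrightarrow> f \<in> A \<and> g \<in> A)"
    and n: "card V = t + s + 2" "3 * s + 6 \<le> t" and L: "2 * real t + real s / 2 \<le> lam * lam"
  shows False
proof -
  \<comment> \<open>Both partners of pw lie on every detour around it, so two detours share at least
    two edges.\<close>
  have meet: False
    if e: "{p, w} \<in> E" and A: "A \<subseteq> E - {{p, w}}" "conn A p w" and B: "B \<subseteq> E - {{p, w}}" "conn B p w"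
      and AB: "A \<inter> B \<subseteq> {h}" for p w A B and h :: "'a set"
  proof -
    have "conn (E - {{p, w}}) p w" using A conn_mono by metis
    then have "{p, w} \<notin> bridges E" by (simp add: bridge_iff)
    then obtain f g where "f \<noteq> g" "f \<in> A" "g \<in> A" "f \<in> B" "g \<in> B"
      using par[OF e] A B by metis
    then show False using AB by blast
  qed
  have He: "H = {}"
  proof (rule ccontr)
    assume "H \<noteq> {}"
    then obtain x where x: "x \<in> V" "x \<notin> N" "x \<noteq> u" "3 \<le> card (N \<inter> nbrs E x)" by (auto simp: H_def c_def)
    obtain w where w: "w \<in> N" "w \<in> nbrs E x" using pick_avoiding_two[OF x(4)] by auto
    obtain w1 where w1: "w1 \<in> N" "w1 \<in> nbrs E x" "w1 \<noteq> w" using pick_avoiding_two[OF x(4), of w w] by auto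
    obtain w2 where w2: "w2 \<in> N" "w2 \<in> nbrs E x" "w2 \<noteq> w" "w2 \<noteq> w1"
      using pick_avoiding_two[OF x(4), of w w1] by auto
    have e: "{u, w} \<in> E" "{u, w1} \<in> E" "{w1, x} \<in> E" "{x, w} \<in> E" "{u, w2} \<in> E" "{w2, x} \<in> E"
      using w w1 w2 by (auto simp: N_def nbrs_iff insert_commute)
    note d = e[THEN edgeD]
    show False
    proof (rule meet[OF e(1), of "{{u, w1}, {w1, x}, {x, w}}" "{{u, w2}, {w2, x}, {x, w}}" "{x, w}"])
    qed (use e d w1 w2 x in \<open>auto simp: doubleton_eq_iff conn_walk3\<close>)
  qed
  have C2: "card (N \<inter> nbrs E x) = 2" if "x \<in> M2" for x using that by (simp add: M2_def c_def)
  have disj: "(N \<inter> nbrs E x) \<inter> (N \<inter> nbrs E y) = {}" if xy: "x \<in> M2" "y \<in> M2" "x \<noteq> y" for x y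
  proof (rule ccontr)
    assume "\<not> ?thesis"
    then obtain w where w: "w \<in> N" "w \<in> nbrs E x" "w \<in> nbrs E y" by blast
    obtain w1 where w1: "w1 \<in> N" "w1 \<in> nbrs E x" "w1 \<noteq> w"
      using C2[OF xy(1)] by (auto simp: card_2_iff')
    obtain w2 where w2: "w2 \<in> N" "w2 \<in> nbrs E y" "w2 \<noteq> w"
      using C2[OF xy(2)] by (auto simp: card_2_iff')
    have e: "{u, w} \<in> E" "{u, w1} \<in> E" "{w1, x} \<in> E" "{x, w} \<in> E" "{u, w2} \<in> E" "{w2, y} \<in> E" "{y, w} \<in> E"
      using w w1 w2 by (auto simp: N_def nbrs_iff insert_commute)
    note d = e[THEN edgeD]
    have xyN: "x \<notin> N" "y \<notin> N" "x \<noteq> u" "y \<noteq> u" using xy by (auto simp: M2_def)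
    then have ne: "x \<noteq> w2" "y \<noteq> w1" "x \<noteq> w" "y \<noteq> w" using w w1 w2 by auto
    show False
    proof (rule meet[OF e(1), of "{{u, w1}, {w1, x}, {x, w}}" "{{u, w2}, {w2, y}, {y, w}}" "{u, w1}"])
    qed (use e d w1 w2 xy xyN ne in \<open>auto simp: doubleton_eq_iff conn_walk3\<close>)
  qed
  have tri: "(N \<inter> nbrs E x) \<inter> TN = {}" if x: "x \<in> M2" for x
  proof (rule ccontr)
    assume "\<not> ?thesis"
    then obtain w where w: "w \<in> N" "w \<in> nbrs E x" "w \<in> TN" by blast
    obtain w1 where w1: "w1 \<in> N" "w1 \<in> nbrs E x" "w1 \<noteq> w"
      using C2[OF x] by (auto simp: card_2_iff')
    have "N \<inter> nbrs E w \<noteq> {}" using w(3) by (auto simp: TN_def c_def)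
    then obtain b where "b \<in> N" "b \<in> nbrs E w" by blast
    then show False
      using quadrangle_no_triangle[of x u w w1 b] w w1 x by (auto simp: N_def M2_def)
  qed
  have "card (\<Union>x\<in>M2. N \<inter> nbrs E x) = (\<Sum>x\<in>M2. card (N \<inter> nbrs E x))"
    by (rule card_UN_disjoint) (use parts_fin finN disj in auto)
  also have "\<dots> = 2 * card M2" using C2 by simp
  finally have cU: "card (\<Union>x\<in>M2. N \<inter> nbrs E x) = 2 * card M2" .
  have "card TN + card (\<Union>x\<in>M2. N \<inter> nbrs E x) = card (TN \<union> (\<Union>x\<in>M2. N \<inter> nbrs E x))"
    by (rule card_Un_disjoint[symmetric]) (use parts_fin finN tri in auto)
  also have "\<dots> \<le> card N" by (rule card_mono[OF finN]) (auto simp: TN_def)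
  finally have 1: "card TN + 2 * card M2 \<le> card N" using cU by simp
  have 2: "card N + card M1 + card M2 \<le> t + s + 1" using card_parts n(1) by linarith
  define \<tau> where "\<tau> = (\<Sum>x\<in>TN. z x)"
  have "lam * lam = real (card N) + \<zeta>" using lam_sq by (simp add: He)
  then have "lam * lam \<le> real (card N) + \<tau> + real (card M1) + 2 * real (card M2)"
    using sum_M_le by (simp add: \<zeta>_def \<tau>_def)
  moreover have "\<tau> \<le> lam" "\<tau> \<le> real (card TN)" using sum_TN_le by (simp_all add: \<tau>_def)
  moreover have "real (card TN) + 2 * real (card M2) \<le> real (card N)"
    "real (card N) + real (card M1) + real (card M2) \<le> real t + real s + 1"
    "0 \<le> real (card M1)"
    using 1 2 by linarith+
  ultimately have "lam * lam \<le> real t + real s + 1 + real (card M2) + \<tau>"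
    "3 * real (card M2) + \<tau> \<le> real t + real s + 1" "\<tau> \<le> lam" by linarith+
  \<comment> \<open>Three times the first bound plus the second eliminates \<open>card M2\<close>;
    \<open>\<tau>\<close> is then replaced by lam.\<close>
  then have 3: "3 * (lam * lam) \<le> 4 * (real t + real s + 1) + 2 * lam" by argo
  have T: "3 * real s + 6 \<le> real t" "0 \<le> real s" using n(2) by linarith+
  \<comment> \<open>Inserting lam^2 \<ge> 2t + s/2 and s \<le> t/3 - 2 into the last bound. As t
    \<ge> 6 this gives lam \<ge> 4, whence 3 lam^2 - 2 lam \<ge> 10 lam, more than 4(t + s +
    1).\<close>
  have x: "12 * lam \<ge> 7 * real t + 6" using 3 L T by argo
  then have "lam \<ge> 4" using T by linarith
  then have "lam * lam \<ge> 4 * lam" using lam0 by (intro mult_right_mono) auto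
  then show False using 3 x T by argo
qed

text \<open>This supplies the quadrangle for \<open>codegree_sum_bound\<close>. Without it two-step
  walks give lam^2 \<le> t + s + 1 + lam, and lam^2 \<ge> 2t + s/2 then forces lam \<ge> 5t/6, too
  large for that inequality.\<close>

lemma codegree_two_exists:
  assumes n: "card V = t + s + 2" "3 * s + 6 \<le> t" and L: "2 * real t + real s / 2 \<le> lam * lam"
  shows "\<exists>x\<in>V. x \<noteq> u \<and> 2 \<le> c x"
proof (rule ccontr)
  assume "\<not> ?thesis"
  then have le: "c x \<le> 1" if "x \<in> V" "x \<noteq> u" for x using that by force
  have e: "H = {}" "M2 = {}" using le by (force simp: H_def M2_def)+
  have "lam * lam = real (card N) + \<zeta>" using lam_sq by (simp add: e)
  also have "\<zeta> \<le> lam + real (card M1)" using sum_TN_le(1) sum_M_le(1) by (simp add: \<zeta>_def e)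
  finally have 1: "lam * lam \<le> real (card N) + lam + real (card M1)" by simp
  have "card N + card M1 \<le> t + s + 1" using card_parts n(1) by linarith
  then have 2: "lam * lam \<le> real t + real s + 1 + lam" using 1 by linarith
  have T: "3 * real s + 6 \<le> real t" "0 \<le> real s" using n(2) by linarith+
  have x: "6 * lam \<ge> 5 * real t" using 2 L T by argo
  then have "lam \<ge> 4" using T by linarith
  then have "lam * lam \<ge> 4 * lam" using lam0 by (intro mult_right_mono) auto
  then show False using 2 x T by linarith
qed

text \<open>The slack between the number of two-step walks and the square of the eigenvalue is at most s/2.
  It bounds the walks ending outside the hubs, so some hub carries almost all of the weight.\<close>

lemma big_hub:
  assumes n: "card V = t + s + 2" "3 * s + 6 \<le> t" and b: "card (bridges E) = s"
    and L: "2 * real t + real s / 2 \<le> lam * lam"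
  shows "lam * lam \<le> 2 * real t + real s" and "\<exists>v\<in>H. 12 * t \<le> 12 * c v + 11 * s"
proof -
  define q where "q = (\<Sum>y\<in>V. c y)"
  define Hc where "Hc = real (\<Sum>x\<in>H. c x)"
  have T: "3 * real s + 6 \<le> real t" "0 \<le> real s" using n(2) by linarith+
  obtain x where x: "x \<in> V" "x \<noteq> u" "2 \<le> c x" using codegree_two_exists[OF n L] by blast
  have "q + waste + s + 4 \<le> 2 * (t + s + 2)"
    using codegree_sum_bound[OF con uV x(1,2)] x(3) by (simp add: q_def c_def N_def waste_def b n)
  then have "real (q + waste + s + 4) \<le> real (2 * (t + s + 2))" by (simp only: of_nat_le_iff)
  then have q1: "real q + real waste \<le> 2 * real t + real s" by simp
  have q2: "real q = real (card N) + a + Hc" using codegree_sum by (simp add: q_def Hc_def)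
  have hl: "(\<Sum>x\<in>H. real (c x) * z x) = Hc - hloss"
    by (simp add: hloss_def Hc_def algebra_simps sum_subtractf)
  have Lq: "lam * lam = real (card N) + \<zeta> + Hc - hloss" using lam_sq hl by simp
  have hl0: "0 \<le> hloss" unfolding hloss_def
    using z1 parts_V by (intro sum_nonneg mult_nonneg_nonneg) auto
  show Lle: "lam * lam \<le> 2 * real t + real s"
    using Lq q1 q2 hl0 \<zeta>_le_a by linarith
  \<comment> \<open>Everything lost between the walk count, at most 2t + s, and lam^2, at least 2t +
    s/2.\<close>
  have I0: "(a - \<zeta>) + hloss + real waste \<le> real s / 2" using Lq q1 q2 L by linarith
  then have I: "hloss + real waste \<le> real s / 2" using \<zeta>_le_a by linarith
  have a0: "0 \<le> a" by (simp add: a_def)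
  \<comment> \<open>For s \<ge> 1 lam is at least 4, so \<zeta> \<le> a/2 + waste, which turns
    \<open>I0\<close> into the claim. For s = 0 only lam > 2 is shown, but there is no slack:
    \<zeta> = a, and \<open>\<zeta>_bound\<close> leaves only a = 0.\<close>
  have II: "a / 2 + hloss \<le> real s / 2"
  proof (cases "s = 0")
    case True
    then have w: "waste = 0" "hloss = 0" "a = \<zeta>" using I0 hl0 \<zeta>_le_a by linarith+
    have "lam * a \<le> 2 * a" using \<zeta>_bound w by simp
    moreover have "lam > 2"
    proof (rule ccontr)
      assume "\<not> ?thesis"
      then have "lam * lam \<le> 2 * 2" using lam0 by (intro mult_mono) auto
      then show False using L T by linarith
    qed
    ultimately have "a = 0" using a0 by (metis mult_le_cancel_right not_le order_le_imp_less_or_eq)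
    then show ?thesis using w by simp
  next
    case False
    have "lam \<ge> 4"
    proof (rule ccontr)
      assume "\<not> ?thesis"
      then have "lam * lam \<le> 4 * 4" using lam0 by (intro mult_mono) auto
      moreover have "1 \<le> real s" using False by simp
      ultimately show False using L T by linarith
    qed
    then have "4 * \<zeta> \<le> lam * \<zeta>" using \<zeta>_nonneg by (intro mult_right_mono) auto
    then show ?thesis using \<zeta>_bound I0 by linarith
  qed
  have Hne: "H \<noteq> {}"
  proof
    assume "H = {}"
    then have "Hc = 0" by (simp add: Hc_def)
    moreover have "card N \<le> t + s + 1" using card_parts n(1) by linarith
    ultimately show False using Lq \<zeta>_le_a hl0 II L T by linarith
  qed
  then have "Max (z ` H) \<in> z ` H" using parts_fin by (intro Max_in) auto
  then obtain v where v: "v \<in> H" "z v = Max (z ` H)" by auto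
  then have vmax: "z x \<le> z v" if "x \<in> H" for x using that parts_fin by simp
  have zv1: "z v \<le> 1" using z1 v parts_V by blast
  have "1 \<le> card H" using Hne parts_fin by (simp add: Suc_le_eq card_gt_0_iff)
  then have "card N \<le> t + s" using card_parts n(1) by linarith
  then have Hc: "Hc \<ge> real t - 3 / 2 * real s"
    using Lq \<zeta>_le_a hl0 II L q2 by linarith
  have "(1 - z v) * Hc \<le> hloss"
    unfolding hloss_def Hc_def of_nat_sum sum_distrib_left
  proof (intro sum_mono)
    fix x assume "x \<in> H"
    then have "real (c x) * (1 - z v) \<le> real (c x) * (1 - z x)"
      using vmax by (intro mult_left_mono) auto
    then show "(1 - z v) * real (c x) \<le> real (c x) * (1 - z x)" by (simp add: mult.commute)
  qed
  moreover have "(1 - z v) * (real t - 3 / 2 * real s) \<le> (1 - z v) * Hc"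
    using Hc zv1 by (intro mult_left_mono) auto
  \<comment> \<open>The constant 14/3 is the quotient of 2t + s by t - 3s/2 at t = 3s, its largest
    value for t \<ge> 3s > 0.\<close>
  moreover have "(1 - z v) * (lam * lam) \<le> (1 - z v) * (14 / 3 * (real t - 3 / 2 * real s))"
  proof (rule mult_left_mono)
    show "lam * lam \<le> 14 / 3 * (real t - 3 / 2 * real s)" using Lle T by argo
  qed (use zv1 in simp)
  moreover have "(1 - z v) * (14 / 3 * (real t - 3 / 2 * real s)) = 14 / 3 * ((1 - z v) * (real t - 3 / 2 * real s))"
    by simp
  ultimately have "(1 - z v) * (lam * lam) \<le> 14 / 3 * hloss" by linarith
  then have "lam * lam - lam * lam * z v \<le> 14 / 3 * hloss" by (simp add: algebra_simps)
  \<comment> \<open>By \<open>hub_bound\<close>, 2 \<open>c v\<close> \<ge> lam^2 - 14/3 hloss - a -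
    2 waste. Here a and 2 waste are each at most s - 2 hloss, and hloss \<le> s/2, so the total loss
    is at most 7s/3; against 2t + s/2 this leaves 2t - 11s/6.\<close>
  then have "12 * real t \<le> 12 * real (c v) + 11 * real s"
    using hub_bound[OF v(1)] I II hl0 L by linarith
  then have "12 * t \<le> 12 * c v + 11 * s" by linarith
  then show "\<exists>v\<in>H. 12 * t \<le> 12 * c v + 11 * s" using v(1) by blast
qed

end

text \<open>The hypothesis \<open>eq\<close> results from L = c(1 + z) + Ru and Lz = c(1 + z) + Rv
  by eliminating the entry z of the second hub. With r = L - t and j = t - c missing common
  neighbours, the 2j extra edges allowed in return cannot make up for the loss: what remains is j(2t
  - 2j - s) \<le> 0.\<close>

lemma hub_equation:
  fixes L t s c Ru Rv :: real
  assumes t: "0 < t" "0 \<le> s" and L1: "t + s / 2 \<le> L - t" and L2: "t\<^sup>2 \<le> (L - t) * (L - t - s)"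
    and c: "c \<le> t" "s < 2 * c" and R: "0 \<le> Ru" "0 \<le> Rv" "Ru + Rv \<le> s + 2 * (t - c)"
    and eq: "(L - c - Ru) * (L - c) = c * (c + Rv)"
  shows "c = t" "(L - t) * (L - t - s) = t\<^sup>2" "s \<le> Ru"
proof -
  define r where "r = L - t"
  define j where "j = t - c"
  have L: "L = r + t" "c = t - j" by (simp_all add: r_def j_def)
  have r: "t + s / 2 \<le> r" "t\<^sup>2 \<le> r * (r - s)" using L1 L2 by (simp_all add: r_def)
  have j0: "0 \<le> j" using c by (simp add: j_def)
  have "(r + j) * (r - j - s + Rv) \<le> (r + j) * (r + j - Ru)"
    using R r j0 t by (intro mult_left_mono) (auto simp: L)
  also have "\<dots> = c * (c + Rv)" using eq by (simp add: L algebra_simps)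
  finally have 1: "(r + j) * (r - j - s) + Rv * (r + 2 * j - t) \<le> (t - j)\<^sup>2"
    by (simp add: L algebra_simps power2_eq_square)
  have "0 \<le> Rv * (r + 2 * j - t)" using R r j0 t by (intro mult_nonneg_nonneg) auto
  then have "j * (2 * t - 2 * j - s) \<le> 0"
    using 1 r(2) by (simp add: algebra_simps power2_eq_square)
  moreover have "0 < 2 * t - 2 * j - s" using c by (simp add: L)
  ultimately have "j \<le> 0" by (simp add: mult_le_0_iff)
  then have j: "j = 0" using j0 by simp
  then show ct: "c = t" by (simp add: L)
  have 2: "r * (r - s) + Rv * (r - t) \<le> t\<^sup>2" using 1 j by simp
  moreover have 3: "0 \<le> Rv * (r - t)" using R r t by (intro mult_nonneg_nonneg) auto
  ultimately have req: "r * (r - s) = t\<^sup>2" using r by linarith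
  then show "(L - t) * (L - t - s) = t\<^sup>2" by (simp add: r_def)
  show "s \<le> Ru"
  proof (cases "s = 0")
    case False
    then have "r - t > 0" using r t by linarith
    moreover have "Rv * (r - t) = 0" using 2 3 req by linarith
    ultimately have "Rv = 0" by simp
    then have "r * (r - Ru) = t\<^sup>2"
      using eq ct by (simp add: L j power2_eq_square mult.commute)
    then have "r * (r - Ru) = r * (r - s)" by (simp only: req)
    moreover have "r > 0" using r t by linarith
    ultimately show ?thesis by (simp only: mult_cancel_left) linarith
  qed (use R in simp)
qed

section \<open>The extremal graph\<close>

locale top_hub = top_eigen +
  fixes v :: 'a
  assumes vH: "v \<in> H"
begin

definition "C = N \<inter> nbrs E v"
definition "R = V - C - {u, v}"
definition "S = {e \<in> E. \<forall>w\<in>C. e \<noteq> {u, w} \<and> e \<noteq> {v, w}}"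

lemma vV: "v \<in> V" "v \<notin> N" "v \<noteq> u" "3 \<le> card C" "c v = card C"
  using vH by (auto simp: H_def c_def C_def)

lemma uv: "u \<notin> nbrs E v" "v \<notin> nbrs E u"
  using vV(2) nbrs_sym[of u E v] by (auto simp: N_def)

lemma hub3: "3 \<le> card (nbrs E u \<inter> nbrs E v)"
  using vV by (simp add: C_def N_def)

lemma CV: "C \<subseteq> V" "finite C" "u \<notin> C" "v \<notin> C"
  using NV finN uN vV by (auto simp: C_def)

lemma RV: "R \<subseteq> V" "finite R"
  using fin by (auto simp: R_def)

lemma SE: "S \<subseteq> E" by (auto simp: S_def)

lemma CE: "w \<in> C \<Longrightarrow> {u, w} \<in> E" "w \<in> C \<Longrightarrow> {v, w} \<in> E"
  by (auto simp: C_def N_def nbrs_iff)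

lemma no_triangle_u: "w \<in> C \<Longrightarrow> y \<in> N \<Longrightarrow> y \<in> nbrs E w \<Longrightarrow> False"
proof -
  assume w: "w \<in> C" "y \<in> N" "y \<in> nbrs E w"
  obtain w2 where w2: "w2 \<in> nbrs E u \<inter> nbrs E v" "w2 \<noteq> w" using pick_avoiding_two[OF hub3, of w w] by auto
  show False
    using quadrangle_no_triangle[of v u w w2 y, OF vV(3) uv(2)] w w2 by (auto simp: C_def N_def)
qed

lemma no_triangle_v: "w \<in> C \<Longrightarrow> y \<in> nbrs E v \<Longrightarrow> y \<in> nbrs E w \<Longrightarrow> False"
proof -
  assume w: "w \<in> C" "y \<in> nbrs E v" "y \<in> nbrs E w"
  obtain w2 where w2: "w2 \<in> nbrs E u \<inter> nbrs E v" "w2 \<noteq> w" using pick_avoiding_two[OF hub3, of w w] by auto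
  show False
    using quadrangle_no_triangle[of u v w w2 y, OF vV(3)[symmetric] uv(1)] w w2 by (auto simp: C_def N_def)
qed

lemma card_S: "card E = card S + 2 * card C"
proof -
  define A where "A = (\<lambda>w. {u, w}) ` C"
  define B where "B = (\<lambda>w. {v, w}) ` C"
  have "card A = card C" "card B = card C"
    unfolding A_def B_def by (intro card_image; auto simp: inj_on_def doubleton_eq_iff)+
  moreover have "A \<inter> B = {}" using CV vV by (auto simp: A_def B_def doubleton_eq_iff)
  moreover have "finite A" "finite B" using CV by (auto simp: A_def B_def)
  ultimately have AB: "card (A \<union> B) = 2 * card C" "finite (A \<union> B)" by (simp_all add: card_Un_disjoint)
  have "A \<union> B \<subseteq> E" using CE by (auto simp: A_def B_def)
  moreover have "S = E - (A \<union> B)" by (auto simp: S_def A_def B_def)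
  ultimately show ?thesis
    using card_Diff_subset[OF AB(2), of E] card_mono[OF finE, of "A \<union> B"] AB(1) by simp
qed

lemma S_bound: "card S + 2 * card C + card (bridges E) + 4 \<le> 2 * card V"
proof -
  obtain w1 where w1: "w1 \<in> C" using pick_avoiding_two[OF vV(4)] by auto
  obtain w2 where w2: "w2 \<in> C" "w2 \<noteq> w1" using pick_avoiding_two[OF vV(4), of w1 w1] by auto
  have "card E + card (bridges E) + 4 \<le> 2 * card V"
    by (rule sparse_quadrangle[OF tc con, of u w1 v w2])
      (use w1 w2 CE[of w1] CE[of w2] vV(3) in \<open>auto simp: insert_commute\<close>)
  then show ?thesis using card_S by simp
qed

text \<open>Every edge of the complete bipartite part lies on a quadrangle. This gives s \<le>
  \<open>card S\<close>, from which \<open>hub_extremal\<close> concludes \<open>card C\<close>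
  \<le> t.\<close>

lemma bridges_S: "bridges E \<subseteq> S"
proof
  fix e assume e: "e \<in> bridges E"
  have *: "{p, w} \<notin> bridges E" if w: "w \<in> C" and p: "{p, r} = {u, v}" for w p r
  proof -
    obtain w2 where w2: "w2 \<in> C" "w2 \<noteq> w" using pick_avoiding_two[OF vV(4), of w w] by auto
    have ne: "p \<noteq> r" using p vV(3) by (auto simp: doubleton_eq_iff)
    have pr: "{p, w2} \<in> E" "{r, w2} \<in> E" "{r, w} \<in> E" "p \<noteq> w" "p \<noteq> w2"
      using p CE[OF w] CE[OF w2(1)] CV w w2 by (auto simp: doubleton_eq_iff)
    have "conn (E - {{p, w}}) p w"
      by (rule conn_path3[of p w2 _ r])
        (use pr ne w2 in \<open>auto simp: doubleton_eq_iff insert_commute\<close>)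
    then show ?thesis by (simp add: bridge_iff)
  qed
  have "{u, w} \<notin> bridges E" "{v, w} \<notin> bridges E" if "w \<in> C" for w
    using *[OF that, of u v] *[OF that, of v u] by (auto simp: insert_commute)
  with e show "e \<in> S" using bridges_subset by (auto simp: S_def)
qed

lemma nbrs_S_C:
  assumes "w \<in> C"
  shows "nbrs E w = {u, v} \<union> nbrs S w" "u \<notin> nbrs S w" "v \<notin> nbrs S w"
proof -
  have w: "w \<noteq> u" "w \<noteq> v" using assms CV by auto
  show "nbrs E w = {u, v} \<union> nbrs S w"
    using CE[OF assms] w by (auto simp: nbrs_iff S_def doubleton_eq_iff insert_commute)
  show "u \<notin> nbrs S w" "v \<notin> nbrs S w"
    using assms by (auto simp: nbrs_iff S_def insert_commute)
qed

lemma nbrs_S_other: "w \<notin> C \<Longrightarrow> w \<noteq> u \<Longrightarrow> w \<noteq> v \<Longrightarrow> nbrs E w = nbrs S w"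
  by (auto simp: nbrs_iff S_def doubleton_eq_iff)

text \<open>Two neighbours in \<open>C\<close> contradict \<open>hub_disjoint\<close>; one in
  \<open>C\<close> together with u or v puts a triangle on a quadrangle; u together with v would
  place x in \<open>C\<close>.\<close>

lemma R_outside: "x \<in> R \<Longrightarrow> card (nbrs E x - R) \<le> 1"
proof -
  assume x: "x \<in> R"
  have xR: "x \<in> V" "x \<notin> C" "x \<noteq> u" "x \<noteq> v" using x by (auto simp: R_def)
  have outC: "p \<in> C \<or> p = u \<or> p = v" if "p \<in> nbrs E x - R" for p
    using that nbrs_subset by (auto simp: R_def)
  have key: "p = q" if p: "p \<in> nbrs E x" "p \<in> C" and q: "q \<in> nbrs E x" "q \<in> C \<or> q = u \<or> q = v" for p q
  proof -
    have px: "x \<in> nbrs E p" and qx: "x \<in> nbrs E q" using p q nbrs_sym by metis+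
    consider "q \<in> C" | "q = u" | "q = v" using q by blast
    then show ?thesis
    proof cases
      case 1
      have "nbrs E u \<inter> nbrs E x = {p}"
        by (rule hub_disjoint[OF vV(3) uv(2) hub3 xR(3,4) _ _ p(1)]) (use p in \<open>auto simp: C_def N_def\<close>)
      moreover have "q \<in> nbrs E u \<inter> nbrs E x" using 1 q by (auto simp: C_def N_def)
      ultimately show ?thesis by simp
    next
      case 2
      then have "x \<in> N" using qx by (simp add: N_def)
      then show ?thesis using no_triangle_u[OF p(2) _ px] by blast
    next
      case 3
      then show ?thesis using no_triangle_v[OF p(2) _ px] qx by blast
    qed
  qed
  have notboth: False if "u \<in> nbrs E x" "v \<in> nbrs E x"
  proof -
    have "x \<in> nbrs E u" "x \<in> nbrs E v" using that nbrs_sym by metis+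
    then show False using xR by (auto simp: C_def N_def)
  qed
  have "p = q" if pq: "p \<in> nbrs E x - R" "q \<in> nbrs E x - R" for p q
    using outC[OF pq(1)] outC[OF pq(2)] key[of p q] key[of q p] notboth pq by blast
  then show ?thesis
    by (subst card_le_Suc0_iff_eq[unfolded One_nat_def[symmetric]]) auto
qed

lemma R_eig: "x \<in> R \<Longrightarrow> lam * z x \<le> real (card (nbrs E x - R)) + (\<Sum>y\<in>nbrs E x \<inter> R. z y)"
proof -
  assume x: "x \<in> R"
  have "lam * z x = (\<Sum>y\<in>nbrs E x \<inter> R. z y) + (\<Sum>y\<in>nbrs E x - R. z y)"
    using eig[of x] x RV sum.Int_Diff[of "nbrs E x" z R] by auto
  moreover have "(\<Sum>y\<in>nbrs E x - R. z y) \<le> real (card (nbrs E x - R))"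
    using sum_mono[of "nbrs E x - R" z "\<lambda>_. 1"] z1 nbrs_subset by fastforce
  ultimately show ?thesis by simp
qed

lemma R_degree_sum: "(\<Sum>y\<in>R. 2 * card (nbrs E y - R) + card (nbrs E y \<inter> R)) \<le> 2 * card S"
proof -
  define S1 where "S1 = {e \<in> S. e \<subseteq> R}"
  define S2 where "S2 = {e \<in> S. \<exists>x\<in>R. \<exists>y\<in>V - R. e = {x, y}}"
  interpret S: fin_graph V S by (rule subgraph[OF SE])
  interpret S1: fin_graph V S1 by (rule subgraph) (use SE in \<open>auto simp: S1_def\<close>)
  have nS: "nbrs E y = nbrs S y" if "y \<in> R" for y
    using nbrs_S_other[of y] that by (auto simp: R_def)
  have n1: "nbrs E y \<inter> R = nbrs S1 y" if y: "y \<in> R" for y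
    unfolding nS[OF y] using y by (auto simp: nbrs_iff S1_def)
  have "(\<Sum>y\<in>R. card (nbrs E y \<inter> R)) = (\<Sum>y\<in>R. card (nbrs S1 y))"
    using n1 by (intro sum.cong) auto
  also have "\<dots> \<le> (\<Sum>y\<in>V. card (nbrs S1 y))" by (rule sum_mono2[OF fin RV(1)]) auto
  finally have 1: "(\<Sum>y\<in>R. card (nbrs E y \<inter> R)) \<le> 2 * card S1" using S1.handshake by simp
  have "(\<Sum>y\<in>R. card (nbrs E y - R)) = (\<Sum>y\<in>R. card (nbrs S y \<inter> (V - R)))"
  proof (rule sum.cong[OF refl])
    fix y assume y: "y \<in> R"
    have "nbrs E y - R = nbrs S y \<inter> (V - R)" unfolding nS[OF y] using S.nbrs_subset by auto
    then show "card (nbrs E y - R) = card (nbrs S y \<inter> (V - R))" by simp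
  qed
  also have "\<dots> = card S2" unfolding S2_def by (rule S.card_between) (use RV in auto)
  finally have 2: "(\<Sum>y\<in>R. card (nbrs E y - R)) = card S2" .
  have "card S1 + card S2 = card (S1 \<union> S2)"
    by (rule card_Un_disjoint[symmetric]) (use S.finE in \<open>auto simp: S1_def S2_def\<close>)
  also have "\<dots> \<le> card S" by (rule card_mono[OF S.finE]) (auto simp: S1_def S2_def)
  finally show ?thesis using 1 2 by (simp add: sum.distrib sum_distrib_left[symmetric])
qed

text \<open>If the largest entry z r on \<open>R\<close> is at least 1/2, each neighbour outside
  \<open>R\<close> counts at most 2 z r, so all terms are multiples of z r. Two steps from r then
  give lam^2 \<le> 2 lam + 2 |S|. Since |S| \<le> 17s/6, lam would be linear in t, against lam^2
  \<le> 2t + s.\<close>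

lemma R_small:
  assumes n: "card V = t + s + 2" "3 * s + 6 \<le> t" and b: "card (bridges E) = s"
    and L: "2 * real t + real s / 2 \<le> lam * lam" and big: "12 * t \<le> 12 * c v + 11 * s"
    and x: "x \<in> R"
  shows "z x < 1 / 2"
proof (rule ccontr)
  assume "\<not> ?thesis"
  then have x2: "1 / 2 \<le> z x" by simp
  have "Max (z ` R) \<in> z ` R" using RV x by (intro Max_in) auto
  then obtain r where r: "r \<in> R" "z r = Max (z ` R)" by auto
  then have rmax: "z y \<le> z r" if "y \<in> R" for y using that RV by simp
  have r2: "1 / 2 \<le> z r" using x2 rmax[OF x] by simp
  have step: "lam * z y \<le> z r * (2 * real (card (nbrs E y - R)) + real (card (nbrs E y \<inter> R)))"
    if y: "y \<in> R" for y
  proof -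
    have "(\<Sum>p\<in>nbrs E y \<inter> R. z p) \<le> (\<Sum>p\<in>nbrs E y \<inter> R. z r)" by (intro sum_mono rmax) auto
    then have "(\<Sum>p\<in>nbrs E y \<inter> R. z p) \<le> z r * real (card (nbrs E y \<inter> R))" by (simp add: mult.commute)
    moreover have "1 * real (card (nbrs E y - R)) \<le> (2 * z r) * real (card (nbrs E y - R))"
      by (rule mult_right_mono) (use r2 in auto)
    ultimately show ?thesis using R_eig[OF y] by (simp add: distrib_left)
  qed
  have "lam * (lam * z r) \<le> lam * (real (card (nbrs E r - R)) + (\<Sum>y\<in>nbrs E r \<inter> R. z y))"
    using R_eig[OF r(1)] lam0 by (intro mult_left_mono) auto
  also have "\<dots> = lam * real (card (nbrs E r - R)) + (\<Sum>y\<in>nbrs E r \<inter> R. lam * z y)"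
    by (simp add: distrib_left sum_distrib_left)
  also have "\<dots> \<le> lam * (2 * z r) + (\<Sum>y\<in>R. z r * (2 * real (card (nbrs E y - R)) + real (card (nbrs E y \<inter> R))))"
  proof (rule add_mono)
    have "real (card (nbrs E r - R)) \<le> 2 * z r" using R_outside[OF r(1)] r2 by linarith
    then show "lam * real (card (nbrs E r - R)) \<le> lam * (2 * z r)" using lam0 by (intro mult_left_mono) auto
    have "(\<Sum>y\<in>nbrs E r \<inter> R. lam * z y) \<le> (\<Sum>y\<in>R. lam * z y)"
      by (rule sum_mono2) (use RV lam0 z0 in auto)
    also have "\<dots> \<le> (\<Sum>y\<in>R. z r * (2 * real (card (nbrs E y - R)) + real (card (nbrs E y \<inter> R))))"
      by (intro sum_mono step)
    finally show "(\<Sum>y\<in>nbrs E r \<inter> R. lam * z y) \<le> \<dots>" .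
  qed
  also have "(\<Sum>y\<in>R. z r * (2 * real (card (nbrs E y - R)) + real (card (nbrs E y \<inter> R))))
      = z r * real (\<Sum>y\<in>R. 2 * card (nbrs E y - R) + card (nbrs E y \<inter> R))"
    by (simp add: sum_distrib_left)
  also have "\<dots> \<le> z r * real (2 * card S)"
  proof (rule mult_left_mono)
    show "real (\<Sum>y\<in>R. 2 * card (nbrs E y - R) + card (nbrs E y \<inter> R)) \<le> real (2 * card S)"
      using R_degree_sum by (simp only: of_nat_le_iff)
  qed (rule z0)
  finally have "z r * (lam * lam) \<le> z r * (2 * lam + 2 * real (card S))"
    by (simp add: algebra_simps)
  then have 1: "lam * lam \<le> 2 * lam + 2 * real (card S)" using r2 by (simp add: mult_le_cancel_left)
  have "card S + 2 * c v + s + 4 \<le> 2 * (t + s + 2)" using S_bound vV(5) b n by simp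
  then have "real (card S + 2 * c v + s + 4) \<le> real (2 * (t + s + 2))" by (simp only: of_nat_le_iff)
  moreover have "real (12 * t) \<le> real (12 * c v + 11 * s)" using big by (simp only: of_nat_le_iff)
  moreover have T: "3 * real s + 6 \<le> real t" "0 \<le> real s" using n(2) by linarith+
  ultimately have "2 * real t - 31 / 6 * real s \<le> 2 * lam" using 1 L by simp
  then have y: "(5 * real t + 186) / 36 \<le> lam" using T by argo
  have "((5 * real t + 186) / 36) * ((5 * real t + 186) / 36) \<le> lam * lam"
    by (rule mult_mono[OF y y]) (use lam0 in auto)
  also have "\<dots> \<le> 2 * real t + real s" by (rule big_hub(1)[OF n b L])
  also have "\<dots> \<le> 7 / 3 * real t - 2" using T by argo
  finally have "(5 * real t + 186) * (5 * real t + 186) \<le> 3024 * real t - 2592" by (simp add: field_simps)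
  \<comment> \<open>Completing the square; 23000 is the positive remainder, rounded down.\<close>
  then have "(5 * real t - 582 / 5)\<^sup>2 + 23000 \<le> 0" by (simp add: power2_eq_square algebra_simps)
  moreover have "0 \<le> (5 * real t - 582 / 5)\<^sup>2" by simp
  ultimately show False by linarith
qed

text \<open>The weight of the two-step walks from p whose second edge lies outside the complete
  bipartite graph between {u, v} and \<open>C\<close>.\<close>

definition "excess p = (\<Sum>w\<in>nbrs E p. \<Sum>x\<in>nbrs S w. z x)"

lemma excess_nonneg: "0 \<le> excess p"
  unfolding excess_def by (intro sum_nonneg z0)

lemma hub_eq:
  assumes "p = u \<or> p = v"
  shows "lam * lam * z p = real (card C) * (1 + z v) + excess p"
proof -
  have pV: "p \<in> V" "C \<subseteq> nbrs E p" "u \<notin> nbrs E p" "v \<notin> nbrs E p"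
    using assms uV vV uv nbrs_irrefl by (auto simp: C_def N_def)
  interpret S: fin_graph V S by (rule subgraph[OF SE])
  have "lam * lam * z p = (\<Sum>w\<in>nbrs E p. lam * z w)"
    unfolding mult.assoc eig[OF pV(1)] by (rule sum_distrib_left)
  also have "\<dots> = (\<Sum>w\<in>nbrs E p. (if w \<in> C then 1 + z v else 0) + (\<Sum>x\<in>nbrs S w. z x))"
  proof (rule sum.cong[OF refl])
    fix w assume w: "w \<in> nbrs E p"
    have wV: "w \<in> V" using w nbrs_subset by auto
    show "lam * z w = (if w \<in> C then 1 + z v else 0) + (\<Sum>x\<in>nbrs S w. z x)"
    proof (cases "w \<in> C")
      case True
      have "(\<Sum>x\<in>nbrs E w. z x) = (\<Sum>x\<in>{u, v}. z x) + (\<Sum>x\<in>nbrs S w. z x)"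
        unfolding nbrs_S_C(1)[OF True]
        by (rule sum.union_disjoint) (use nbrs_S_C[OF True] S.finite_nbrs in auto)
      then show ?thesis using True eig[OF wV] vV(3) zu by simp
    next
      case False
      have "w \<noteq> u" "w \<noteq> v" using w pV by auto
      with False show ?thesis using eig[OF wV] nbrs_S_other[of w] by simp
    qed
  qed
  also have "\<dots> = (\<Sum>w\<in>nbrs E p. if w \<in> C then 1 + z v else 0) + excess p"
    by (simp add: sum.distrib excess_def)
  also have "(\<Sum>w\<in>nbrs E p. if w \<in> C then 1 + z v else 0) = (\<Sum>w\<in>C. 1 + z v)"
    by (rule sum_restrict) (use pV in auto)
  finally show ?thesis by simp
qed

text \<open>The share of the edge wx, traversed towards x, in \<open>excess p\<close>.\<close>

definition "wt p w x = (if w \<in> nbrs E p then z x else 0)"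

lemma excess_wt: "excess p = (\<Sum>w\<in>V. \<Sum>x\<in>nbrs S w. wt p w x)"
proof -
  have "(\<Sum>w\<in>V. \<Sum>x\<in>nbrs S w. wt p w x) = (\<Sum>w\<in>V. if w \<in> nbrs E p then \<Sum>x\<in>nbrs S w. z x else 0)"
    by (intro sum.cong refl) (auto simp: wt_def)
  also have "\<dots> = excess p" unfolding excess_def by (rule sum_restrict[OF fin nbrs_subset])
  finally show ?thesis by simp
qed

text \<open>An edge outside the complete bipartite part contributes to the two-step walks from u and v
  together at most 1, and to those from u alone less than 1 unless it contains u.\<close>

lemma edge_weight:
  assumes small: "\<And>x. x \<in> R \<Longrightarrow> z x < 1 / 2" and e: "{w, x} \<in> S"
  shows "wt u w x + wt v w x + (wt u x w + wt v x w) \<le> 1"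
    and "u \<notin> {w, x} \<Longrightarrow> wt u w x + wt u x w < 1"
proof -
  have gen: "wt u w x + wt v w x + (wt u x w + wt v x w) \<le> 1 \<and> (u \<notin> {w, x} \<longrightarrow> wt u w x + wt u x w < 1)"
    if e: "{w, x} \<in> S" and case': "w = u \<or> (u \<notin> {w, x} \<and> w = v) \<or> ({u, v} \<inter> {w, x} = {} \<and> w \<in> C)
      \<or> ({u, v} \<inter> {w, x} = {} \<and> w \<notin> C \<and> x \<notin> C)" for w x
  proof -
    have eE: "{w, x} \<in> E" using e SE by blast
    have V: "w \<in> V" "x \<in> V" "w \<noteq> x" using edgeD[OF eE] by auto
    have xw: "x \<in> nbrs E w" "w \<in> nbrs E x" using eE by (auto simp: nbrs_iff insert_commute)
    consider (u) "w = u" | (v) "u \<notin> {w, x}" "w = v" | (C) "{u, v} \<inter> {w, x} = {}" "w \<in> C"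
      | (R) "{u, v} \<inter> {w, x} = {}" "w \<notin> C" "x \<notin> C" using case' by blast
    then show ?thesis
    proof cases
      case u
      have "x \<notin> C" using e u by (auto simp: S_def)
      then have "x \<notin> nbrs E v" using xw u by (auto simp: C_def N_def)
      then show ?thesis using u uv nbrs_irrefl[of u] zu by (auto simp: wt_def)
    next
      case v
      have "x \<notin> C" using e v by (auto simp: S_def)
      then have "x \<notin> nbrs E u" using xw v by (auto simp: C_def N_def)
      then show ?thesis using v uv nbrs_irrefl[of v] z1[OF vV(1)] by (auto simp: wt_def)
    next
      \<comment> \<open>The end w is adjacent to both u and v, and x to neither, so the weight is 2
        z x. This is where the threshold 1/2 is needed.\<close>
      case C
      have "x \<notin> N" "x \<notin> nbrs E v" using no_triangle_u[OF C(2) _ xw(1)] no_triangle_v[OF C(2) _ xw(1)] by auto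
      moreover from this have "x \<in> R" using V C by (auto simp: R_def C_def)
      ultimately show ?thesis using small[of x] by (auto simp: wt_def N_def)
    next
      \<comment> \<open>Neither end is adjacent to both u and v, so the weight is at most z w + z
        x.\<close>
      case R
      then have R': "w \<in> R" "x \<in> R" using V by (auto simp: R_def)
      have "\<not> (w \<in> nbrs E u \<and> w \<in> nbrs E v)" "\<not> (x \<in> nbrs E u \<and> x \<in> nbrs E v)"
        using R by (auto simp: C_def N_def)
      then show ?thesis using small[OF R'(1)] small[OF R'(2)] z0[of w] z0[of x] by (auto simp: wt_def)
    qed
  qed
  have e': "{x, w} \<in> S" using e by (simp add: insert_commute)
  have "(wt u w x + wt v w x + (wt u x w + wt v x w) \<le> 1 \<and> (u \<notin> {w, x} \<longrightarrow> wt u w x + wt u x w < 1))"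
  proof (cases "w = u \<or> (u \<notin> {w, x} \<and> w = v) \<or> ({u, v} \<inter> {w, x} = {} \<and> w \<in> C)
      \<or> ({u, v} \<inter> {w, x} = {} \<and> w \<notin> C \<and> x \<notin> C)")
    case True
    show ?thesis by (rule gen[OF e True])
  next
    case False
    then have "x = u \<or> (u \<notin> {x, w} \<and> x = v) \<or> ({u, v} \<inter> {x, w} = {} \<and> x \<in> C)
      \<or> ({u, v} \<inter> {x, w} = {} \<and> x \<notin> C \<and> w \<notin> C)" by auto
    from gen[OF e' this] show ?thesis by (simp add: insert_commute add.commute add.left_commute)
  qed
  then show "wt u w x + wt v w x + (wt u x w + wt v x w) \<le> 1"
    and "u \<notin> {w, x} \<Longrightarrow> wt u w x + wt u x w < 1" by blast+
qed

lemma hub_extremal: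
  assumes n: "card V = t + s + 2" "3 * s + 6 \<le> t" and b: "card (bridges E) = s"
    and L1: "real t + real s / 2 \<le> lam * lam - real t"
    and L2: "(real t)\<^sup>2 \<le> (lam * lam - real t) * (lam * lam - real t - real s)"
    and big: "12 * t \<le> 12 * c v + 11 * s"
  shows "(lam * lam - real t) * (lam * lam - real t - real s) = (real t)\<^sup>2"
    and "card C = t" "card R = s" "S = (\<lambda>y. {u, y}) ` R"
proof -
  have L: "2 * real t + real s / 2 \<le> lam * lam" using L1 by simp
  note small = R_small[OF n b L big]
  interpret S: fin_graph V S by (rule subgraph[OF SE])
  have T: "3 * real s + 6 \<le> real t" "0 \<le> real s" using n(2) by linarith+
  have cC: "c v = card C" by (rule vV(5))
  have Sb: "card S + 2 * card C \<le> 2 * t + s" using S_bound b n by simp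
  have "s \<le> card S" using card_mono[OF S.finE bridges_S] b by simp
  then have Ct: "card C \<le> t" using Sb by linarith
  have ex: "excess u + excess v \<le> real (card S)"
    using S.sum_edges_le(1)[of "\<lambda>w x. wt u w x + wt v w x"] edge_weight(1)[OF small]
    by (simp add: excess_wt sum.distrib)
  have Su: "excess u \<le> real (card S)" using ex excess_nonneg[of v] by simp
  have "real (card S + 2 * card C) \<le> real (2 * t + s)" using Sb by (simp only: of_nat_le_iff)
  then have Sr: "real (card S) \<le> real s + 2 * (real t - real (card C))" by simp
  have eu: "lam * lam = real (card C) * (1 + z v) + excess u" using hub_eq[of u] zu by simp
  have ev: "lam * lam * z v = real (card C) * (1 + z v) + excess v" using hub_eq[of v] by simp
  \<comment> \<open>Eliminating z v from the equations at u and v.\<close>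
  have "(lam * lam - real (card C) - excess u) * (lam * lam - real (card C))
      = real (card C) * ((lam * lam - real (card C)) * z v)"
    using eu by (simp add: algebra_simps)
  also have "(lam * lam - real (card C)) * z v = real (card C) + excess v"
    using ev by (simp add: algebra_simps)
  finally have eq: "(lam * lam - real (card C) - excess u) * (lam * lam - real (card C))
      = real (card C) * (real (card C) + excess v)" .
  have "real (12 * t) \<le> real (12 * card C + 11 * s)" using big unfolding cC by (simp only: of_nat_le_iff)
  then have sc: "real s < 2 * real (card C)" using T by simp
  have "excess u + excess v \<le> real s + 2 * (real t - real (card C))" using ex Sr by simp
  note he = hub_equation[OF _ T(2) L1 L2 _ sc excess_nonneg excess_nonneg this eq]
  show "(lam * lam - real t) * (lam * lam - real t - real s) = (real t)\<^sup>2"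
    using he(2) T Ct by simp
  show Ceq: "card C = t" using he(1) T Ct by simp
  \<comment> \<open>Now s \<le> excess u \<le> |S| \<le> s + 2(t - |C|) = s, so every edge of
    \<open>S\<close> attains weight 1 in \<open>excess u\<close> and must contain u.\<close>
  have "real s \<le> excess u" using he(3) T Ct by simp
  then have cS: "card S = s" and full: "excess u = real (card S)" using Su Sr Ceq by simp_all
  have "card V = card ({u, v} \<union> C \<union> R)" using uV vV CV by (intro arg_cong[of _ _ card]) (auto simp: R_def)
  also have "\<dots> = card ({u, v} \<union> C) + card R"
    by (rule card_Un_disjoint) (use CV RV in \<open>auto simp: R_def\<close>)
  also have "card ({u, v} \<union> C) = card {u, v} + card C"
    by (rule card_Un_disjoint) (use CV in auto)
  finally show cR: "card R = s" using vV(3) Ceq n by simp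
  have le1: "wt u w x + wt u x w \<le> 1" if "{w, x} \<in> S" for w x
  proof -
    have "0 \<le> wt v w x" "0 \<le> wt v x w" using z0 by (auto simp: wt_def)
    then show ?thesis using edge_weight(1)[OF small that] by linarith
  qed
  have "S \<subseteq> (\<lambda>y. {u, y}) ` R"
  proof
    fix e assume e: "e \<in> S"
    then obtain w x where wx: "e = {w, x}" using S.edge_ex by blast
    have "wt u w x + wt u x w = 1"
      using S.sum_edges_le(2)[of "wt u", OF le1] full e wx by (simp add: excess_wt)
    then have "u \<in> {w, x}" using edge_weight(2)[OF small, of w x] e wx by auto
    then obtain y where y: "e = {u, y}" using wx by (auto simp: insert_commute)
    have "y \<in> nbrs E u" using e SE y by (auto simp: nbrs_iff)
    moreover have "y \<notin> C" using e y by (auto simp: S_def)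
    ultimately have "y \<in> R" using nbrs_subset nbrs_irrefl[of u] uv by (auto simp: R_def)
    then show "e \<in> (\<lambda>y. {u, y}) ` R" using y by blast
  qed
  moreover have "card ((\<lambda>y. {u, y}) ` R) \<le> card S" using card_image_le[OF RV(2)] cR cS by simp
  ultimately show "S = (\<lambda>y. {u, y}) ` R" using RV(2) by (intro card_subset_eq[OF finite_imageI]) (auto simp: le_antisym card_mono)
qed

end

section \<open>Recognising the extremal graph, its eigenvector, and the final comparison\<close>

lemma K2_star_adj:
  "{i, j} \<in> edges (K2_star s t) \<longleftrightarrow>
     (i = 0 \<or> i = 1) \<and> j \<in> {2..<t + 2} \<or> (j = 0 \<or> j = 1) \<and> i \<in> {2..<t + 2} \<or>
     i = 0 \<and> j \<in> {t + 2..<t + s + 2} \<or> j = 0 \<and> i \<in> {t + 2..<t + s + 2}"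
  (is "?l \<longleftrightarrow> ?r")
proof
  assume ?l
  then consider h m where "{i, j} = {h, m}" "h = 0 \<or> h = 1" "m \<in> {2..<t + 2}"
    | l where "{i, j} = {0, l}" "l \<in> {t + 2..<t + s + 2}"
    unfolding K2_star_def edges_def by auto
  then show ?r by cases (auto simp: doubleton_eq_iff)
next
  have A: "{h, m} \<in> edges (K2_star s t)" if "h = 0 \<or> h = 1" "m \<in> {2..<t + 2}" for h m
    using that unfolding K2_star_def edges_def by auto
  have B: "{0, l} \<in> edges (K2_star s t)" if "l \<in> {t + 2..<t + s + 2}" for l
    using that unfolding K2_star_def edges_def by auto
  assume ?r
  then show ?l using A[of i j] A[of j i] B[of i] B[of j] by (auto simp only: insert_commute)
qed

lemma verts_K2_star: "verts (K2_star s t) = {..<t + s + 2}"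
  by (simp add: K2_star_def verts_def)

lemma K2_star_iso:
  assumes V: "verts G = {u, v} \<union> C \<union> R" and fin: "finite C" "finite R"
    and dis: "u \<noteq> v" "u \<notin> C" "v \<notin> C" "u \<notin> R" "v \<notin> R" "C \<inter> R = {}"
    and card: "card C = t" "card R = s"
    and E: "edges G = (\<lambda>w. {u, w}) ` C \<union> (\<lambda>w. {v, w}) ` C \<union> (\<lambda>y. {u, y}) ` R"
  shows "graph_iso G (K2_star s t)"
proof -
  obtain g where g: "bij_betw g C {2..<t + 2}"
    using finite_same_card_bij[of C "{2..<t + 2}"] fin card by auto
  obtain h where h: "bij_betw h R {t + 2..<t + s + 2}"
    using finite_same_card_bij[of R "{t + 2..<t + s + 2}"] fin card by auto
  define f where "f x = (if x = u then 0 else if x = v then 1 else if x \<in> C then g x else h x)" for x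
  have gC: "g x \<in> {2..<t + 2}" if "x \<in> C" for x using g that by (rule bij_betwE[rule_format])
  have hR: "h x \<in> {t + 2..<t + s + 2}" if "x \<in> R" for x using h that by (rule bij_betwE[rule_format])
  have fv: "f u = 0" "f v = 1" "x \<in> C \<Longrightarrow> f x = g x" "x \<in> R \<Longrightarrow> f x = h x" for x
    using dis by (auto simp: f_def)
  \<comment> \<open>Adjacency in both graphs depends only on membership in the four classes, so it
    suffices that f matches the classes.\<close>
  have cls: "f x = 0 \<longleftrightarrow> x = u" "f x = 1 \<longleftrightarrow> x = v" "f x \<in> {2..<t + 2} \<longleftrightarrow> x \<in> C"
    "f x \<in> {t + 2..<t + s + 2} \<longleftrightarrow> x \<in> R" if "x \<in> verts G" for x
  proof -
    consider "x = u" | "x = v" | "x \<in> C" | "x \<in> R" using \<open>x \<in> verts G\<close> V by auto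
    then have "(f x = 0 \<longleftrightarrow> x = u) \<and> (f x = 1 \<longleftrightarrow> x = v) \<and> (f x \<in> {2..<t + 2} \<longleftrightarrow> x \<in> C) \<and>
      (f x \<in> {t + 2..<t + s + 2} \<longleftrightarrow> x \<in> R)"
    proof cases
      case 3
      then show ?thesis using gC[OF 3] fv(3)[OF 3] dis by auto
    next
      case 4
      then show ?thesis using hR[OF 4] fv(4)[OF 4] dis by auto
    qed (use fv dis in auto)
    then show "f x = 0 \<longleftrightarrow> x = u" "f x = 1 \<longleftrightarrow> x = v" "f x \<in> {2..<t + 2} \<longleftrightarrow> x \<in> C"
      "f x \<in> {t + 2..<t + s + 2} \<longleftrightarrow> x \<in> R" by simp_all
  qed
  have "inj_on f (verts G)"
  proof (rule inj_onI)
    fix x y assume xy: "x \<in> verts G" "y \<in> verts G" "f x = f y"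
    consider "x = u" | "x = v" | "x \<in> C" | "x \<in> R" using xy(1) V by auto
    then show "x = y"
    proof cases
      case 1 then show ?thesis using cls(1)[OF xy(1)] cls(1)[OF xy(2)] xy(3) by metis
    next
      case 2 then show ?thesis using cls(2)[OF xy(1)] cls(2)[OF xy(2)] xy(3) by metis
    next
      case 3
      then have "y \<in> C" using cls(3)[OF xy(1)] cls(3)[OF xy(2)] xy(3) by metis
      then have "g x = g y" using 3 xy(3) fv(3) by metis
      then show ?thesis using inj_onD[OF bij_betw_imp_inj_on[OF g]] 3 \<open>y \<in> C\<close> by metis
    next
      case 4
      then have "y \<in> R" using cls(4)[OF xy(1)] cls(4)[OF xy(2)] xy(3) by metis
      then have "h x = h y" using 4 xy(3) fv(4) by metis
      then show ?thesis using inj_onD[OF bij_betw_imp_inj_on[OF h]] 4 \<open>y \<in> R\<close> by metis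
    qed
  qed
  moreover have "f ` verts G = {..<t + s + 2}"
  proof -
    have "f ` verts G = {0, 1} \<union> f ` C \<union> f ` R"
      unfolding V image_Un image_insert image_empty fv(1,2) ..
    also have "f ` C = {2..<t + 2}" using bij_betw_imp_surj_on[OF g] image_cong[OF refl fv(3), of C] by simp
    also have "f ` R = {t + 2..<t + s + 2}" using bij_betw_imp_surj_on[OF h] image_cong[OF refl fv(4), of R] by simp
    finally show ?thesis by auto
  qed
  ultimately have "bij_betw f (verts G) (verts (K2_star s t))"
    by (simp add: bij_betw_def verts_K2_star)
  moreover have "{x, y} \<in> edges G \<longleftrightarrow> {f x, f y} \<in> edges (K2_star s t)"
    if xy: "x \<in> verts G" "y \<in> verts G" for x y
  proof -
    have "{x, y} \<in> edges G \<longleftrightarrow> (x = u \<or> x = v) \<and> y \<in> C \<or> (y = u \<or> y = v) \<and> x \<in> C \<or>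
        x = u \<and> y \<in> R \<or> y = u \<and> x \<in> R"
      unfolding E by (auto simp: doubleton_eq_iff image_iff)
    then show ?thesis unfolding K2_star_adj cls[OF xy(1)] cls[OF xy(2)] .
  qed
  ultimately show ?thesis unfolding graph_iso_def by blast
qed

lemma eigenfun_iso:
  assumes G: "simple_graph G" and H: "\<And>i j. {i, j} \<in> edges H \<Longrightarrow> i \<in> verts H \<and> j \<in> verts H"
    and f: "bij_betw f (verts G) (verts H)"
      "\<And>x y. x \<in> verts G \<Longrightarrow> y \<in> verts G \<Longrightarrow> {x, y} \<in> edges G \<longleftrightarrow> {f x, f y} \<in> edges H"
    and g: "eigenfun (verts H) (edges H) \<mu> g"
  shows "eigenfun (verts G) (edges G) \<mu> (g \<circ> f)"
proof -
  interpret fin_graph "verts G" "edges G" using G by (simp add: simple_graph_fin_graph)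
  have img: "f ` verts G = verts H" and inj: "inj_on f (verts G)" using f(1) by (auto simp: bij_betw_def)
  have "\<mu> * g (f x) = (\<Sum>y\<in>nbrs (edges G) x. g (f y))" if x: "x \<in> verts G" for x
  proof -
    have fx: "f x \<in> verts H" using x img by auto
    have nb: "nbrs (edges H) (f x) = f ` nbrs (edges G) x"
    proof (intro subset_antisym subsetI)
      fix j assume j: "j \<in> nbrs (edges H) (f x)"
      then have "j \<in> verts H" using H by (auto simp: nbrs_iff)
      then obtain y where "y \<in> verts G" "j = f y" using img by auto
      then show "j \<in> f ` nbrs (edges G) x" using j f(2)[OF x] by (auto simp: nbrs_iff)
    next
      fix j assume "j \<in> f ` nbrs (edges G) x"
      then obtain y where y: "y \<in> nbrs (edges G) x" "j = f y" by auto
      then have "y \<in> verts G" using nbrs_subset by auto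
      then show "j \<in> nbrs (edges H) (f x)" using y f(2)[OF x] by (auto simp: nbrs_iff)
    qed
    have "\<mu> * g (f x) = (\<Sum>j\<in>nbrs (edges H) (f x). g j)" using g fx by (simp add: eigenfun_def)
    also have "\<dots> = (\<Sum>y\<in>nbrs (edges G) x. g (f y))"
      unfolding nb using sum.reindex[of f "nbrs (edges G) x" g] inj_on_subset[OF inj nbrs_subset] by simp
    finally show ?thesis .
  qed
  moreover have "\<exists>x\<in>verts G. g (f x) \<noteq> 0"
  proof -
    have "\<exists>j\<in>f ` verts G. g j \<noteq> 0" using g unfolding img by (simp add: eigenfun_def)
    then show ?thesis by blast
  qed
  ultimately show ?thesis by (simp add: eigenfun_def)
qed

text \<open>The top eigenvector of the extremal graph takes one value on each of the four vertex classes.\<close>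

lemma K2_star_eigenfun:
  fixes L \<mu> :: real
  assumes \<mu>: "\<mu> * \<mu> = L" "0 < \<mu>" and t: "0 < t"
    and L: "(L - real t) * (L - real t - real s) = (real t)\<^sup>2"
  shows "\<exists>g. eigenfun (verts (K2_star s t)) (edges (K2_star s t)) \<mu> g"
proof -
  \<comment> \<open>Scaled so that the leaves get L - t; the equations at the leaves, the middle
    vertices and vertex 1 then hold by choice of the values. The one at the centre 0 is the
    quadratic assumed for L.\<close>
  define g :: "nat \<Rightarrow> real" where
    "g i = (if i = 0 then \<mu> * (L - t) else if i = 1 then \<mu> * t else if i < t + 2 then L else L - t)" for i
  let ?E = "edges (K2_star s t)"
  have n: "nbrs ?E 0 = {2..<t + 2} \<union> {t + 2..<t + s + 2}" "nbrs ?E 1 = {2..<t + 2}"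
    "i \<in> {2..<t + 2} \<Longrightarrow> nbrs ?E i = {0, 1}" "i \<in> {t + 2..<t + s + 2} \<Longrightarrow> nbrs ?E i = {0}" for i
    unfolding nbrs_def K2_star_adj by auto
  have m: "(\<Sum>i\<in>{2..<t + 2}. g i) = t * L" by (simp add: g_def)
  have l: "(\<Sum>i\<in>{t + 2..<t + s + 2}. g i) = s * (L - t)" by (simp add: g_def)
  have "\<mu> * g i = (\<Sum>j\<in>nbrs ?E i. g j)" if "i \<in> verts (K2_star s t)" for i
  proof -
    consider "i = 0" | "i = 1" | "i \<in> {2..<t + 2}" | "i \<in> {t + 2..<t + s + 2}"
      using \<open>i \<in> verts (K2_star s t)\<close> unfolding verts_K2_star by fastforce
    then show ?thesis
    proof cases
      case 1
      have "(\<Sum>j\<in>nbrs ?E 0. g j) = t * L + s * (L - t)"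
        unfolding n(1) m[symmetric] l[symmetric] by (rule sum.union_disjoint) auto
      moreover have "\<mu> * g 0 = L * (L - t)" using \<mu> by (simp add: g_def flip: mult.assoc)
      moreover have "L * (L - t) = t * L + s * (L - t)" using L by (simp add: algebra_simps power2_eq_square)
      ultimately show ?thesis using 1 by simp
    next
      case 2
      have "\<mu> * g 1 = L * t" using \<mu> by (simp add: g_def flip: mult.assoc)
      then show ?thesis using 2 m n(2) by simp
    next
      case 3
      then have "g i = L" by (simp add: g_def)
      then show ?thesis unfolding n(3)[OF 3] by (simp add: g_def algebra_simps)
    next
      case 4
      then have "g i = L - t" by (simp add: g_def)
      then show ?thesis unfolding n(4)[OF 4] by (simp add: g_def)
    qed
  qed
  moreover have "g 1 \<noteq> 0" "1 \<in> verts (K2_star s t)" using \<mu> t by (auto simp: g_def verts_K2_star)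
  ultimately show ?thesis unfolding eigenfun_def by blast
qed

text \<open>The square of the claimed bound for s = k - 2 and t = n - k, that is, the larger root of
  (L - t)(L - t - s) = t^2.\<close>

definition radius_sq :: "nat \<Rightarrow> nat \<Rightarrow> real" where
  "radius_sq s t = (2 * real t + real s + sqrt (4 * (real t)\<^sup>2 + (real s)\<^sup>2)) / 2"

lemma radius_sq:
  shows "real t + real s / 2 \<le> radius_sq s t - real t"
    and "(radius_sq s t - real t) * (radius_sq s t - real t - real s) = (real t)\<^sup>2"
proof -
  define w where "w = sqrt (4 * (real t)\<^sup>2 + (real s)\<^sup>2) / 2"
  have r: "radius_sq s t - real t = real s / 2 + w" by (simp add: radius_sq_def w_def field_simps)
  have "sqrt ((2 * real t)\<^sup>2) \<le> sqrt (4 * (real t)\<^sup>2 + (real s)\<^sup>2)"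
    by (rule real_sqrt_le_mono) (simp add: power_mult_distrib)
  then have "2 * real t \<le> sqrt (4 * (real t)\<^sup>2 + (real s)\<^sup>2)" by (simp only: real_sqrt_abs)
  then have "real t \<le> w" by (simp add: w_def)
  then show "real t + real s / 2 \<le> radius_sq s t - real t" unfolding r by simp
  have "w\<^sup>2 = (4 * (real t)\<^sup>2 + (real s)\<^sup>2) / 4" by (simp add: w_def power_divide)
  then show "(radius_sq s t - real t) * (radius_sq s t - real t - real s) = (real t)\<^sup>2"
    unfolding r by (simp add: power2_eq_square field_simps)
qed

lemma radius_sq_unique:
  assumes "real t + real s / 2 \<le> L - real t" "(L - real t) * (L - real t - real s) = (real t)\<^sup>2"
  shows "L = radius_sq s t"
proof -
  have "(L - real t - real s / 2)\<^sup>2 = (radius_sq s t - real t - real s / 2)\<^sup>2"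
    using assms(2) radius_sq(2)[of s t] by (simp add: power2_eq_square algebra_simps)
  then have "L - real t - real s / 2 = radius_sq s t - real t - real s / 2"
    by (rule power2_eq_imp_eq) (use assms(1) radius_sq(1)[of t s] in auto)
  then show ?thesis by simp
qed

lemma extremal_of_large_radius:
  assumes k: "2 \<le> k" and G: "simple_graph G" and mec: "minimally_edge_connected k k G"
    and n: "card (verts G) = t + s + 2" "k = s + 2" "3 * s + 6 \<le> t"
    and large: "sqrt (radius_sq s t) \<le> graph_spectral_radius G"
  shows "graph_spectral_radius G = sqrt (radius_sq s t) \<and> graph_iso G (K2_star s t)"
proof -
  define V where "V = verts G"
  define E where "E = edges G"
  define lam where "lam = graph_spectral_radius G"
  interpret fin_graph V E using G by (simp add: simple_graph_fin_graph V_def E_def)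
  have kV: "k \<le> card (verts G)" using n by simp
  have tcE: "two_cuts E" unfolding E_def by (rule minimally_two_cuts[OF G mec k kV])
  have ec: "edge_connected k k G" using mec by (simp add: minimally_edge_connected_def)
  have con: "V \<noteq> {}" "\<And>x y. x \<in> V \<Longrightarrow> y \<in> V \<Longrightarrow> conn E x y"
    using ec by (auto simp: edge_connected_def connected_graph_conn V_def E_def)
  have bs: "card (bridges E) \<le> s" using few_bridges[OF G ec k kV] n by (simp add: E_def)
  obtain z where z: "\<And>x. 0 \<le> z x" "eigenfun V E lam z"
    using spectral_radius_eigenfun[OF G] con(1) unfolding V_def E_def lam_def by metis
  have "Max (z ` V) \<in> z ` V" using fin con(1) by (intro Max_in) auto
  then obtain u where u: "u \<in> V" "z u = Max (z ` V)" by auto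
  then have umax: "z x \<le> z u" if "x \<in> V" for x using that fin by simp
  obtain x0 where "x0 \<in> V" "z x0 \<noteq> 0" using z(2) by (auto simp: eigenfun_def)
  then have zu: "0 < z u" using umax[of x0] z(1)[of x0] by linarith
  have r0: "0 < radius_sq s t" using radius_sq(1)[of t s] n(3) by linarith
  have lam0: "0 < lam" using large r0 by (simp add: lam_def order_less_le_trans[OF real_sqrt_gt_zero])
  interpret top_eigen V E lam "\<lambda>x. z x / z u" u
  proof
    fix x assume x: "x \<in> V"
    show "lam * (z x / z u) = (\<Sum>y\<in>nbrs E x. z y / z u)"
      using z(2) x by (simp add: eigenfun_def sum_divide_distrib[symmetric])
    show "z x / z u \<le> 1" using umax[OF x] zu by simp
  qed (use tcE con u z(1) zu lam0 in auto)
  have "radius_sq s t = sqrt (radius_sq s t) * sqrt (radius_sq s t)" using r0 by simp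
  also have "\<dots> \<le> lam * lam" using large r0 lam0 by (intro mult_mono) (auto simp: lam_def)
  finally have Lr: "radius_sq s t \<le> lam * lam" .
  then have L1: "real t + real s / 2 \<le> lam * lam - real t" using radius_sq(1)[of t s] by linarith
  have L2: "(real t)\<^sup>2 \<le> (lam * lam - real t) * (lam * lam - real t - real s)"
    unfolding radius_sq(2)[of s t, symmetric]
  proof (rule mult_mono)
    have "0 \<le> real t - real s / 2" using n(3) by linarith
    then show "0 \<le> radius_sq s t - real t - real s" using radius_sq(1)[of t s] by linarith
  qed (use Lr L1 in auto)
  have L: "2 * real t + real s / 2 \<le> lam * lam" using L1 by linarith
  have cV: "card V = t + s + 2" using n by (simp add: V_def)
  have b: "card (bridges E) = s"
  proof (rule ccontr)
    assume "card (bridges E) \<noteq> s"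
    then have "card (bridges (edges G)) < k - 2" using bs n by (simp add: E_def)
    from two_partners_impossible[OF _ cV n(3) L] minimally_two_partners[OF G mec k kV this]
    show False unfolding E_def by blast
  qed
  obtain v where v: "v \<in> H" "12 * t \<le> 12 * c v + 11 * s" using big_hub(2)[OF cV n(3) b L] by blast
  interpret top_hub V E lam "\<lambda>x. z x / z u" u v by unfold_locales (rule v(1))
  note ext = hub_extremal[OF cV n(3) b L1 L2 v(2)]
  have "lam * lam = radius_sq s t" by (rule radius_sq_unique[OF L1 ext(1)])
  then have "lam = sqrt (radius_sq s t)" using lam0 by (simp add: real_sqrt_unique power2_eq_square)
  moreover have "graph_iso G (K2_star s t)"
  proof (rule K2_star_iso[OF _ CV(2) RV(2) _ CV(3,4) _ _ _ ext(2,3)])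
    have "V = {u, v} \<union> C \<union> R" using uV vV(1) CV(1) by (auto simp: R_def)
    then show "verts G = {u, v} \<union> C \<union> R" by (simp only: V_def)
    show "edges G = (\<lambda>w. {u, w}) ` C \<union> (\<lambda>w. {v, w}) ` C \<union> (\<lambda>y. {u, y}) ` R"
    proof -
      have "E = (\<lambda>w. {u, w}) ` C \<union> (\<lambda>w. {v, w}) ` C \<union> S" using CE by (auto simp: S_def)
      then have "E = (\<lambda>w. {u, w}) ` C \<union> (\<lambda>w. {v, w}) ` C \<union> (\<lambda>y. {u, y}) ` R" by (simp only: ext(4))
      then show ?thesis by (simp only: E_def)
    qed
  qed (use vV(3) in \<open>auto simp: R_def\<close>)
  ultimately show ?thesis by (simp add: lam_def)
qed

lemma radius_of_iso:
  assumes G: "simple_graph G" "verts G \<noteq> {}" and iso: "graph_iso G (K2_star s t)" and t: "0 < t"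
  shows "sqrt (radius_sq s t) \<le> graph_spectral_radius G"
proof -
  have r0: "0 < radius_sq s t" using radius_sq(1)[of t s] t by linarith
  obtain g where g: "eigenfun (verts (K2_star s t)) (edges (K2_star s t)) (sqrt (radius_sq s t)) g"
    using K2_star_eigenfun[OF _ _ t radius_sq(2), of "sqrt (radius_sq s t)"] r0 by auto
  obtain f where f: "bij_betw f (verts G) (verts (K2_star s t))"
    "\<And>x y. x \<in> verts G \<Longrightarrow> y \<in> verts G \<Longrightarrow> {x, y} \<in> edges G \<longleftrightarrow> {f x, f y} \<in> edges (K2_star s t)"
    using iso unfolding graph_iso_def by blast
  have "eigenfun (verts G) (edges G) (sqrt (radius_sq s t)) (g \<circ> f)"
    by (rule eigenfun_iso[OF G(1) _ f g]) (auto simp: K2_star_adj verts_K2_star)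
  then show ?thesis using spectral_radius_eigenfun[OF G] by metis
qed

theorem theorem1:
  fixes G :: "'a graph" and k n :: nat
  assumes "k \<ge> 2"
    and "simple_graph G"
    and "minimally_edge_connected k k G"
    and "card (verts G) = n"
    and "n \<ge> 4 * k"
  shows "graph_spectral_radius G
           \<le> sqrt (4 * real n - 2 * real k - 4
                    + 2 * sqrt (5 * (real k)\<^sup>2 - 8 * real k * real n + 4 * (real n)\<^sup>2
                                - 4 * real k + 4)) / 2 \<and>
         (graph_spectral_radius G
            = sqrt (4 * real n - 2 * real k - 4
                    + 2 * sqrt (5 * (real k)\<^sup>2 - 8 * real k * real n + 4 * (real n)\<^sup>2
                                - 4 * real k + 4)) / 2
          \<longleftrightarrow> graph_iso G (K2_star (k - 2) (n - k)))"
proof -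
  define s where "s = k - 2"
  define t where "t = n - k"
  have st: "n = t + s + 2" "k = s + 2" "3 * s + 6 \<le> t" using assms(1,5) by (auto simp: s_def t_def)
  have "5 * (real k)\<^sup>2 - 8 * real k * real n + 4 * (real n)\<^sup>2 - 4 * real k + 4 = 4 * (real t)\<^sup>2 + (real s)\<^sup>2"
    unfolding st by (simp add: power2_eq_square algebra_simps)
  moreover have "4 * real n - 2 * real k - 4 = 2 * (2 * real t + real s)" unfolding st by simp
  ultimately have "4 * real n - 2 * real k - 4 + 2 * sqrt (5 * (real k)\<^sup>2 - 8 * real k * real n + 4 * (real n)\<^sup>2
      - 4 * real k + 4) = 2\<^sup>2 * radius_sq s t"
    by (simp add: radius_sq_def)
  then have bound: "sqrt (4 * real n - 2 * real k - 4 + 2 * sqrt (5 * (real k)\<^sup>2 - 8 * real k * real n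
      + 4 * (real n)\<^sup>2 - 4 * real k + 4)) / 2 = sqrt (radius_sq s t)"
    by (simp add: real_sqrt_mult)
  have ne: "verts G \<noteq> {}" using assms(4) st by auto
  have ext: "graph_spectral_radius G = sqrt (radius_sq s t) \<and> graph_iso G (K2_star s t)"
    if "sqrt (radius_sq s t) \<le> graph_spectral_radius G"
    by (rule extremal_of_large_radius[OF assms(1-3) _ st(2,3) that]) (use assms(4) st in simp)
  have "graph_iso G (K2_star s t) \<Longrightarrow> sqrt (radius_sq s t) \<le> graph_spectral_radius G"
    using radius_of_iso[OF assms(2) ne] st(3) by simp
  \<comment> \<open>Below the bound no isomorphism is possible, by the implication just shown;
    otherwise \<open>ext\<close> gives both equality and the isomorphism.\<close>
  then show ?thesis
    unfolding bound s_def[symmetric] t_def[symmetric] using ext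
    by (cases "sqrt (radius_sq s t) \<le> graph_spectral_radius G") auto
qed

end
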